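(* Let $X$ be a compact Riemann surface, let $\mathcal{O}$ be its trivial holomorphic line bundle equipped with a constant hermitian metric $h_{\mathcal{O}}$, and let $h_{X,\infty}$ be an integrable metric on $X$. Then there exists a family $(h_{X,u})_{u\geq 1}$ of smooth hermitian metrics on $TX$, converging uniformly to $h_{X,\infty}$ as $u\to\infty$, such that for all $\xi,\xi'\in A^{(0,0)}(X)$: 1. $\lim_{u\to\infty}\|\Delta_{X,u}\xi\|^2_{L^2,u}=\|\Delta_{X,\infty}\xi\|^2_{L^2,\infty}<\infty$; 2. $\Delta_{X,\infty}$ is a linear operator from $A^{(0,0)}(X)$ to $\mathcal{H}_0(X)$; 3. $(\Delta_{X,\infty}\xi,\xi')_{L^2,\infty}=(\xi,\Delta_{X,\infty}\xi')_{L^2,\infty}$; 4. $(\Delta_{X,\infty}\xi,\xi)_{L^2,\infty}\geq 0$.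
   Context: $A^{(0,0)}(X)$ is the space of smooth complex functions on $X$. A continuous hermitian metric $\|\cdot\|$ on a holomorphic line bundle $L$ is positive if the current $c_1(L,\|\cdot\|)$, locally $dd^c(-\log\|s\|^2)$ for a non-vanishing local holomorphic section $s$, is $\geq 0$; it is admissible if it is the uniform limit of a sequence of smooth positive hermitian metrics on $L$. Uniform convergence of metrics $h_n\to h$ means that the functions $h_n/h$ converge uniformly to $1$ on $X$. An integrable metric on $X$ is a hermitian metric $h_{X,\infty}$ on the holomorphic tangent bundle $TX$ of the form $h_{1,\infty}\otimes h_{2,\infty}^{-1}$, where $h_{1,\infty},h_{2,\infty}$ are admissible metrics on holomorphic line bundles $L_1,L_2$ with $TX\simeq L_1\otimes L_2^{-1}$. For a continuous hermitian metric $h$ on $TX$, the normalized volume form is, in a local coordinate $z$, $\omega=\frac{i}{2\pi}h(\frac{\partial}{\partial z},\frac{\partial}{\partial z})\,dz\wedge d\overline z$; the $L^2$ product on functions is $(\xi,\xi')=\int_X \xi\overline{\xi'}\,h_{\mathcal{O}}(1,1)\,\omega$; and the associated Laplacian is $\Delta\xi=-h(\frac{\partial}{\partial z},\frac{\partial}{\partial z})^{-1}\frac{\partial^2\xi}{\partial z\,\partial\overline z}$ for $\xi\in A^{(0,0)}(X)$. For $h=h_{X,u}$ (respectively $h=h_{X,\infty}$) these are written with index $u$ (respectively $\infty$): $\omega_{X,u}$, $(\cdot,\cdot)_{L^2,u}$, $\|\cdot\|_{L^2,u}$, $\Delta_{X,u}$. $\mathcal{H}_0(X)$ is the completion of $A^{(0,0)}(X)$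 for the $L^2$ norm; it does not depend on the chosen continuous metric, since all these norms are equivalent. *)

theory Defs
  imports "HOL-Complex_Analysis.Complex_Analysis"
begin

section \<open>Smooth functions and Wirtinger derivatives in the plane\<close>

definition partial_x :: "(complex \<Rightarrow> 'b::real_normed_vector) \<Rightarrow> complex \<Rightarrow> 'b" where
  "partial_x f z = frechet_derivative f (at z) 1"

definition partial_y :: "(complex \<Rightarrow> 'b::real_normed_vector) \<Rightarrow> complex \<Rightarrow> 'b" where
  "partial_y f z = frechet_derivative f (at z) \<i>"

text \<open>Real differentiability of class \<open>C\<^sup>k\<close>; only used for open \<open>S\<close>.\<close>

primrec Ck_on :: "nat \<Rightarrow> (complex \<Rightarrow> 'b::real_normed_vector) \<Rightarrow> complex set \<Rightarrow> bool" where
  "Ck_on 0 f S \<longleftrightarrow> continuous_on S f"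
| "Ck_on (Suc k) f S \<longleftrightarrow>
     (\<forall>z\<in>S. f differentiable (at z)) \<and> Ck_on k (partial_x f) S \<and> Ck_on k (partial_y f) S"

definition smooth_on :: "complex set \<Rightarrow> (complex \<Rightarrow> 'b::real_normed_vector) \<Rightarrow> bool" where
  "smooth_on S f \<longleftrightarrow> (\<forall>k. Ck_on k f S)"

definition d_dz :: "(complex \<Rightarrow> complex) \<Rightarrow> complex \<Rightarrow> complex" where
  "d_dz f z = (partial_x f z - \<i> * partial_y f z) / 2"

definition d_dzbar :: "(complex \<Rightarrow> complex) \<Rightarrow> complex \<Rightarrow> complex" where
  "d_dzbar f z = (partial_x f z + \<i> * partial_y f z) / 2"


section \<open>Compact Riemann surfaces\<close>

text \<open>The points of the surface \<open>X\<close> are the elements of a Hausdorff topological type. A chart is a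
  pair of an open domain and a coordinate function, of which only the values on the domain matter.
  The complex structure is given by an atlas, which need not be maximal.\<close>

type_synonym 'a chart = "'a set \<times> ('a \<Rightarrow> complex)"

abbreviation chart_inv :: "'a chart \<Rightarrow> complex \<Rightarrow> 'a" where
  "chart_inv c \<equiv> inv_into (fst c) (snd c)"

definition is_chart :: "'a::topological_space chart \<Rightarrow> bool" where
  "is_chart c \<longleftrightarrow> open (fst c) \<and> open (snd c ` fst c)
     \<and> homeomorphism (fst c) (snd c ` fst c) (snd c) (chart_inv c)"

definition compact_riemann_surface :: "'a::t2_space chart set \<Rightarrow> bool" where
  "compact_riemann_surface A \<longleftrightarrow>
     compact (UNIV :: 'a set) \<and> connected (UNIV :: 'a set)
     \<and> (\<forall>c\<in>A. is_chart c) \<and> (\<Union>c\<in>A. fst c) = UNIV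
     \<and> (\<forall>c\<in>A. \<forall>d\<in>A. (snd c \<circ> chart_inv d) holomorphic_on (snd d ` (fst c \<inter> fst d)))"

definition smooth_on_surface ::
  "'a chart set \<Rightarrow> 'a set \<Rightarrow> ('a \<Rightarrow> 'b::real_normed_vector) \<Rightarrow> bool" where
  "smooth_on_surface A W f \<longleftrightarrow> (\<forall>c\<in>A. smooth_on (snd c ` (fst c \<inter> W)) (f \<circ> chart_inv c))"

definition holomorphic_on_surface :: "'a chart set \<Rightarrow> 'a set \<Rightarrow> ('a \<Rightarrow> complex) \<Rightarrow> bool" where
  "holomorphic_on_surface A W f \<longleftrightarrow>
     (\<forall>c\<in>A. (f \<circ> chart_inv c) holomorphic_on (snd c ` (fst c \<inter> W)))"

definition A00 :: "'a chart set \<Rightarrow> ('a \<Rightarrow> complex) set" where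
  "A00 A = {\<xi>. smooth_on_surface A UNIV \<xi>}"


section \<open>Holomorphic line bundles\<close>

text \<open>A holomorphic line bundle is given by local frames \<open>e\<^sub>i\<close> over the members \<open>U\<^sub>i\<close> of an open cover
  and by the transition functions \<open>g\<^sub>i\<^sub>j\<close> defined by \<open>e\<^sub>j = g\<^sub>i\<^sub>j e\<^sub>i\<close> on \<open>U\<^sub>i \<inter> U\<^sub>j\<close>. Hence the components
  \<open>s\<^sub>i\<close> of a section \<open>s = s\<^sub>i e\<^sub>i\<close> satisfy \<open>s\<^sub>i = g\<^sub>i\<^sub>j s\<^sub>j\<close>. A family indexed by the cover is only
  relevant over the corresponding set \<open>U\<^sub>i\<close>.\<close>

record ('i, 'a) line_bundle =
  lb_index :: "'i set"
  lb_dom :: "'i \<Rightarrow> 'a set"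
  lb_trans :: "'i \<Rightarrow> 'i \<Rightarrow> 'a \<Rightarrow> complex"

definition holomorphic_line_bundle ::
  "'a::topological_space chart set \<Rightarrow> ('i, 'a) line_bundle \<Rightarrow> bool" where
  "holomorphic_line_bundle A L \<longleftrightarrow>
     (\<forall>i\<in>lb_index L. open (lb_dom L i)) \<and> (\<Union>i\<in>lb_index L. lb_dom L i) = UNIV
     \<and> (\<forall>i\<in>lb_index L. \<forall>j\<in>lb_index L.
          holomorphic_on_surface A (lb_dom L i \<inter> lb_dom L j) (lb_trans L i j)
          \<and> (\<forall>x\<in>lb_dom L i \<inter> lb_dom L j. lb_trans L i j x \<noteq> 0))
     \<and> (\<forall>i\<in>lb_index L. \<forall>j\<in>lb_index L. \<forall>k\<in>lb_index L.
          \<forall>x\<in>lb_dom L i \<inter> lb_dom L j \<inter> lb_dom L k.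
            lb_trans L i j x * lb_trans L j k x = lb_trans L i k x)"

definition trivial_bundle :: "(unit, 'a) line_bundle" where
  "trivial_bundle = \<lparr>lb_index = UNIV, lb_dom = (\<lambda>_. UNIV), lb_trans = (\<lambda>_ _ _. 1)\<rparr>"

text \<open>The frame of the tangent bundle over the domain of a chart with coordinate \<open>z\<^sub>c\<close> is
  \<open>\<partial>/\<partial>z\<^sub>c\<close>, and \<open>\<partial>/\<partial>z\<^sub>d = (dz\<^sub>c/dz\<^sub>d) \<partial>/\<partial>z\<^sub>c\<close>.\<close>

definition tangent_bundle :: "'a chart set \<Rightarrow> ('a chart, 'a) line_bundle" where
  "tangent_bundle A = \<lparr>lb_index = A, lb_dom = fst,
     lb_trans = (\<lambda>c d x. deriv (snd c \<circ> chart_inv d) (snd d x))\<rparr>"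

definition tensor_bundle ::
  "('i, 'a) line_bundle \<Rightarrow> ('j, 'a) line_bundle \<Rightarrow> ('i \<times> 'j, 'a) line_bundle" where
  "tensor_bundle L M = \<lparr>lb_index = lb_index L \<times> lb_index M,
     lb_dom = (\<lambda>(i, j). lb_dom L i \<inter> lb_dom M j),
     lb_trans = (\<lambda>(i, j) (i', j') x. lb_trans L i i' x * lb_trans M j j' x)\<rparr>"

definition dual_bundle :: "('i, 'a) line_bundle \<Rightarrow> ('i, 'a) line_bundle" where
  "dual_bundle L = \<lparr>lb_index = lb_index L, lb_dom = lb_dom L,
     lb_trans = (\<lambda>i j x. inverse (lb_trans L i j x))\<rparr>"

text \<open>An isomorphism \<open>L \<simeq> M\<close> maps the frame \<open>e\<^sub>i\<close> of \<open>L\<close> to \<open>f\<^sub>j\<^sub>i \<epsilon>\<^sub>j\<close>, where \<open>\<epsilon>\<^sub>j\<close> is the frame of \<open>M\<close>;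
  the last condition expresses the independence of the frames.\<close>

definition line_bundle_iso ::
  "'a chart set \<Rightarrow> ('i, 'a) line_bundle \<Rightarrow> ('j, 'a) line_bundle \<Rightarrow> ('j \<Rightarrow> 'i \<Rightarrow> 'a \<Rightarrow> complex) \<Rightarrow> bool" where
  "line_bundle_iso A L M f \<longleftrightarrow>
     (\<forall>i\<in>lb_index L. \<forall>j\<in>lb_index M.
        holomorphic_on_surface A (lb_dom L i \<inter> lb_dom M j) (f j i)
        \<and> (\<forall>x\<in>lb_dom L i \<inter> lb_dom M j. f j i x \<noteq> 0))
     \<and> (\<forall>i\<in>lb_index L. \<forall>i'\<in>lb_index L. \<forall>j\<in>lb_index M. \<forall>j'\<in>lb_index M.
          \<forall>x\<in>lb_dom L i \<inter> lb_dom L i' \<inter> lb_dom M j \<inter> lb_dom M j'.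
            f j i x * lb_trans L i i' x = lb_trans M j j' x * f j' i' x)"

definition holomorphic_section ::
  "'a chart set \<Rightarrow> ('i, 'a) line_bundle \<Rightarrow> 'a set \<Rightarrow> ('i \<Rightarrow> 'a \<Rightarrow> complex) \<Rightarrow> bool" where
  "holomorphic_section A L V s \<longleftrightarrow>
     (\<forall>i\<in>lb_index L. holomorphic_on_surface A (V \<inter> lb_dom L i) (s i))
     \<and> (\<forall>i\<in>lb_index L. \<forall>j\<in>lb_index L. \<forall>x\<in>V \<inter> lb_dom L i \<inter> lb_dom L j.
          s i x = lb_trans L i j x * s j x)"

definition nonvanishing_section ::
  "('i, 'a) line_bundle \<Rightarrow> 'a set \<Rightarrow> ('i \<Rightarrow> 'a \<Rightarrow> complex) \<Rightarrow> bool" where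
  "nonvanishing_section L V s \<longleftrightarrow> (\<forall>i\<in>lb_index L. \<forall>x\<in>V \<inter> lb_dom L i. s i x \<noteq> 0)"


section \<open>Hermitian metrics\<close>

text \<open>A hermitian metric \<open>h\<close> on \<open>L\<close> is given by the functions \<open>h\<^sub>i = h(e\<^sub>i, e\<^sub>i) = \<parallel>e\<^sub>i\<parallel>\<^sup>2\<close>. For the
  tangent bundle, \<open>h c x\<close> is thus \<open>h(\<partial>/\<partial>z\<^sub>c, \<partial>/\<partial>z\<^sub>c)\<close> at \<open>x\<close>.\<close>

type_synonym ('i, 'a) metric = "'i \<Rightarrow> 'a \<Rightarrow> real"

definition hermitian_metric :: "('i, 'a) line_bundle \<Rightarrow> ('i, 'a) metric \<Rightarrow> bool" where
  "hermitian_metric L h \<longleftrightarrow>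
     (\<forall>i\<in>lb_index L. \<forall>x\<in>lb_dom L i. h i x > 0)
     \<and> (\<forall>i\<in>lb_index L. \<forall>j\<in>lb_index L. \<forall>x\<in>lb_dom L i \<inter> lb_dom L j.
          h j x = (cmod (lb_trans L i j x))\<^sup>2 * h i x)"

definition continuous_metric ::
  "('i, 'a::topological_space) line_bundle \<Rightarrow> ('i, 'a) metric \<Rightarrow> bool" where
  "continuous_metric L h \<longleftrightarrow>
     hermitian_metric L h \<and> (\<forall>i\<in>lb_index L. continuous_on (lb_dom L i) (h i))"

definition smooth_metric :: "'a chart set \<Rightarrow> ('i, 'a) line_bundle \<Rightarrow> ('i, 'a) metric \<Rightarrow> bool" where
  "smooth_metric A L h \<longleftrightarrow>
     hermitian_metric L h \<and> (\<forall>i\<in>lb_index L. smooth_on_surface A (lb_dom L i) (h i))"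

definition constant_metric :: "(unit, 'a) metric \<Rightarrow> bool" where
  "constant_metric h \<longleftrightarrow> hermitian_metric trivial_bundle h \<and> (\<exists>r. \<forall>x. h () x = r)"

definition tensor_metric :: "('i, 'a) metric \<Rightarrow> ('j, 'a) metric \<Rightarrow> ('i \<times> 'j, 'a) metric" where
  "tensor_metric h k = (\<lambda>(i, j) x. h i x * k j x)"

definition dual_metric :: "('i, 'a) metric \<Rightarrow> ('i, 'a) metric" where
  "dual_metric h = (\<lambda>i x. inverse (h i x))"

definition isometry_of_metrics ::
  "('i, 'a) line_bundle \<Rightarrow> ('j, 'a) line_bundle \<Rightarrow> ('j \<Rightarrow> 'i \<Rightarrow> 'a \<Rightarrow> complex)
     \<Rightarrow> ('i, 'a) metric \<Rightarrow> ('j, 'a) metric \<Rightarrow> bool" where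
  "isometry_of_metrics L M f h k \<longleftrightarrow>
     (\<forall>i\<in>lb_index L. \<forall>j\<in>lb_index M. \<forall>x\<in>lb_dom L i \<inter> lb_dom M j.
        h i x = (cmod (f j i x))\<^sup>2 * k j x)"

text \<open>The quotient of two metrics on \<open>L\<close> is a function on \<open>X\<close>: it does not depend on the frame.\<close>

definition metrics_converge_uniformly ::
  "('i, 'a) line_bundle \<Rightarrow> ('n \<Rightarrow> ('i, 'a) metric) \<Rightarrow> ('i, 'a) metric \<Rightarrow> 'n filter \<Rightarrow> bool" where
  "metrics_converge_uniformly L hs h F \<longleftrightarrow>
     (\<forall>\<epsilon>>0. \<forall>\<^sub>F n in F. \<forall>i\<in>lb_index L. \<forall>x\<in>lb_dom L i. \<bar>hs n i x / h i x - 1\<bar> < \<epsilon>)"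


section \<open>Positive, admissible and integrable metrics\<close>

definition index_at :: "('i, 'a) line_bundle \<Rightarrow> 'a \<Rightarrow> 'i" where
  "index_at L x = (SOME i. i \<in> lb_index L \<and> x \<in> lb_dom L i)"

text \<open>\<open>\<parallel>s\<parallel>\<^sup>2 = |s\<^sub>i|\<^sup>2 h\<^sub>i\<close>, which is independent of the frame.\<close>

definition section_norm_sq ::
  "('i, 'a) line_bundle \<Rightarrow> ('i, 'a) metric \<Rightarrow> ('i \<Rightarrow> 'a \<Rightarrow> complex) \<Rightarrow> 'a \<Rightarrow> real" where
  "section_norm_sq L h s x = (let i = index_at L x in (cmod (s i x))\<^sup>2 * h i x)"

definition test_function :: "complex set \<Rightarrow> (complex \<Rightarrow> real) \<Rightarrow> bool" where
  "test_function S \<phi> \<longleftrightarrow> smooth_on UNIV \<phi> \<and> (\<exists>K. compact K \<and> K \<subseteq> S \<and> (\<forall>z. z \<notin> K \<longrightarrow> \<phi> z = 0))"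

text \<open>With \<open>d\<^sup>c\<close> normalized so that \<open>dd\<^sup>c = (i/2\<pi>) \<partial>\<partial>\<close>-bar and with \<open>i dz \<and> dz\<close>-bar \<open>= 2 dx \<and> dy\<close>,
  the current \<open>dd\<^sup>c u\<close> on an open subset \<open>V\<close> of the domain of the chart \<open>c\<close> maps a test function \<open>\<phi>\<close>
  (written in the coordinate) to the integral of \<open>u dd\<^sup>c \<phi>\<close>.\<close>

definition ddc_current :: "'a chart \<Rightarrow> 'a set \<Rightarrow> ('a \<Rightarrow> real) \<Rightarrow> (complex \<Rightarrow> real) \<Rightarrow> real" where
  "ddc_current c V u \<phi> =
     (LINT z : snd c ` V | lborel.
        u (chart_inv c z) * (Re (d_dz (d_dzbar (\<lambda>w. complex_of_real (\<phi> w))) z) / pi))"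

definition positive_metric ::
  "'a::topological_space chart set \<Rightarrow> ('i, 'a) line_bundle \<Rightarrow> ('i, 'a) metric \<Rightarrow> bool" where
  "positive_metric A L h \<longleftrightarrow> continuous_metric L h \<and>
     (\<forall>c\<in>A. \<forall>V s \<phi>. open V \<and> V \<subseteq> fst c
        \<and> holomorphic_section A L V s \<and> nonvanishing_section L V s
        \<and> test_function (snd c ` V) \<phi> \<and> (\<forall>z. \<phi> z \<ge> 0)
        \<longrightarrow> ddc_current c V (\<lambda>x. - ln (section_norm_sq L h s x)) \<phi> \<ge> 0)"

definition admissible_metric ::
  "'a::topological_space chart set \<Rightarrow> ('i, 'a) line_bundle \<Rightarrow> ('i, 'a) metric \<Rightarrow> bool" where
  "admissible_metric A L h \<longleftrightarrow> continuous_metric L h \<and>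
     (\<exists>hs :: nat \<Rightarrow> ('i, 'a) metric.
        (\<forall>n. smooth_metric A L (hs n) \<and> positive_metric A L (hs n))
        \<and> metrics_converge_uniformly L hs h sequentially)"

text \<open>The bundles \<open>L\<^sub>1\<close> and \<open>L\<^sub>2\<close> are explicit arguments because their types of indices cannot be
  quantified existentially.\<close>

definition integrable_metric ::
  "'a::topological_space chart set \<Rightarrow> ('i, 'a) line_bundle \<Rightarrow> ('j, 'a) line_bundle
     \<Rightarrow> ('a chart, 'a) metric \<Rightarrow> bool" where
  "integrable_metric A L\<^sub>1 L\<^sub>2 h \<longleftrightarrow>
     holomorphic_line_bundle A L\<^sub>1 \<and> holomorphic_line_bundle A L\<^sub>2
     \<and> hermitian_metric (tangent_bundle A) h
     \<and> (\<exists>h\<^sub>1 h\<^sub>2 f. admissible_metric A L\<^sub>1 h\<^sub>1 \<and> admissible_metric A L\<^sub>2 h\<^sub>2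
          \<and> line_bundle_iso A (tangent_bundle A) (tensor_bundle L\<^sub>1 (dual_bundle L\<^sub>2)) f
          \<and> isometry_of_metrics (tangent_bundle A) (tensor_bundle L\<^sub>1 (dual_bundle L\<^sub>2)) f
              h (tensor_metric h\<^sub>1 (dual_metric h\<^sub>2)))"


section \<open>Volume form, \<open>L\<^sup>2\<close> product, Laplacian\<close>

text \<open>Integration against \<open>\<omega> = (i/2\<pi>) h(\<partial>/\<partial>z, \<partial>/\<partial>z) dz \<and> dz\<close>-bar, as a Borel measure. It is
  determined by its restrictions to the domains of the charts, where \<open>(i/2\<pi>) dz \<and> dz\<close>-bar
  \<open>= (1/\<pi>) dx \<and> dy\<close>.\<close>

definition volume_form ::
  "'a::topological_space chart set \<Rightarrow> ('a chart, 'a) metric \<Rightarrow> 'a measure" where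
  "volume_form A h = (THE \<mu>. sets \<mu> = sets borel \<and>
     (\<forall>c\<in>A. \<forall>B\<in>sets borel. B \<subseteq> fst c \<longrightarrow>
        emeasure \<mu> B
          = (\<integral>\<^sup>+ z. ennreal (h c (chart_inv c z) / pi) * indicator (snd c ` B) z \<partial>lborel)))"

definition l2_prod ::
  "'a::topological_space chart set \<Rightarrow> (unit, 'a) metric \<Rightarrow> ('a chart, 'a) metric
     \<Rightarrow> ('a \<Rightarrow> complex) \<Rightarrow> ('a \<Rightarrow> complex) \<Rightarrow> complex" where
  "l2_prod A hO h \<xi> \<xi>' =
     (LINT x | volume_form A h. \<xi> x * cnj (\<xi>' x) * complex_of_real (hO () x))"

text \<open>The square of the \<open>L\<^sup>2\<close> norm is taken in \<open>[0, \<infinity>]\<close>, so that its finiteness has content.\<close>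

definition l2_norm_sq ::
  "'a::topological_space chart set \<Rightarrow> (unit, 'a) metric \<Rightarrow> ('a chart, 'a) metric
     \<Rightarrow> ('a \<Rightarrow> complex) \<Rightarrow> ennreal" where
  "l2_norm_sq A hO h \<xi> = (\<integral>\<^sup>+ x. ennreal ((cmod (\<xi> x))\<^sup>2 * hO () x) \<partial>volume_form A h)"

text \<open>For smooth \<open>\<xi>\<close> and a hermitian metric \<open>h\<close> the value does not depend on the chart at \<open>x\<close>.\<close>

definition laplacian ::
  "'a chart set \<Rightarrow> ('a chart, 'a) metric \<Rightarrow> ('a \<Rightarrow> complex) \<Rightarrow> 'a \<Rightarrow> complex" where
  "laplacian A h \<xi> x = (let c = index_at (tangent_bundle A) x in
     - inverse (complex_of_real (h c x)) * d_dz (d_dzbar (\<xi> \<circ> chart_inv c)) (snd c x))"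


section \<open>The completion \<open>H\<^sub>0(X)\<close>\<close>

text \<open>The completion of \<open>A\<^sup>(\<^sup>0\<^sup>,\<^sup>0\<^sup>)(X)\<close> is the space of Cauchy sequences modulo null sequences.\<close>

definition l2_cauchy ::
  "'a::topological_space chart set \<Rightarrow> (unit, 'a) metric \<Rightarrow> ('a chart, 'a) metric
     \<Rightarrow> (nat \<Rightarrow> 'a \<Rightarrow> complex) \<Rightarrow> bool" where
  "l2_cauchy A hO h s \<longleftrightarrow> (\<forall>n. s n \<in> A00 A) \<and>
     (\<forall>e>0. \<exists>N. \<forall>m\<ge>N. \<forall>n\<ge>N. l2_norm_sq A hO h (\<lambda>x. s m x - s n x) < ennreal e)"

definition l2_equiv ::
  "'a::topological_space chart set \<Rightarrow> (unit, 'a) metric \<Rightarrow> ('a chart, 'a) metric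
     \<Rightarrow> ((nat \<Rightarrow> 'a \<Rightarrow> complex) \<times> (nat \<Rightarrow> 'a \<Rightarrow> complex)) set" where
  "l2_equiv A hO h = {(s, t). l2_cauchy A hO h s \<and> l2_cauchy A hO h t
     \<and> (\<lambda>n. l2_norm_sq A hO h (\<lambda>x. s n x - t n x)) \<longlonglongrightarrow> 0}"

definition H0 ::
  "'a::topological_space chart set \<Rightarrow> (unit, 'a) metric \<Rightarrow> ('a chart, 'a) metric
     \<Rightarrow> (nat \<Rightarrow> 'a \<Rightarrow> complex) set set" where
  "H0 A hO h = {s. l2_cauchy A hO h s} // l2_equiv A hO h"

definition H0_add ::
  "'a::topological_space chart set \<Rightarrow> (unit, 'a) metric \<Rightarrow> ('a chart, 'a) metric
     \<Rightarrow> (nat \<Rightarrow> 'a \<Rightarrow> complex) set \<Rightarrow> (nat \<Rightarrow> 'a \<Rightarrow> complex) set \<Rightarrow> (nat \<Rightarrow> 'a \<Rightarrow> complex) set" where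
  "H0_add A hO h P Q = l2_equiv A hO h `` {(\<lambda>n x. s n x + t n x) | s t. s \<in> P \<and> t \<in> Q}"

definition H0_scale ::
  "'a::topological_space chart set \<Rightarrow> (unit, 'a) metric \<Rightarrow> ('a chart, 'a) metric
     \<Rightarrow> complex \<Rightarrow> (nat \<Rightarrow> 'a \<Rightarrow> complex) set \<Rightarrow> (nat \<Rightarrow> 'a \<Rightarrow> complex) set" where
  "H0_scale A hO h a P = l2_equiv A hO h `` {(\<lambda>n x. a * s n x) | s. s \<in> P}"

text \<open>The element of the completion defined by a function \<open>f\<close> consists of all sequences of smooth
  functions converging to \<open>f\<close> in the \<open>L\<^sup>2\<close> norm. If \<open>f\<close> is not measurable, or not an \<open>L\<^sup>2\<close> limit of
  smooth functions, this set is empty and hence not an element of \<open>H0\<close>.\<close>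

definition H0_class ::
  "'a::topological_space chart set \<Rightarrow> (unit, 'a) metric \<Rightarrow> ('a chart, 'a) metric
     \<Rightarrow> ('a \<Rightarrow> complex) \<Rightarrow> (nat \<Rightarrow> 'a \<Rightarrow> complex) set" where
  "H0_class A hO h f = {s. f \<in> borel_measurable borel \<and> l2_cauchy A hO h s
     \<and> (\<lambda>n. l2_norm_sq A hO h (\<lambda>x. s n x - f x)) \<longlonglongrightarrow> 0}"

definition linear_operator_into_H0 ::
  "'a::topological_space chart set \<Rightarrow> (unit, 'a) metric \<Rightarrow> ('a chart, 'a) metric
     \<Rightarrow> (('a \<Rightarrow> complex) \<Rightarrow> (nat \<Rightarrow> 'a \<Rightarrow> complex) set) \<Rightarrow> bool" where
  "linear_operator_into_H0 A hO h T \<longleftrightarrow>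
     (\<forall>\<xi>\<in>A00 A. T \<xi> \<in> H0 A hO h)
     \<and> (\<forall>\<xi>\<in>A00 A. \<forall>\<eta>\<in>A00 A. T (\<lambda>x. \<xi> x + \<eta> x) = H0_add A hO h (T \<xi>) (T \<eta>))
     \<and> (\<forall>a. \<forall>\<xi>\<in>A00 A. T (\<lambda>x. a * \<xi> x) = H0_scale A hO h a (T \<xi>))"

end

theory Submission
  imports Defs
begin

text \<open>Write \<open>h\<^sub>\<infinity> = |f|\<^sup>2 h\<^sub>1 / h\<^sub>2\<close>, where \<open>f\<close> is the isomorphism \<open>TX \<simeq> L\<^sub>1 \<otimes> L\<^sub>2\<^sup>-\<^sup>1\<close> in local frames, and
  replace \<open>h\<^sub>1\<close> and \<open>h\<^sub>2\<close> by members of smooth sequences converging to them; this gives \<open>h\<^sub>u\<close>. If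
  \<open>\<rho>\<^sub>u = h\<^sub>u / h\<^sub>\<infinity>\<close>, then \<open>\<omega>\<^sub>u = \<rho>\<^sub>u \<omega>\<^sub>\<infinity>\<close> and \<open>\<Delta>\<^sub>u = \<rho>\<^sub>u\<^sup>-\<^sup>1 \<Delta>\<^sub>\<infinity>\<close>, so that \<open>\<parallel>\<Delta>\<^sub>u \<xi>\<parallel>\<^sup>2\<close> is the integral of
  \<open>\<rho>\<^sub>u\<^sup>-\<^sup>1 |\<Delta>\<^sub>\<infinity> \<xi>|\<^sup>2\<close> against \<open>\<omega>\<^sub>\<infinity>\<close> and converges because \<open>\<rho>\<^sub>u\<close> tends to \<open>1\<close> uniformly. The function
  \<open>\<Delta>\<^sub>\<infinity> \<xi>\<close> is continuous, and smooth functions are uniformly dense in the continuous ones by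
  Stone--Weierstrass, so it represents an element of the completion. Since \<open>h\<^sub>\<infinity>\<close> cancels in
  \<open>\<Delta>\<^sub>\<infinity> \<xi> \<omega>\<^sub>\<infinity>\<close>, symmetry and positivity follow already for continuous metrics from Green's
  formula, which a partition of unity reduces to an integration by parts in the plane.\<close>

section \<open>Calculus of smooth functions in the plane\<close>

text \<open>In the study of the Laplacian no derivative may fall on a metric, because
  \<open>h_inf\<close> is merely continuous: the Laplacian divides by it after differentiating and
  the volume form multiplies by it. Hence \<open>laplacian A h_inf \<xi>\<close> is in general no
  better than continuous, which is why its values are taken in the completion. A second obstacle is
  that the objects are given by choices. \<open>volume_form\<close> is a definite description, so a
  measure with the prescribed values in all charts has to be constructed and shown unique before any
  integral can be computed. The Laplacian, the Dirichlet density and the approximating metrics are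
  evaluated in a frame that \<open>index_at\<close> selects separately at each point, and for each
  of them a transition rule shows that every other chart or frame gives the same value. The
  recurring cancellation is that under a coordinate change g both the metric and
  \<partial>\<partial>-bar scale by |g'|^2, which is also the Jacobian of g. Since the total volume
  is finite, continuous functions are integrable and bounds in the supremum norm become bounds in
  L^2.\<close>

lemma Ck_on_Suc_iff:
  "Ck_on (Suc k) f S \<longleftrightarrow> (\<forall>z\<in>S. f differentiable at z)
     \<and> (\<forall>v\<in>{1, \<i>}. Ck_on k (\<lambda>z. frechet_derivative f (at z) v) S)"
  by (auto simp: partial_x_def[abs_def] partial_y_def[abs_def])

declare Ck_on.simps(2)[simp del]

text \<open>Both partial derivatives are values of one Frechet derivative. Quantifying over the
  directions \<open>1\<close> and \<open>\<i>\<close> lets each closure property be proved once for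
  both of them.\<close>

lemma Ck_on_SucI:
  assumes "\<And>z. z \<in> S \<Longrightarrow> f differentiable at z"
    and "\<And>v. v \<in> {1, \<i>} \<Longrightarrow> Ck_on k (\<lambda>z. frechet_derivative f (at z) v) S"
  shows "Ck_on (Suc k) f S"
  using assms by (auto simp: Ck_on_Suc_iff)

lemma Ck_on_SucD:
  assumes "Ck_on (Suc k) f S"
  shows "z \<in> S \<Longrightarrow> f differentiable at z"
    and "v \<in> {1, \<i>} \<Longrightarrow> Ck_on k (\<lambda>z. frechet_derivative f (at z) v) S"
  using assms by (auto simp: Ck_on_Suc_iff)

lemma Ck_on_Suc_has_derivative:
  assumes "Ck_on (Suc k) f S" "z \<in> S"
  shows "(f has_derivative frechet_derivative f (at z)) (at z)"
  using Ck_on_SucD(1)[OF assms] by (simp only: frechet_derivative_works)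

lemma has_derivative_cong_open:
  assumes "open S" "z \<in> S" "\<And>w. w \<in> S \<Longrightarrow> f w = g w"
  shows "(f has_derivative D) (at z) \<longleftrightarrow> (g has_derivative D) (at z)"
proof
  show "(g has_derivative D) (at z)" if "(f has_derivative D) (at z)"
    using that assms by (rule has_derivative_transform_within_open)
  show "(f has_derivative D) (at z)" if "(g has_derivative D) (at z)"
    using that assms(1,2) by (rule has_derivative_transform_within_open) (simp add: assms(3))
qed

text \<open>\<open>frechet_derivative\<close> is a choice among all candidates \<open>D\<close> with
  \<open>has_derivative\<close>, so equal sets of candidates give the same choice, also at points
  where there are none.\<close>

lemma frechet_derivative_cong_open:
  assumes "open S" "z \<in> S" "\<And>w. w \<in> S \<Longrightarrow> f w = g w"
  shows "frechet_derivative f (at z) = frechet_derivative g (at z)"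
  unfolding frechet_derivative_def by (simp only: has_derivative_cong_open[OF assms])

text \<open>The tool behind the closure properties: on an open set an explicit formula for the
  derivative may replace \<open>frechet_derivative\<close> inside \<open>Ck_on\<close>.\<close>

lemma Ck_on_cong:
  assumes "open S" "\<And>z. z \<in> S \<Longrightarrow> f z = g z"
  shows "Ck_on k f S \<longleftrightarrow> Ck_on k g S"
  using assms(2)
proof (induction k arbitrary: f g)
  case 0
  show ?case unfolding Ck_on.simps(1) by (rule continuous_on_cong[OF refl 0])
next
  case (Suc k)
  have d: "f differentiable at z \<longleftrightarrow> g differentiable at z" if "z \<in> S" for z
    unfolding differentiable_def
    by (simp only: has_derivative_cong_open[OF assms(1) that Suc.prems])
  have "Ck_on k (\<lambda>z. frechet_derivative f (at z) v) S
      \<longleftrightarrow> Ck_on k (\<lambda>z. frechet_derivative g (at z) v) S" for v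
    by (rule Suc.IH) (simp only: frechet_derivative_cong_open[OF assms(1) _ Suc.prems])
  with d show ?case by (simp add: Ck_on_Suc_iff)
qed

lemma Ck_on_SucD_le: "Ck_on (Suc k) f S \<Longrightarrow> Ck_on k f S"
proof (induction k arbitrary: f)
  case 0
  then show ?case
    by (auto intro!: continuous_at_imp_continuous_on differentiable_imp_continuous_within
        dest: Ck_on_SucD(1))
next
  case (Suc k)
  show ?case
  proof (rule Ck_on_SucI)
    show "f differentiable at z" if "z \<in> S" for z
      using Ck_on_SucD(1)[OF Suc.prems that] .
    show "Ck_on k (\<lambda>z. frechet_derivative f (at z) v) S" if "v \<in> {1, \<i>}" for v
      by (rule Suc.IH) (rule Ck_on_SucD(2)[OF Suc.prems that])
  qed
qed

lemma Ck_on_subset: "Ck_on k f S \<Longrightarrow> T \<subseteq> S \<Longrightarrow> Ck_on k f T"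
  by (induction k arbitrary: f) (auto simp: Ck_on_Suc_iff intro: continuous_on_subset)

text \<open>Used for gluing: a function extended by zero is smooth because it is so on a chart and
  on the complement of its support, two open sets.\<close>

lemma Ck_on_local:
  assumes "\<And>z. z \<in> S \<Longrightarrow> \<exists>T. open T \<and> z \<in> T \<and> Ck_on k f T"
  shows "Ck_on k f S"
  using assms
proof (induction k arbitrary: f)
  case 0
  have "isCont f z" if z: "z \<in> S" for z
    using 0[OF z] by (auto simp: continuous_on_eq_continuous_at)
  then show ?case by (simp add: continuous_at_imp_continuous_on)
next
  case (Suc k)
  show ?case
  proof (rule Ck_on_SucI)
    fix z assume "z \<in> S"
    with Suc.prems obtain T where "z \<in> T" "Ck_on (Suc k) f T" by meson
    then show "f differentiable at z" by (rule Ck_on_SucD(1)[rotated])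
  next
    fix v :: complex assume v: "v \<in> {1, \<i>}"
    show "Ck_on k (\<lambda>z. frechet_derivative f (at z) v) S"
    proof (rule Suc.IH)
      fix z assume "z \<in> S"
      then obtain T where T: "open T" "z \<in> T" "Ck_on (Suc k) f T" using Suc.prems by meson
      show "\<exists>T. open T \<and> z \<in> T \<and> Ck_on k (\<lambda>z. frechet_derivative f (at z) v) T"
        using T(1,2) Ck_on_SucD(2)[OF T(3) v] by auto
    qed
  qed
qed

lemma Ck_on_const [simp]: "Ck_on k (\<lambda>z. c) S"
  by (induction k arbitrary: c) (simp_all add: Ck_on_Suc_iff)

lemma Ck_on_bounded_linear:
  assumes "bounded_linear L" "open S" "Ck_on k f S"
  shows "Ck_on k (\<lambda>z. L (f z)) S"
  using assms(3)
proof (induction k arbitrary: f)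
  case 0
  then show ?case using assms(1) by (simp add: bounded_linear.continuous_on)
next
  case (Suc k)
  have D: "((\<lambda>z. L (f z)) has_derivative (\<lambda>h. L (frechet_derivative f (at z) h))) (at z)"
    if "z \<in> S" for z
    by (rule bounded_linear.has_derivative[OF assms(1) Ck_on_Suc_has_derivative[OF Suc.prems that]])
  show ?case
  proof (rule Ck_on_SucI)
    show "(\<lambda>z. L (f z)) differentiable at z" if "z \<in> S" for z
      using D[OF that] by (rule differentiableI)
  next
    fix v :: complex assume v: "v \<in> {1, \<i>}"
    have "Ck_on k (\<lambda>z. L (frechet_derivative f (at z) v)) S"
      by (rule Suc.IH) (rule Ck_on_SucD(2)[OF Suc.prems v])
    then show "Ck_on k (\<lambda>z. frechet_derivative (\<lambda>z. L (f z)) (at z) v) S"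
      by (subst Ck_on_cong[OF assms(2)]) (simp_all only: frechet_derivative_at[OF D, symmetric])
  qed
qed

lemma Ck_on_add:
  assumes "open S" "Ck_on k f S" "Ck_on k g S"
  shows "Ck_on k (\<lambda>z. f z + g z) S"
  using assms(2,3)
proof (induction k arbitrary: f g)
  case 0
  then show ?case by (simp add: continuous_on_add)
next
  case (Suc k)
  have D: "((\<lambda>z. f z + g z) has_derivative
      (\<lambda>h. frechet_derivative f (at z) h + frechet_derivative g (at z) h)) (at z)"
    if "z \<in> S" for z
    by (intro has_derivative_add Ck_on_Suc_has_derivative[OF Suc.prems(1) that]
        Ck_on_Suc_has_derivative[OF Suc.prems(2) that])
  show ?case
  proof (rule Ck_on_SucI)
    show "(\<lambda>z. f z + g z) differentiable at z" if "z \<in> S" for z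
      using D[OF that] by (rule differentiableI)
  next
    fix v :: complex assume v: "v \<in> {1, \<i>}"
    have "Ck_on k (\<lambda>z. frechet_derivative f (at z) v + frechet_derivative g (at z) v) S"
      by (rule Suc.IH) (rule Ck_on_SucD(2)[OF Suc.prems(1) v] Ck_on_SucD(2)[OF Suc.prems(2) v])+
    then show "Ck_on k (\<lambda>z. frechet_derivative (\<lambda>z. f z + g z) (at z) v) S"
      by (subst Ck_on_cong[OF assms(1)]) (simp_all only: frechet_derivative_at[OF D, symmetric])
  qed
qed

text \<open>The product rule leaves one factor undifferentiated in each term;
  \<open>Ck_on_SucD_le\<close> lowers that factor to the order of the induction hypothesis.\<close>

lemma Ck_on_bilinear:
  assumes "bounded_bilinear pr" "open S" "Ck_on k f S" "Ck_on k g S"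
  shows "Ck_on k (\<lambda>z. pr (f z) (g z)) S"
  using assms(3,4)
proof (induction k arbitrary: f g)
  case 0
  then show ?case using assms(1) by (simp add: bounded_bilinear.continuous_on)
next
  case (Suc k)
  have D: "((\<lambda>z. pr (f z) (g z)) has_derivative
      (\<lambda>h. pr (f z) (frechet_derivative g (at z) h) + pr (frechet_derivative f (at z) h) (g z))) (at z)"
    if "z \<in> S" for z
    by (rule bounded_bilinear.FDERIV[OF assms(1) Ck_on_Suc_has_derivative[OF Suc.prems(1) that]
          Ck_on_Suc_has_derivative[OF Suc.prems(2) that]])
  show ?case
  proof (rule Ck_on_SucI)
    show "(\<lambda>z. pr (f z) (g z)) differentiable at z" if "z \<in> S" for z
      using D[OF that] by (rule differentiableI)
  next
    fix v :: complex assume v: "v \<in> {1, \<i>}"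
    have "Ck_on k (\<lambda>z. pr (f z) (frechet_derivative g (at z) v)
        + pr (frechet_derivative f (at z) v) (g z)) S"
      by (intro Ck_on_add[OF assms(2)] Suc.IH)
         (use Suc.prems v in \<open>auto intro: Ck_on_SucD(2) Ck_on_SucD_le\<close>)
    then show "Ck_on k (\<lambda>z. frechet_derivative (\<lambda>z. pr (f z) (g z)) (at z) v) S"
      by (subst Ck_on_cong[OF assms(2)]) (simp_all only: frechet_derivative_at[OF D, symmetric])
  qed
qed

text \<open>The derivative -(1/f) f' (1/f) contains 1/f itself, which the induction hypothesis
  already makes of order \<open>k\<close>.\<close>

lemma Ck_on_inverse:
  fixes f :: "complex \<Rightarrow> 'b::real_normed_field"
  assumes "open S" "\<And>z. z \<in> S \<Longrightarrow> f z \<noteq> 0" "Ck_on k f S"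
  shows "Ck_on k (\<lambda>z. inverse (f z)) S"
  using assms(3)
proof (induction k)
  case 0
  then show ?case using assms(2) by (simp add: continuous_on_inverse)
next
  case (Suc k)
  have D: "((\<lambda>z. inverse (f z)) has_derivative
      (\<lambda>h. - (inverse (f z) * frechet_derivative f (at z) h * inverse (f z)))) (at z)"
    if "z \<in> S" for z
    by (rule Deriv.has_derivative_inverse[OF assms(2)[OF that] Ck_on_Suc_has_derivative[OF Suc.prems that]])
  show ?case
  proof (rule Ck_on_SucI)
    show "(\<lambda>z. inverse (f z)) differentiable at z" if "z \<in> S" for z
      using D[OF that] by (rule differentiableI)
  next
    fix v :: complex assume v: "v \<in> {1, \<i>}"
    have I: "Ck_on k (\<lambda>z. inverse (f z)) S" and "Ck_on k (\<lambda>z. frechet_derivative f (at z) v) S"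
      using Suc v by (auto intro: Ck_on_SucD(2) Ck_on_SucD_le)
    then have "Ck_on k (\<lambda>z. - (inverse (f z) * frechet_derivative f (at z) v * inverse (f z))) S"
      by (intro Ck_on_bounded_linear[OF bounded_linear_minus[OF bounded_linear_ident]]
          Ck_on_bilinear[OF bounded_bilinear_mult] assms(1))
    then show "Ck_on k (\<lambda>z. frechet_derivative (\<lambda>z. inverse (f z)) (at z) v) S"
      by (subst Ck_on_cong[OF assms(1)]) (simp_all only: frechet_derivative_at[OF D, symmetric])
  qed
qed

text \<open>In every direction \<open>v\<close> the derivative is \<open>deriv f z * v\<close>,
  again holomorphic, so the induction over varying \<open>f\<close> closes.\<close>

lemma Ck_on_holomorphic:
  assumes "open S" "f holomorphic_on S"
  shows "Ck_on k f S"
  using assms(2)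
proof (induction k arbitrary: f)
  case 0
  then show ?case by (simp add: holomorphic_on_imp_continuous_on)
next
  case (Suc k)
  have D: "(f has_derivative (\<lambda>h. deriv f z * h)) (at z)" if "z \<in> S" for z
    using holomorphic_derivI[OF Suc.prems assms(1) that] by (simp add: has_field_derivative_def)
  show ?case
  proof (rule Ck_on_SucI)
    show "f differentiable at z" if "z \<in> S" for z
      using D[OF that] by (rule differentiableI)
  next
    fix v :: complex
    have "Ck_on k (\<lambda>z. deriv f z * v) S"
      by (rule Suc.IH) (intro holomorphic_intros Suc.prems assms(1))
    then show "Ck_on k (\<lambda>z. frechet_derivative f (at z) v) S"
      by (subst Ck_on_cong[OF assms(1)]) (simp_all only: frechet_derivative_at[OF D, symmetric])
  qed
qed

text \<open>The power of \<open>1/t\<close> makes this family closed under differentiation, so that the smoothness of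
  its members can be proved for all \<open>m\<close> at once by induction on the order.\<close>

definition flat_exp :: "nat \<Rightarrow> real \<Rightarrow> real" where
  "flat_exp m t = (if t > 0 then exp (- inverse t) * inverse t ^ m else 0)"

text \<open>A single term of the exponential series with nonnegative terms is at most its
  sum.\<close>

lemma power_le_fact_mult_exp: "x ^ n \<le> fact n * exp x" if "x \<ge> 0" for x :: real
proof -
  have "(\<lambda>n. x ^ n /\<^sub>R fact n) n \<le> (\<Sum>n. x ^ n /\<^sub>R fact n)"
    using that exp_converges[of x] 
    by (intro sum_le_suminf[of _ "{n}", simplified]) (auto simp: sums_iff)
  then show ?thesis by (simp add: exp_def field_simps)
qed

lemma flat_exp_nonneg: "flat_exp m t \<ge> 0"
  by (simp add: flat_exp_def)

text \<open>Vanishing to second order at 0 is what makes the derivative there exist and equal 0.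
  With s = 1/t, the bound on s^(m+2) exp(-s) absorbs both the power s^m and the two factors
  t.\<close>

lemma flat_exp_le: "\<bar>flat_exp m t\<bar> \<le> fact (m + 2) * t\<^sup>2"
proof (cases "t > 0")
  case True
  define s where "s = inverse t"
  have s: "s > 0" "s * t = 1" using True by (simp_all add: s_def)
  have "s ^ (m + 2) * exp (- s) \<le> fact (m + 2) * exp s * exp (- s)"
    using s by (intro mult_right_mono power_le_fact_mult_exp) auto
  then have "s ^ (m + 2) * exp (- s) \<le> fact (m + 2)"
    by (simp only: mult.assoc exp_minus_inverse mult_1_right)
  then have "s ^ (m + 2) * exp (- s) * t\<^sup>2 \<le> fact (m + 2) * t\<^sup>2"
    by (intro mult_right_mono) auto
  moreover have "s ^ (m + 2) * exp (- s) * t\<^sup>2 = s ^ m * exp (- s) * (s * t)\<^sup>2"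
    by (simp add: power2_eq_square)
  ultimately have "s ^ m * exp (- s) \<le> fact (m + 2) * t\<^sup>2"
    by (simp only: s power_one mult_1_right)
  moreover have "\<bar>flat_exp m t\<bar> = s ^ m * exp (- s)"
    using True s by (simp add: flat_exp_def s_def[symmetric] mult.commute)
  ultimately show ?thesis by simp
qed (simp add: flat_exp_def)

lemma flat_exp_has_derivative:
  "(flat_exp m has_real_derivative flat_exp (m + 2) t - m * flat_exp (Suc m) t) (at t)"
proof -
  consider "t > 0" | "t < 0" | "t = 0" by linarith
  then show ?thesis
  proof cases
    case 1
    have "((\<lambda>t. exp (- inverse t) * inverse t ^ m) has_real_derivative
        flat_exp (m + 2) t - m * flat_exp (Suc m) t) (at t)"
    \<comment> \<open>The power rule has a truncated exponent m - 1, so m = 0 is treated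
      apart.\<close>
    proof (cases m)
      case 0
      show ?thesis unfolding 0 using 1
        by (auto intro!: derivative_eq_intros simp: flat_exp_def power2_eq_square)
    next
      case (Suc n)
      have "((\<lambda>t. inverse t ^ Suc n) has_real_derivative
          - (real (Suc n) * inverse t ^ (n + 2))) (at t)"
        using DERIV_power[OF DERIV_inverse, of t "Suc n" UNIV] 1 
        by (simp add: power2_eq_square mult_ac)
      moreover have "((\<lambda>t. exp (- inverse t)) has_real_derivative exp (- inverse t) * (inverse t)\<^sup>2) (at t)"
        using 1 by (auto intro!: derivative_eq_intros simp: power2_eq_square)
      ultimately show ?thesis unfolding Suc
        by (rule DERIV_cong[OF DERIV_mult[rotated]])
           (use 1 in \<open>simp add: flat_exp_def power2_eq_square algebra_simps\<close>)
    qed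
    moreover have "\<forall>\<^sub>F s in nhds t. exp (- inverse s) * inverse s ^ m = flat_exp m s"
      using eventually_nhds_in_open[OF open_greaterThan[of 0], of t] 1
      by (auto elim!: eventually_mono simp: flat_exp_def)
    ultimately show ?thesis by (rule DERIV_cong_ev[OF refl _ refl, THEN iffD1, rotated])
  next
    case 2
    have "\<forall>\<^sub>F s in nhds t. 0 = flat_exp m s"
      using eventually_nhds_in_open[OF open_lessThan[of 0], of t] 2
      by (auto elim!: eventually_mono simp: flat_exp_def)
    moreover have "((\<lambda>_. 0) has_real_derivative flat_exp (m + 2) t - m * flat_exp (Suc m) t) (at t)"
      using 2 by (simp add: flat_exp_def)
    ultimately show ?thesis by (rule DERIV_cong_ev[OF refl _ refl, THEN iffD1])
  next
    case 3
    \<comment> \<open>By \<open>flat_exp_le\<close> the difference quotient at 0 is at most a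
      constant times |h|.\<close>
    have "((\<lambda>h. flat_exp m h / h) \<longlongrightarrow> 0) (at 0)"
    proof (rule Lim_null_comparison)
      show "\<forall>\<^sub>F h in at 0. norm (flat_exp m h / h) \<le> fact (m + 2) * \<bar>h\<bar>"
      proof (rule eventuallyI)
        fix h :: real
        show "norm (flat_exp m h / h) \<le> fact (m + 2) * \<bar>h\<bar>"
        proof (cases "h = 0")
          case False
          have "\<bar>flat_exp m h\<bar> \<le> fact (m + 2) * \<bar>h\<bar> * \<bar>h\<bar>"
            using flat_exp_le[of m h] by (simp only: mult.assoc abs_mult_self_eq power2_eq_square)
          with False show ?thesis
            by (simp only: real_norm_def abs_divide pos_divide_le_eq zero_less_abs_iff simp_thms)
        qed simp
      qed
      have "((\<lambda>h::real. fact (m + 2) * \<bar>h\<bar>) \<longlongrightarrow> fact (m + 2) * \<bar>0\<bar>) (at 0)"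
        by (intro tendsto_intros)
      then show "((\<lambda>h::real. fact (m + 2) * \<bar>h\<bar>) \<longlongrightarrow> 0) (at 0)" by simp
    qed
    then show ?thesis using 3
      by (simp add: has_field_derivative_def flat_exp_def DERIV_def field_has_derivative_at)
  qed
qed

lemma Ck_on_flat_exp:
  assumes "open S" "Ck_on k \<rho> S"
  shows "Ck_on k (\<lambda>z. flat_exp m (\<rho> z)) S"
  using assms(2)
proof (induction k arbitrary: m)
  case 0
  have "continuous_on UNIV (flat_exp m)"
    by (meson DERIV_continuous continuous_at_imp_continuous_on flat_exp_has_derivative)
  with 0 show ?case by (auto intro: continuous_on_compose2)
next
  case (Suc k)
  have D: "((\<lambda>z. flat_exp m (\<rho> z)) has_derivative (\<lambda>h. frechet_derivative \<rho> (at z) h *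
      (flat_exp (m + 2) (\<rho> z) - m * flat_exp (Suc m) (\<rho> z)))) (at z)" if "z \<in> S" for z
    using has_derivative_compose[OF Ck_on_Suc_has_derivative[OF Suc.prems that]
          flat_exp_has_derivative[unfolded has_field_derivative_def]]
    by (simp only: mult.commute)
  show ?case
  proof (rule Ck_on_SucI)
    show "(\<lambda>z. flat_exp m (\<rho> z)) differentiable at z" if "z \<in> S" for z
      using D[OF that] by (rule differentiableI)
  next
    fix v :: complex assume v: "v \<in> {1, \<i>}"
    have k: "Ck_on k \<rho> S" using Suc.prems by (rule Ck_on_SucD_le)
    have "Ck_on k (\<lambda>z. frechet_derivative \<rho> (at z) v *
      (flat_exp (m + 2) (\<rho> z) + (- real m) * flat_exp (Suc m) (\<rho> z))) S"
      using Ck_on_SucD(2)[OF Suc.prems v] k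
      by (intro Ck_on_bilinear[OF bounded_bilinear_mult] Ck_on_add Suc.IH assms(1)) auto
    then show "Ck_on k (\<lambda>z. frechet_derivative (\<lambda>z. flat_exp m (\<rho> z)) (at z) v) S"
      by (subst Ck_on_cong[OF assms(1)]) (simp_all only: frechet_derivative_at[OF D, symmetric] diff_conv_add_uminus mult_minus_left)
  qed
qed

section \<open>Change of variables and integration by parts in the plane\<close>

text \<open>The change of variables theorem of the library concerns \<open>real^'n\<close> only.\<close>

definition vec2c :: "real^2 \<Rightarrow> complex" where
  "vec2c x = Complex (x $ 1) (x $ 2)"

definition c2vec :: "complex \<Rightarrow> real^2" where
  "c2vec z = (\<chi> i. if i = 1 then Re z else Im z)"

lemma vec2c_c2vec [simp]: "vec2c (c2vec z) = z"
  by (simp add: vec2c_def c2vec_def)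

lemma c2vec_vec2c [simp]: "c2vec (vec2c x) = x"
  by (auto simp: vec2c_def c2vec_def vec_eq_iff forall_2)

lemma bounded_linear_vec2c: "bounded_linear vec2c"
  by (intro linear_conv_bounded_linear[THEN iffD1] linearI) (simp_all add: vec2c_def complex_eq_iff)

lemma bounded_linear_c2vec: "bounded_linear c2vec"
  by (intro linear_conv_bounded_linear[THEN iffD1] linearI) (simp_all add: c2vec_def vec_eq_iff)

lemma measurable_vec2c [measurable]: "vec2c \<in> borel \<rightarrow>\<^sub>M borel"
  by (intro borel_measurable_continuous_onI linear_continuous_on bounded_linear_vec2c)

lemma Basis_real_2: "(Basis :: (real^2) set) = {axis 1 1, axis 2 1}"
  by (auto simp: Basis_vec_def UNIV_2)

text \<open>\<open>lborel\<close> is characterised by the volumes of boxes, and \<open>vec2c\<close>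
  pulls a box back to a box with the same side lengths.\<close>

lemma distr_lborel_vec2c: "distr lborel borel vec2c = lborel"
proof (rule lborel_eqI[symmetric])
  fix l u :: complex
  assume le: "\<And>b. b \<in> Basis \<Longrightarrow> l \<bullet> b \<le> u \<bullet> b"
  have le': "Re l \<le> Re u" "Im l \<le> Im u" using le[of 1] le[of \<i>] by (simp_all add: Basis_complex_def)
  have "vec2c -` box l u = box (c2vec l) (c2vec u)"
    by (auto simp: mem_box Basis_real_2 Basis_complex_def inner_axis c2vec_def vec2c_def)
  moreover have "emeasure lborel (box (c2vec l) (c2vec u))
      = ennreal (\<Prod>b\<in>Basis. (c2vec u - c2vec l) \<bullet> b)"
    by (rule emeasure_lborel_box) (use le' in \<open>auto simp: Basis_real_2 inner_axis c2vec_def\<close>)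
  moreover have "(\<Prod>b\<in>Basis. (c2vec u - c2vec l) \<bullet> b) = (\<Prod>b\<in>Basis. (u - l) \<bullet> b)"
    by (simp add: Basis_real_2 Basis_complex_def inner_axis c2vec_def axis_eq_axis complex_eq_iff)
  ultimately show "emeasure (distr lborel borel vec2c) (box l u) = ennreal (\<Prod>b\<in>Basis. (u - l) \<bullet> b)"
    by (simp add: emeasure_distr)
qed simp

lemma emeasure_vimage_vec2c:
  assumes "A \<in> sets borel"
  shows "emeasure lborel (vec2c -` A) = emeasure lborel A"
proof -
  have "emeasure lborel A = emeasure (distr lborel borel vec2c) A"
    by (simp only: distr_lborel_vec2c)
  with assms show ?thesis by (simp add: emeasure_distr)
qed

section \<open>Change of variables for injective holomorphic maps\<close>

lemma has_integral_iff_nn_integral: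
  fixes f :: "'a::euclidean_space \<Rightarrow> real"
  assumes "f \<in> borel_measurable borel" "\<And>x. 0 \<le> f x" "0 \<le> m"
  shows "(f has_integral m) UNIV \<longleftrightarrow> (\<integral>\<^sup>+x. f x \<partial>lborel) = ennreal m"
  using assms nn_integral_has_integral nn_integral_has_integral_lborel by blast

text \<open>Suited to a change of variables theorem that speaks of finite values: if neither side
  attains a finite value, both are infinite.\<close>

lemma ennreal_eqI_finite:
  assumes "\<And>m. 0 \<le> m \<Longrightarrow> a = ennreal m \<longleftrightarrow> b = ennreal m"
  shows "a = b"
  by (cases a; cases b) (use assms in auto)

text \<open>\<open>deriv g\<close> is controlled only on \<open>U\<close>, so the function is cut
  off there before continuity gives measurability.\<close>

lemma borel_measurable_cmod_deriv:
  assumes "open U" "g holomorphic_on U" "S \<in> sets borel" "S \<subseteq> U"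
  shows "(\<lambda>z. (cmod (deriv g z))\<^sup>2 * indicator S z) \<in> borel_measurable borel"
proof -
  have "continuous_on U (\<lambda>z. (cmod (deriv g z))\<^sup>2)"
    by (intro continuous_intros holomorphic_on_imp_continuous_on holomorphic_deriv assms)
  then have "(\<lambda>z. indicator U z *\<^sub>R (cmod (deriv g z))\<^sup>2) \<in> borel_measurable borel"
    using assms(1) by (intro borel_measurable_continuous_on_indicator) auto
  with assms(3) have "(\<lambda>z. (indicator U z *\<^sub>R (cmod (deriv g z))\<^sup>2) * indicator S z) \<in> borel_measurable borel"
    by (intro borel_measurable_times borel_measurable_indicator) auto
  moreover have "(\<lambda>z. (cmod (deriv g z))\<^sup>2 * indicator S z)
      = (\<lambda>z. (indicator U z *\<^sub>R (cmod (deriv g z))\<^sup>2) * indicator S z)"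
    using assms(4) by (auto simp: indicator_def fun_eq_iff)
  ultimately show ?thesis by simp
qed

text \<open>As a real linear map, multiplication by g' = a + ib has determinant a^2 + b^2 =
  |g'|^2.\<close>

lemma emeasure_holomorphic_image:
  assumes U: "open U" "g holomorphic_on U" and S: "S \<in> sets borel" "S \<subseteq> U"
    and inj: "inj_on g S" and gS: "g ` S \<in> sets borel"
  shows "emeasure lborel (g ` S) = (\<integral>\<^sup>+ z. ennreal ((cmod (deriv g z))\<^sup>2 * indicator S z) \<partial>lborel)"
proof -
  define G where "G = (\<lambda>x. c2vec (g (vec2c x)))"
  define G' where "G' = (\<lambda>x h. c2vec (deriv g (vec2c x) * vec2c h))"
  define S' where "S' = vec2c -` S"
  define F where "F = (\<lambda>z. (cmod (deriv g z))\<^sup>2 * indicator S z)"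
  have S'_borel: "S' \<in> sets borel"
    unfolding S'_def using measurable_sets[OF measurable_vec2c S(1)] by simp
  have GS: "G ` S' = vec2c -` (g ` S)"
  proof (intro equalityI subsetI)
    fix y assume "y \<in> G ` S'"
    then show "y \<in> vec2c -` (g ` S)" by (auto simp: G_def S'_def)
  next
    fix y assume "y \<in> vec2c -` (g ` S)"
    then obtain s where s: "vec2c y = g s" "s \<in> S" by auto
    then have "G (c2vec s) = c2vec (vec2c y)" "c2vec s \<in> S'"
      by (simp_all add: G_def S'_def)
    then have "y = G (c2vec s)" "c2vec s \<in> S'" by simp_all
    then show "y \<in> G ` S'" by blast
  qed
  have GS_borel: "G ` S' \<in> sets borel"
    unfolding GS using measurable_sets[OF measurable_vec2c gS] by simp
  have injG: "inj_on G S'"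
    using inj unfolding inj_on_def G_def S'_def by (metis c2vec_vec2c vec2c_c2vec vimageD)
  have der: "(G has_derivative G' x) (at x within S')" if "x \<in> S'" for x
  proof -
    have "vec2c x \<in> U" using that S(2) by (auto simp: S'_def)
    then have "(g has_derivative (\<lambda>h. deriv g (vec2c x) * h)) (at (vec2c x))"
      using holomorphic_derivI[OF U(2,1)] by (simp add: has_field_derivative_def)
    from has_derivative_compose[OF bounded_linear.has_derivative[OF bounded_linear_vec2c has_derivative_ident] this]
    have "((\<lambda>x. g (vec2c x)) has_derivative (\<lambda>h. deriv g (vec2c x) * vec2c h)) (at x)" .
    from bounded_linear.has_derivative[OF bounded_linear_c2vec this]
    show ?thesis unfolding G_def G'_def by (rule has_derivative_at_withinI)
  qed
  have det: "\<bar>det (matrix (G' x))\<bar> = (cmod (deriv g (vec2c x)))\<^sup>2" for x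
    unfolding cmod_power2
    by (simp add: det_2 matrix_def G'_def c2vec_def vec2c_def axis_def power2_eq_square)
  have F_borel: "F \<in> borel_measurable borel"
    unfolding F_def by (rule borel_measurable_cmod_deriv[OF U S])
  have F': "(\<lambda>x. F (vec2c x)) \<in> borel_measurable borel"
    using F_borel by measurable
  \<comment> \<open>The theorem on differentiable images is an equivalence for each finite value m,
    so passing through all m settles the finite and the infinite case together.\<close>
  have "emeasure lborel (g ` S) = ennreal m
      \<longleftrightarrow> (\<integral>\<^sup>+ z. ennreal (F z) \<partial>lborel) = ennreal m" if m: "0 \<le> m" for m
  proof -
    have "emeasure lborel (g ` S) = ennreal m \<longleftrightarrow> emeasure lborel (G ` S') = ennreal m"
      by (simp add: GS emeasure_vimage_vec2c gS)
    also have "\<dots> \<longleftrightarrow> ((\<lambda>x. 1::real) has_integral m) (G ` S')"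
      by (simp add: has_integral_iff_emeasure_lborel GS_borel m)
    also have "\<dots> \<longleftrightarrow> G ` S' \<in> lmeasurable \<and> measure lebesgue (G ` S') = m"
      by (auto simp: has_integral_iff lmeasurable_iff_integrable_on lmeasure_integral)
    also have "\<dots> \<longleftrightarrow> ((\<lambda>x. \<bar>det (matrix (G' x))\<bar>) has_integral m) S'"
      using S'_borel by (intro has_measure_differentiable_image der injG) auto
    also have "\<dots> \<longleftrightarrow> ((\<lambda>x. F (vec2c x)) has_integral m) UNIV"
      unfolding det has_integral_restrict_UNIV[of S', symmetric]
      by (intro arg_cong[where f = "\<lambda>f. (f has_integral m) UNIV"])
         (auto simp: F_def S'_def indicator_def fun_eq_iff)
    also have "\<dots> \<longleftrightarrow> (\<integral>\<^sup>+ x. ennreal (F (vec2c x)) \<partial>lborel) = ennreal m"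
      by (intro has_integral_iff_nn_integral F' m) (simp add: F_def)
    also have "(\<integral>\<^sup>+ x. ennreal (F (vec2c x)) \<partial>lborel) = (\<integral>\<^sup>+ z. ennreal (F z) \<partial>lborel)"
    proof -
      have "(\<integral>\<^sup>+ z. ennreal (F z) \<partial>lborel) = (\<integral>\<^sup>+ z. ennreal (F z) \<partial>distr lborel borel vec2c)"
        by (simp only: distr_lborel_vec2c)
      with F_borel show ?thesis by (simp add: nn_integral_distr)
    qed
    finally show ?thesis .
  qed
  then show ?thesis unfolding F_def by (rule ennreal_eqI_finite)
qed

text \<open>The measure with density |g'|^2 on \<open>S\<close> is carried by \<open>g\<close> to
  Lebesgue measure on the image of \<open>S\<close>; integrating \<open>f\<close> against both gives
  the formula.\<close>

lemma nn_integral_holomorphic_image: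
  assumes U: "open U" "g holomorphic_on U" and inj: "inj_on g U"
    and S: "S \<in> sets borel" "S \<subseteq> U" and f: "f \<in> borel_measurable borel"
  shows "(\<integral>\<^sup>+ w. f w * indicator (g ` S) w \<partial>lborel)
    = (\<integral>\<^sup>+ z. f (g z) * ennreal ((cmod (deriv g z))\<^sup>2) * indicator S z \<partial>lborel)"
proof -
  \<comment> \<open>A Borel function on the whole plane that agrees with \<open>g\<close> on
    \<open>U\<close>, as needed to form the image measure.\<close>
  define g' where "g' = (\<lambda>z. if z \<in> U then g z else 0)"
  define J where "J = (\<lambda>z. ennreal ((cmod (deriv g z))\<^sup>2 * indicator S z))"
  have contg: "continuous_on U g" using U(2) by (rule holomorphic_on_imp_continuous_on)
  have g'_meas [measurable]: "g' \<in> borel \<rightarrow>\<^sub>M borel"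
    unfolding g'_def using U(1) contg
    by (intro borel_measurable_continuous_on_if) auto
  \<comment> \<open>Images of Borel sets are Borel because they are preimages under the holomorphic
    inverse \<open>k\<close> of \<open>g\<close>.\<close>
  have im_borel: "g ` T \<in> sets borel" if T: "T \<in> sets borel" "T \<subseteq> U" for T
  proof -
    obtain k where k: "k holomorphic_on (g ` U)" "\<And>z. z \<in> U \<Longrightarrow> k (g z) = z"
      using holomorphic_has_inverse[OF U(2,1) inj] by metis
    have op: "open (g ` U)" 
      by (rule open_mapping_thm3[OF U(2,1) inj])
    have "g ` T = {w \<in> g ` U. k w \<in> T}" using k(2) T(2) by force
    also have "\<dots> = (\<lambda>w. if w \<in> g ` U then k w else 0) -` T \<inter> g ` U" by auto
    also have "\<dots> \<in> sets borel"
    proof -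
      have "(\<lambda>w. if w \<in> g ` U then k w else 0) \<in> borel \<rightarrow>\<^sub>M borel"
        using op holomorphic_on_imp_continuous_on[OF k(1)]
        by (intro borel_measurable_continuous_on_if) auto
      from measurable_sets[OF this T(1)] op show ?thesis by auto
    qed
    finally show ?thesis .
  qed
  have J_meas [measurable]: "J \<in> borel_measurable borel"
    unfolding J_def using borel_measurable_cmod_deriv[OF U S] by measurable
  have eq: "distr (density lborel J) borel g' = density lborel (indicator (g ` S))"
  proof (rule measure_eqI)
    fix B assume "B \<in> sets (distr (density lborel J) borel g')"
    then have B [measurable]: "B \<in> sets borel" by simp
    define T where "T = g' -` B \<inter> S"
    have T: "T \<in> sets borel" "T \<subseteq> S" 
      unfolding T_def using measurable_sets[OF g'_meas B] S(1) by auto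
    have gT: "g ` T = B \<inter> g ` S" using S(2) by (auto simp: T_def g'_def)
    have "emeasure (distr (density lborel J) borel g') B = emeasure (density lborel J) (g' -` B)"
      by (subst emeasure_distr) auto
    also have "\<dots> = (\<integral>\<^sup>+ z. J z * indicator (g' -` B) z \<partial>lborel)"
      using measurable_sets[OF g'_meas B] by (subst emeasure_density) auto
    also have "\<dots> = (\<integral>\<^sup>+ z. ennreal ((cmod (deriv g z))\<^sup>2 * indicator T z) \<partial>lborel)"
      by (intro nn_integral_cong) (auto simp: J_def T_def indicator_def)
    also have "\<dots> = emeasure lborel (g ` T)"
      using T S(2) by (intro emeasure_holomorphic_image[OF U, symmetric] im_borel inj_on_subset[OF inj]) auto
    also have "\<dots> = (\<integral>\<^sup>+ w. indicator (B \<inter> g ` S) w \<partial>lborel)"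
      using im_borel[OF S] unfolding gT by (subst nn_integral_indicator) auto
    also have "\<dots> = (\<integral>\<^sup>+ w. indicator (g ` S) w * indicator B w \<partial>lborel)"
      by (intro nn_integral_cong) (auto simp: indicator_def)
    also have "\<dots> = emeasure (density lborel (indicator (g ` S))) B"
      using im_borel[OF S] by (subst emeasure_density) auto
    finally show "emeasure (distr (density lborel J) borel g') B
      = emeasure (density lborel (indicator (g ` S))) B" .
  qed simp
  have "(\<integral>\<^sup>+ w. f w * indicator (g ` S) w \<partial>lborel) = (\<integral>\<^sup>+ w. f w \<partial>density lborel (indicator (g ` S)))"
    using f im_borel[OF S] by (subst nn_integral_density) (auto simp: mult.commute)
  also have "\<dots> = (\<integral>\<^sup>+ z. f (g' z) \<partial>density lborel J)"
    unfolding eq[symmetric] using f by (subst nn_integral_distr) auto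
  also have "\<dots> = (\<integral>\<^sup>+ z. J z * f (g' z) \<partial>lborel)"
    using f by (subst nn_integral_density) auto
  also have "\<dots> = (\<integral>\<^sup>+ z. f (g z) * ennreal ((cmod (deriv g z))\<^sup>2) * indicator S z \<partial>lborel)"
    using S(2) by (intro nn_integral_cong) (auto simp: J_def g'_def indicator_def mult.commute)
  finally show ?thesis .
qed

section \<open>Integrals of derivatives of compactly supported functions\<close>

lemma lborel_integral_translate:
  fixes F :: "'a::euclidean_space \<Rightarrow> 'b::{banach, second_countable_topology}"
  assumes "integrable lborel F"
  shows "integrable lborel (\<lambda>x. F (x + c))" "(\<integral>x. F (x + c) \<partial>lborel) = (\<integral>x. F x \<partial>lborel)"
proof -
  have F: "F \<in> borel_measurable borel" using assms by auto
  have "integrable (distr lborel borel ((+) c)) F" by (simp add: lborel_distr_plus assms)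
  then show "integrable lborel (\<lambda>x. F (x + c))"
    using F by (simp add: integrable_distr_eq add.commute)
  have "(\<integral>x. F x \<partial>lborel) = (\<integral>x. F x \<partial>distr lborel borel ((+) c))" by (simp add: lborel_distr_plus)
  also have "\<dots> = (\<integral>x. F (x + c) \<partial>lborel)" using F by (simp add: integral_distr add.commute)
  finally show "(\<integral>x. F (x + c) \<partial>lborel) = (\<integral>x. F x \<partial>lborel)" by simp
qed

lemma integrable_lborel_compact_support:
  fixes F :: "'a::euclidean_space \<Rightarrow> 'b::{banach, second_countable_topology}"
  assumes "continuous_on UNIV F" "compact K" "\<And>x. x \<notin> K \<Longrightarrow> F x = 0"
  shows "integrable lborel F"
proof -
  have "integrable lborel (\<lambda>x. indicator K x *\<^sub>R F x)"
    using assms(1,2) by (intro borel_integrable_compact) (auto intro: continuous_on_subset)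
  moreover have "(\<lambda>x. indicator K x *\<^sub>R F x) = F"
    using assms(3) by (auto simp: indicator_def fun_eq_iff)
  ultimately show ?thesis by simp
qed

text \<open>The difference quotients have integral \<open>0\<close> by translation invariance.\<close>

lemma integral_directional_derivative_eq_0:
  fixes F :: "'a::euclidean_space \<Rightarrow> 'b::euclidean_space"
  assumes diff: "\<And>z. F differentiable at z"
    and cont: "continuous_on UNIV (\<lambda>z. frechet_derivative F (at z) v)"
    and K: "compact K" "\<And>z. z \<notin> K \<Longrightarrow> F z = 0"
  shows "(\<integral>z. frechet_derivative F (at z) v \<partial>lborel) = 0"
proof -
  define D where "D = (\<lambda>z. frechet_derivative F (at z) v)"
  have D0: "D z = 0" if "z \<notin> K" for z
  proof -
    have "frechet_derivative F (at z) = frechet_derivative (\<lambda>z. 0) (at z)"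
      by (rule frechet_derivative_cong_open[of "- K"])
         (use that K in \<open>auto simp: compact_imp_closed\<close>)
    then show ?thesis by (simp add: D_def)
  qed
  have contF: "continuous_on UNIV F"
    using diff by (simp add: continuous_at_imp_continuous_on differentiable_imp_continuous_within)
  have intF: "integrable lborel F" by (rule integrable_lborel_compact_support[OF contF K])
  have "bounded (D ` K)"
    using cont K(1) by (intro compact_imp_bounded compact_continuous_image) 
      (auto simp: D_def intro: continuous_on_subset)
  then obtain B where B: "B > 0" "\<And>z. z \<in> K \<Longrightarrow> norm (D z) \<le> B"
    by (auto simp: bounded_pos)
  have BD: "norm (D z) \<le> B" for z using B D0[of z] by (cases "z \<in> K") auto
  obtain R where R: "\<And>z. z \<in> K \<Longrightarrow> norm z \<le> R"
    using compact_imp_bounded[OF K(1)] by (auto simp: bounded_iff)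
  have line: "((\<lambda>t. F (z + t *\<^sub>R v)) has_derivative (\<lambda>h. h *\<^sub>R D (z + t *\<^sub>R v))) (at t within T)" for z t T
  proof -
    have Fd: "(F has_derivative frechet_derivative F (at (z + t *\<^sub>R v))) (at (z + t *\<^sub>R v))"
      using diff frechet_derivative_works by blast
    have "((\<lambda>t. z + t *\<^sub>R v) has_derivative (\<lambda>h. h *\<^sub>R v)) (at t within T)"
      by (auto intro!: derivative_eq_intros)
    from has_derivative_compose[OF this Fd]
    show ?thesis
      by (simp add: D_def linear_scale[OF has_derivative_linear[OF Fd]])
  qed
  \<comment> \<open>The Lipschitz bound makes the difference quotients uniformly bounded, as
    dominated convergence requires.\<close>
  have lip: "norm (F (z + t *\<^sub>R v) - F z) \<le> B * \<bar>t\<bar>" for z t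
  proof -
    have "norm (F (z + t *\<^sub>R v) - F (z + 0 *\<^sub>R v)) \<le> B * norm (t - 0)"
    proof (rule differentiable_bound[OF convex_UNIV line])
      show "onorm (\<lambda>h. h *\<^sub>R D (z + s *\<^sub>R v)) \<le> B" for s
        using BD[of "z + s *\<^sub>R v"]
        by (intro onorm_le) (simp add: mult.commute[of B] mult_left_mono)
    qed auto
    then show ?thesis by simp
  qed
  define s where "s = (\<lambda>n z. real (Suc n) *\<^sub>R (F (z + inverse (real (Suc n)) *\<^sub>R v) - F z))"
  have "(\<lambda>n. \<integral>z. s n z \<partial>lborel) \<longlonglongrightarrow> (\<integral>z. D z \<partial>lborel)"
  \<comment> \<open>The increments have length at most \<open>norm v\<close> and \<open>K\<close>
    lies in the ball of radius \<open>R\<close>, so all quotients vanish outside the ball of radius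
    \<open>R + norm v\<close>.\<close>
  proof (rule integral_dominated_convergence[where w = "\<lambda>z. indicator (cball 0 (R + norm v)) z *\<^sub>R B"])
    show "D \<in> borel_measurable lborel"
      using cont by (simp add: D_def borel_measurable_continuous_onI)
    show "s n \<in> borel_measurable lborel" for n
      unfolding s_def using intF by measurable
    show "integrable lborel (\<lambda>z::'a. indicator (cball 0 (R + norm v)) z *\<^sub>R B)"
      by (rule borel_integrable_compact) auto
    show "AE z in lborel. (\<lambda>n. s n z) \<longlonglongrightarrow> D z"
    proof (intro AE_I2)
      fix z
      have "((\<lambda>t. norm (F (z + t *\<^sub>R v) - F z - t *\<^sub>R D z) / norm t) \<longlongrightarrow> 0) (at 0)"
        using line[of z 0 UNIV] by (simp add: has_derivative_at)
      then have "(\<lambda>n. norm (F (z + inverse (real (Suc n)) *\<^sub>R v) - F z - inverse (real (Suc n)) *\<^sub>R D z)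
          / norm (inverse (real (Suc n)))) \<longlonglongrightarrow> 0"
        by (rule filterlim_compose) 
           (auto simp: filterlim_at simp del: of_nat_Suc intro!: LIMSEQ_inverse_real_of_nat)
      moreover have "norm (F (z + inverse (real (Suc n)) *\<^sub>R v) - F z - inverse (real (Suc n)) *\<^sub>R D z)
          / norm (inverse (real (Suc n))) = norm (s n z - D z)" for n
      proof -
        have "s n z - D z = real (Suc n) *\<^sub>R (F (z + inverse (real (Suc n)) *\<^sub>R v) - F z - inverse (real (Suc n)) *\<^sub>R D z)"
          unfolding s_def by (simp add: scaleR_diff_right del: of_nat_Suc)
        then show ?thesis by (simp add: divide_inverse mult.commute del: of_nat_Suc)
      qed
      ultimately have "(\<lambda>n. norm (s n z - D z)) \<longlonglongrightarrow> 0" by simp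
      then show "(\<lambda>n. s n z) \<longlonglongrightarrow> D z"
        by (simp add: tendsto_norm_zero_iff LIM_zero_iff)
    qed
    fix n
    show "AE z in lborel. norm (s n z) \<le> indicator (cball 0 (R + norm v)) z *\<^sub>R B"
    proof (intro AE_I2)
      fix z
      show "norm (s n z) \<le> indicator (cball 0 (R + norm v)) z *\<^sub>R B"
      proof (cases "z \<in> cball 0 (R + norm v)")
        case True
        have "norm (s n z) \<le> real (Suc n) * (B * \<bar>inverse (real (Suc n))\<bar>)"
          unfolding s_def norm_scaleR abs_of_nat by (intro mult_left_mono lip) auto
        also have "\<dots> = B" by (simp add: field_simps)
        finally show ?thesis using True by simp
      next
        case False
        have "norm (inverse (real (Suc n)) *\<^sub>R v) \<le> norm v"
          by (simp add: mult_left_le_one_le inverse_le_1_iff del: of_nat_Suc)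
        moreover have "norm z \<le> norm (z + inverse (real (Suc n)) *\<^sub>R v) + norm (inverse (real (Suc n)) *\<^sub>R v)"
          by (metis add_diff_cancel norm_triangle_ineq4)
        moreover have "R + norm v < norm z" using False by simp
        ultimately have "R < norm (z + inverse (real (Suc n)) *\<^sub>R v)" "R < norm z"
          using norm_ge_zero[of v] by linarith+
        then have "z + inverse (real (Suc n)) *\<^sub>R v \<notin> K" "z \<notin> K" using R by force+
        then show ?thesis using False by (simp add: s_def K(2))
      qed
    qed
  qed
  moreover have "(\<integral>z. s n z \<partial>lborel) = 0" for n
    unfolding s_def using lborel_integral_translate[OF intF, of "inverse (real (Suc n)) *\<^sub>R v"] intF
    by simp
  ultimately show ?thesis by (simp add: D_def LIMSEQ_const_iff)
qed

section \<open>Wirtinger calculus\<close>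

text \<open>A real-linear map of the plane is \<open>a * h + b * cnj h\<close> for unique
  coefficients, and these are the two Wirtinger derivatives. Most rules below are obtained by
  reading off these coefficients.\<close>

lemma d_dz_eqI:
  assumes "(f has_derivative (\<lambda>h. a * h + b * cnj h)) (at z)"
  shows "d_dz f z = a" "d_dzbar f z = b"
proof -
  have *: "frechet_derivative f (at z) = (\<lambda>h. a * h + b * cnj h)"
    using frechet_derivative_at[OF assms] by simp
  show "d_dz f z = a" "d_dzbar f z = b"
    unfolding d_dz_def d_dzbar_def partial_x_def partial_y_def *
    by (simp_all add: algebra_simps)
qed

lemma has_derivative_wirtinger:
  assumes "f differentiable at z"
  shows "(f has_derivative (\<lambda>h. d_dz f z * h + d_dzbar f z * cnj h)) (at z)"
proof -
  let ?D = "frechet_derivative f (at z)"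
  have D: "(f has_derivative ?D) (at z)" using assms by (simp only: frechet_derivative_works)
  interpret linear ?D using D by (rule has_derivative_linear)
  have "?D h = d_dz f z * h + d_dzbar f z * cnj h" for h
  proof -
    have "?D h = ?D (Re h *\<^sub>R 1 + Im h *\<^sub>R \<i>)"
      by (rule arg_cong[where f = ?D]) (simp add: complex_eq_iff)
    also have "\<dots> = Re h *\<^sub>R ?D 1 + Im h *\<^sub>R ?D \<i>"
      by (simp only: add scale)
    also have "\<dots> = d_dz f z * h + d_dzbar f z * cnj h"
      unfolding d_dz_def d_dzbar_def partial_x_def partial_y_def
      by (simp add: complex_eq_iff field_simps)
    finally show ?thesis .
  qed
  then have "?D = (\<lambda>h. d_dz f z * h + d_dzbar f z * cnj h)" by (rule ext)
  with D show ?thesis by simp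
qed

lemma d_dz_cong:
  assumes "open S" "z \<in> S" "\<And>w. w \<in> S \<Longrightarrow> f w = g w"
  shows "d_dz f z = d_dz g z" "d_dzbar f z = d_dzbar g z"
  unfolding d_dz_def d_dzbar_def partial_x_def partial_y_def
  by (simp_all only: frechet_derivative_cong_open[OF assms])

lemma Ck_on_d_dz:
  assumes "open S" "Ck_on (Suc k) f S"
  shows "Ck_on k (d_dz f) S" "Ck_on k (d_dzbar f) S"
proof -
  have x: "Ck_on k (\<lambda>z. frechet_derivative f (at z) 1) S"
    and y: "Ck_on k (\<lambda>z. frechet_derivative f (at z) \<i>) S"
    using Ck_on_SucD(2)[OF assms(2)] by auto
  have "Ck_on k (\<lambda>z. (1/2) * frechet_derivative f (at z) 1
      + (- (\<i> / 2)) * frechet_derivative f (at z) \<i>) S"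
    by (intro Ck_on_add assms(1) Ck_on_bilinear[OF bounded_bilinear_mult] x y Ck_on_const)
  then show "Ck_on k (d_dz f) S"
    by (simp add: d_dz_def[abs_def] partial_x_def partial_y_def diff_divide_distrib)
  have "Ck_on k (\<lambda>z. (1/2) * frechet_derivative f (at z) 1
      + (\<i> / 2) * frechet_derivative f (at z) \<i>) S"
    by (intro Ck_on_add assms(1) Ck_on_bilinear[OF bounded_bilinear_mult] x y Ck_on_const)
  then show "Ck_on k (d_dzbar f) S"
    by (simp add: d_dzbar_def[abs_def] partial_x_def partial_y_def add_divide_distrib)
qed

lemma d_dz_mult:
  assumes "f differentiable at z" "g differentiable at z"
  shows "d_dz (\<lambda>w. f w * g w) z = d_dz f z * g z + f z * d_dz g z"
    "d_dzbar (\<lambda>w. f w * g w) z = d_dzbar f z * g z + f z * d_dzbar g z"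
proof -
  have "((\<lambda>w. f w * g w) has_derivative
      (\<lambda>h. (d_dz f z * g z + f z * d_dz g z) * h + (d_dzbar f z * g z + f z * d_dzbar g z) * cnj h)) (at z)"
    by (rule has_derivative_eq_rhs[OF has_derivative_mult[OF assms[THEN has_derivative_wirtinger]]])
       (simp add: fun_eq_iff algebra_simps)
  from d_dz_eqI[OF this] show
    "d_dz (\<lambda>w. f w * g w) z = d_dz f z * g z + f z * d_dz g z"
    "d_dzbar (\<lambda>w. f w * g w) z = d_dzbar f z * g z + f z * d_dzbar g z" .
qed

lemma d_dz_add:
  assumes "f differentiable at z" "g differentiable at z"
  shows "d_dz (\<lambda>w. f w + g w) z = d_dz f z + d_dz g z"
    "d_dzbar (\<lambda>w. f w + g w) z = d_dzbar f z + d_dzbar g z"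
proof -
  have "((\<lambda>w. f w + g w) has_derivative
      (\<lambda>h. (d_dz f z + d_dz g z) * h + (d_dzbar f z + d_dzbar g z) * cnj h)) (at z)"
    by (rule has_derivative_eq_rhs[OF has_derivative_add[OF assms[THEN has_derivative_wirtinger]]])
       (simp add: fun_eq_iff algebra_simps)
  from d_dz_eqI[OF this] show "d_dz (\<lambda>w. f w + g w) z = d_dz f z + d_dz g z"
    "d_dzbar (\<lambda>w. f w + g w) z = d_dzbar f z + d_dzbar g z" .
qed

lemma d_dz_const [simp]: "d_dz (\<lambda>w. c) z = 0" "d_dzbar (\<lambda>w. c) z = 0"
proof -
  have "((\<lambda>w. c) has_derivative (\<lambda>h. 0 * h + 0 * cnj h)) (at z)" by simp
  from d_dz_eqI[OF this] show "d_dz (\<lambda>w. c) z = 0" "d_dzbar (\<lambda>w. c) z = 0" .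
qed

lemma d_dz_cmult:
  assumes "f differentiable at z"
  shows "d_dz (\<lambda>w. c * f w) z = c * d_dz f z" "d_dzbar (\<lambda>w. c * f w) z = c * d_dzbar f z"
  using d_dz_mult[OF differentiable_const assms, of c] by simp_all

lemma d_dz_cnj:
  assumes "f differentiable at z"
  shows "d_dz (\<lambda>w. cnj (f w)) z = cnj (d_dzbar f z)" "d_dzbar (\<lambda>w. cnj (f w)) z = cnj (d_dz f z)"
    and "(\<lambda>w. cnj (f w)) differentiable at z"
proof -
  have "((\<lambda>w. cnj (f w)) has_derivative
      (\<lambda>h. cnj (d_dzbar f z) * h + cnj (d_dz f z) * cnj h)) (at z)"
    by (rule has_derivative_eq_rhs[OF has_derivative_cnj[OF has_derivative_wirtinger[OF assms]]])
       (simp add: fun_eq_iff)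
  from d_dz_eqI[OF this] differentiableI[OF this] show
    "d_dz (\<lambda>w. cnj (f w)) z = cnj (d_dzbar f z)" "d_dzbar (\<lambda>w. cnj (f w)) z = cnj (d_dz f z)"
    "(\<lambda>w. cnj (f w)) differentiable at z" .
qed

lemma d_dz_compose_holomorphic:
  assumes "f differentiable at (g z)" "(g has_field_derivative g') (at z)"
  shows "d_dz (\<lambda>w. f (g w)) z = g' * d_dz f (g z)"
    "d_dzbar (\<lambda>w. f (g w)) z = cnj g' * d_dzbar f (g z)"
    and "(\<lambda>w. f (g w)) differentiable at z"
proof -
  have g: "(g has_derivative (\<lambda>h. g' * h)) (at z)"
    using assms(2) by (simp add: has_field_derivative_def)
  have "((\<lambda>w. f (g w)) has_derivative
      (\<lambda>h. (g' * d_dz f (g z)) * h + (cnj g' * d_dzbar f (g z)) * cnj h)) (at z)"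
    by (rule has_derivative_eq_rhs[OF has_derivative_compose[OF g has_derivative_wirtinger[OF assms(1)]]])
       (simp add: fun_eq_iff algebra_simps)
  from d_dz_eqI[OF this] differentiableI[OF this] show
    "d_dz (\<lambda>w. f (g w)) z = g' * d_dz f (g z)"
    "d_dzbar (\<lambda>w. f (g w)) z = cnj g' * d_dzbar f (g z)"
    "(\<lambda>w. f (g w)) differentiable at z" .
qed

lemma d_dz_holomorphic:
  assumes "(f has_field_derivative f') (at z)"
  shows "d_dz f z = f'" "d_dzbar f z = 0"
proof -
  have "(f has_derivative (\<lambda>h. f' * h + 0 * cnj h)) (at z)"
    using assms by (simp add: has_field_derivative_def)
  from d_dz_eqI[OF this] show "d_dz f z = f'" "d_dzbar f z = 0" .
qed

text \<open>The inner derivative produces the factor \<open>cnj (deriv g w)\<close>, which is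
  antiholomorphic and so is treated as a constant by the outer one. The resulting |g'|^2 is the
  factor by which a metric on the tangent bundle changes between charts.\<close>

lemma d_dz_d_dzbar_compose_holomorphic:
  assumes U: "open U" "g holomorphic_on U" "z \<in> U"
    and V: "open V" "g ` U \<subseteq> V" "Ck_on 2 f V"
  shows "d_dz (d_dzbar (\<lambda>w. f (g w))) z
    = of_real ((cmod (deriv g z))\<^sup>2) * d_dz (d_dzbar f) (g z)"
proof -
  have V2: "Ck_on (Suc 1) f V" using V(3) by (simp add: numeral_2_eq_2)
  have g': "(g has_field_derivative deriv g w) (at w)" if "w \<in> U" for w
    by (rule holomorphic_derivI[OF U(2,1) that])
  have "d_dz (d_dzbar (\<lambda>w. f (g w))) z = d_dz (\<lambda>w. cnj (deriv g w) * d_dzbar f (g w)) z"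
  proof (rule d_dz_cong[OF U(1,3)])
    fix w assume w: "w \<in> U"
    then have "g w \<in> V" using V(2) by auto
    then show "d_dzbar (\<lambda>w. f (g w)) w = cnj (deriv g w) * d_dzbar f (g w)"
      by (rule d_dz_compose_holomorphic(2)[OF Ck_on_SucD(1)[OF V2] g'[OF w]])
  qed
  also have "\<dots> = cnj (deriv g z) * (deriv g z * d_dz (d_dzbar f) (g z))"
  proof -
    have gz: "g z \<in> V" using U(3) V(2) by auto
    have "Ck_on (Suc 0) (d_dzbar f) V" using Ck_on_d_dz(2)[OF V(1) V2] by simp
    from Ck_on_SucD(1)[OF this gz] have df: "d_dzbar f differentiable at (g z)" .
    have dg: "(deriv g has_field_derivative deriv (deriv g) z) (at z)"
      by (rule holomorphic_derivI[OF holomorphic_deriv[OF U(2,1)] U(1,3)])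
    then have dgd: "deriv g differentiable at z"
      by (auto simp: has_field_derivative_def intro: differentiableI)
    show ?thesis
      using d_dz_mult(1)[OF d_dz_cnj(3)[OF dgd] d_dz_compose_holomorphic(3)[OF df g'[OF U(3)]]]
      by (simp add: d_dz_cnj(1)[OF dgd] d_dz_holomorphic[OF dg] d_dz_compose_holomorphic(1)[OF df g'[OF U(3)]])
  qed
  also have "\<dots> = of_real ((cmod (deriv g z))\<^sup>2) * d_dz (d_dzbar f) (g z)"
    using complex_norm_square[of "deriv g z"] by (simp add: mult_ac)
  finally show ?thesis .
qed

lemma integral_d_dz_eq_0:
  assumes F: "Ck_on 1 F UNIV" and K: "compact K" "\<And>z. z \<notin> K \<Longrightarrow> F z = 0"
  shows "(\<integral>z. d_dz F z \<partial>lborel) = 0"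
proof -
  have F1: "Ck_on (Suc 0) F UNIV" using F by simp
  have d: "F differentiable at z" for z using Ck_on_SucD(1)[OF F1] by simp
  have c: "continuous_on UNIV (\<lambda>z. frechet_derivative F (at z) v)" if "v \<in> {1, \<i>}" for v
    using Ck_on_SucD(2)[OF F1 that] by simp
  have z: "frechet_derivative F (at z) v = 0" if "z \<notin> K" for z v
    using frechet_derivative_cong_open[OF open_Compl[OF compact_imp_closed[OF K(1)]], of z F "\<lambda>_. 0"]
      that K(2) by simp
  have i: "integrable lborel (\<lambda>z. frechet_derivative F (at z) v)" if "v \<in> {1, \<i>}" for v
    by (rule integrable_lborel_compact_support[OF c[OF that] K(1) z])
  have "(\<integral>z. d_dz F z \<partial>lborel) = (\<integral>z. (1/2) * frechet_derivative F (at z) 1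
      - (\<i> / 2) * frechet_derivative F (at z) \<i> \<partial>lborel)"
    by (simp add: d_dz_def[abs_def] partial_x_def partial_y_def diff_divide_distrib)
  also have "\<dots> = (1/2) * (\<integral>z. frechet_derivative F (at z) 1 \<partial>lborel)
      - (\<i> / 2) * (\<integral>z. frechet_derivative F (at z) \<i> \<partial>lborel)"
    by (subst Bochner_Integration.integral_diff) (auto intro!: integrable_mult_right i)
  also have "\<dots> = 0"
    using integral_directional_derivative_eq_0[OF d c K] by simp
  finally show ?thesis .
qed

section \<open>Smooth functions on a compact Riemann surface\<close>

lemma continuous_on_local:
  fixes f :: "'a::t2_space \<Rightarrow> 'b::topological_space"
  assumes "\<And>x. x \<in> W \<Longrightarrow> \<exists>V. open V \<and> x \<in> V \<and> continuous_on V f"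
  shows "continuous_on W f"
proof (rule continuous_at_imp_continuous_on, rule ballI)
  fix x assume "x \<in> W"
  with assms obtain V where "open V" "x \<in> V" "continuous_on V f" by meson
  then show "isCont f x" by (simp add: continuous_on_eq_continuous_at)
qed

lemma tangent_bundle_simps [simp]:
  "lb_index (tangent_bundle A) = A" "lb_dom (tangent_bundle A) = fst"
  "lb_trans (tangent_bundle A) c d x = deriv (snd c \<circ> chart_inv d) (snd d x)"
  by (simp_all add: tangent_bundle_def)

locale riemann_surface =
  fixes A :: "'a::t2_space chart set"
  assumes compact_riemann_surface: "compact_riemann_surface A"
begin

lemma compact_UNIV: "compact (UNIV :: 'a set)"
  using compact_riemann_surface by (simp add: compact_riemann_surface_def)

lemma chart_at: obtains c where "c \<in> A" "x \<in> fst c"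
proof -
  have "x \<in> (\<Union>c\<in>A. fst c)" using compact_riemann_surface by (simp add: compact_riemann_surface_def)
  with that show thesis by blast
qed

lemma index_at_tangent: "index_at (tangent_bundle A) x \<in> A" "x \<in> fst (index_at (tangent_bundle A) x)"
proof -
  have "\<exists>c. c \<in> A \<and> x \<in> fst c" using chart_at[of x] by metis
  from someI_ex[OF this]
  show "index_at (tangent_bundle A) x \<in> A" "x \<in> fst (index_at (tangent_bundle A) x)"
    by (simp_all add: index_at_def)
qed

context
  fixes c assumes c: "c \<in> A"
begin

lemma is_chart: "is_chart c"
  using compact_riemann_surface c by (simp add: compact_riemann_surface_def)

lemma open_chart_dom: "open (fst c)" and open_chart_image: "open (snd c ` fst c)"
  using is_chart by (simp_all add: is_chart_def)

lemma chart_homeomorphism: "homeomorphism (fst c) (snd c ` fst c) (snd c) (chart_inv c)"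
  using is_chart by (simp add: is_chart_def)

lemma continuous_on_chart: "continuous_on (fst c) (snd c)"
  and continuous_on_chart_inv: "continuous_on (snd c ` fst c) (chart_inv c)"
  using chart_homeomorphism by (simp_all add: homeomorphism_def)

lemma chart_inv_chart: "x \<in> fst c \<Longrightarrow> chart_inv c (snd c x) = x"
  using chart_homeomorphism by (simp add: homeomorphism_def)

lemma chart_chart_inv: "z \<in> snd c ` fst c \<Longrightarrow> snd c (chart_inv c z) = z"
  by (rule f_inv_into_f)

lemma chart_inv_in_dom: "z \<in> snd c ` fst c \<Longrightarrow> chart_inv c z \<in> fst c"
  by (rule inv_into_into)

lemma inj_on_chart: "inj_on (snd c) (fst c)"
  using chart_inv_chart by (rule inj_on_inverseI)

lemma in_chart_image_iff:
  "z \<in> snd c ` (fst c \<inter> W) \<longleftrightarrow> z \<in> snd c ` fst c \<and> chart_inv c z \<in> W"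
proof
  assume "z \<in> snd c ` (fst c \<inter> W)"
  then obtain x where x: "x \<in> fst c" "x \<in> W" "z = snd c x" by auto
  then show "z \<in> snd c ` fst c \<and> chart_inv c z \<in> W" by (simp add: chart_inv_chart)
next
  assume z: "z \<in> snd c ` fst c \<and> chart_inv c z \<in> W"
  then have "z = snd c (chart_inv c z)" "chart_inv c z \<in> fst c \<inter> W"
    by (simp_all add: chart_chart_inv chart_inv_in_dom)
  then show "z \<in> snd c ` (fst c \<inter> W)" by (rule image_eqI)
qed

lemma chart_image_eq: "snd c ` (fst c \<inter> W) = chart_inv c -` W \<inter> snd c ` fst c"
  by (rule set_eqI) (simp only: in_chart_image_iff vimage_eq Int_iff conj_commute)

lemma open_chart_image_Int: "open W \<Longrightarrow> open (snd c ` (fst c \<inter> W))"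
  unfolding chart_image_eq
  by (rule continuous_open_preimage[OF continuous_on_chart_inv open_chart_image,
        unfolded Int_commute[of "snd c ` fst c"]])

lemma continuous_on_chartI:
  assumes "continuous_on (snd c ` (fst c \<inter> W)) (f \<circ> chart_inv c)"
  shows "continuous_on (fst c \<inter> W) f"
proof -
  have "continuous_on (fst c \<inter> W) (\<lambda>x. (f \<circ> chart_inv c) (snd c x))"
    by (rule continuous_on_compose2[OF assms]) (auto intro: continuous_on_subset[OF continuous_on_chart])
  then show ?thesis
    by (rule continuous_on_eq) (simp add: chart_inv_chart)
qed

lemma continuous_on_chartD:
  assumes "continuous_on (fst c \<inter> W) f"
  shows "continuous_on (snd c ` (fst c \<inter> W)) (f \<circ> chart_inv c)"
  unfolding o_def
proof (rule continuous_on_compose2[OF assms])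
  show "continuous_on (snd c ` (fst c \<inter> W)) (chart_inv c)"
    by (rule continuous_on_subset[OF continuous_on_chart_inv]) auto
  show "chart_inv c ` (snd c ` (fst c \<inter> W)) \<subseteq> fst c \<inter> W"
    by (auto simp: chart_inv_chart)
qed

end

lemma transition:
  assumes "c \<in> A" "d \<in> A"
  shows "(snd c \<circ> chart_inv d) holomorphic_on (snd d ` (fst d \<inter> fst c))"
  using assms compact_riemann_surface by (simp add: compact_riemann_surface_def Int_commute)

lemma chart_inv_transition:
  assumes "c \<in> A" "d \<in> A" "z \<in> snd d ` (fst d \<inter> fst c)"
  shows "chart_inv c (snd c (chart_inv d z)) = chart_inv d z"
  using assms by (simp add: in_chart_image_iff chart_inv_chart)

lemma smooth_on_surface_subset:
  "smooth_on_surface A W f \<Longrightarrow> V \<subseteq> W \<Longrightarrow> smooth_on_surface A V f"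
  unfolding smooth_on_surface_def smooth_on_def by (meson Ck_on_subset Int_mono image_mono order_refl)

lemma smooth_on_surface_cong:
  assumes "open W" "\<And>x. x \<in> W \<Longrightarrow> f x = g x" "smooth_on_surface A W g"
  shows "smooth_on_surface A W f"
  unfolding smooth_on_surface_def smooth_on_def
proof (intro ballI allI)
  fix c k assume c: "c \<in> A"
  have "Ck_on k (g \<circ> chart_inv c) (snd c ` (fst c \<inter> W))"
    using assms(3) c by (simp add: smooth_on_surface_def smooth_on_def)
  then show "Ck_on k (f \<circ> chart_inv c) (snd c ` (fst c \<inter> W))"
    by (subst Ck_on_cong[where g = "g \<circ> chart_inv c"])
       (use assms(1,2) c in \<open>simp_all add: open_chart_image_Int in_chart_image_iff\<close>)
qed

lemma smooth_on_surface_local: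
  assumes "\<And>x. x \<in> W \<Longrightarrow> \<exists>V. open V \<and> x \<in> V \<and> smooth_on_surface A V f"
  shows "smooth_on_surface A W f"
  unfolding smooth_on_surface_def smooth_on_def
proof (intro ballI allI)
  fix c k assume c: "c \<in> A"
  show "Ck_on k (f \<circ> chart_inv c) (snd c ` (fst c \<inter> W))"
  proof (rule Ck_on_local)
    fix z assume "z \<in> snd c ` (fst c \<inter> W)"
    then have z: "z \<in> snd c ` fst c" "chart_inv c z \<in> W" using in_chart_image_iff[OF c] by auto
    with assms obtain V where V: "open V" "chart_inv c z \<in> V" "smooth_on_surface A V f" by meson
    have "Ck_on k (f \<circ> chart_inv c) (snd c ` (fst c \<inter> V))"
      using V(3) c by (simp add: smooth_on_surface_def smooth_on_def)
    moreover have "z \<in> snd c ` (fst c \<inter> V)" using V(2) z(1) in_chart_image_iff[OF c] by auto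
    ultimately show "\<exists>T. open T \<and> z \<in> T \<and> Ck_on k (f \<circ> chart_inv c) T"
      using open_chart_image_Int[OF c V(1)] by meson
  qed
qed

lemma smooth_on_surface_const: "smooth_on_surface A W (\<lambda>x. a)"
  unfolding smooth_on_surface_def smooth_on_def o_def by simp

lemma smooth_on_surface_bounded_linear:
  assumes "bounded_linear L" "open W" "smooth_on_surface A W f"
  shows "smooth_on_surface A W (\<lambda>x. L (f x))"
  using assms(3) unfolding smooth_on_surface_def smooth_on_def o_def
  by (intro ballI allI Ck_on_bounded_linear[OF assms(1)] open_chart_image_Int assms(2)) blast+

lemma smooth_on_surface_add:
  assumes "open W" "smooth_on_surface A W f" "smooth_on_surface A W g"
  shows "smooth_on_surface A W (\<lambda>x. f x + g x)"
  using assms(2,3) unfolding smooth_on_surface_def smooth_on_def o_def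
  by (intro ballI allI Ck_on_add open_chart_image_Int assms(1)) blast+

lemma smooth_on_surface_bilinear:
  assumes "bounded_bilinear pr" "open W" "smooth_on_surface A W f" "smooth_on_surface A W g"
  shows "smooth_on_surface A W (\<lambda>x. pr (f x) (g x))"
  using assms(3,4) unfolding smooth_on_surface_def smooth_on_def o_def
  by (intro ballI allI Ck_on_bilinear[OF assms(1)] open_chart_image_Int assms(2)) blast+

lemma smooth_on_surface_inverse:
  fixes f :: "'a \<Rightarrow> 'b::real_normed_field"
  assumes "open W" "\<And>x. x \<in> W \<Longrightarrow> f x \<noteq> 0" "smooth_on_surface A W f"
  shows "smooth_on_surface A W (\<lambda>x. inverse (f x))"
  using assms(3) unfolding smooth_on_surface_def smooth_on_def o_def
  by (intro ballI allI Ck_on_inverse open_chart_image_Int assms(1))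
     (auto simp: in_chart_image_iff assms(2))

lemma smooth_on_surface_sum:
  assumes "open W" "\<And>i. i \<in> I \<Longrightarrow> smooth_on_surface A W (f i)"
  shows "smooth_on_surface A W (\<lambda>x. \<Sum>i\<in>I. f i x)"
  using assms(2)
  by (induction I rule: infinite_finite_induct)
     (simp_all add: smooth_on_surface_const smooth_on_surface_add assms(1))

lemma smooth_on_surface_holomorphic:
  assumes "open W" "holomorphic_on_surface A W f"
  shows "smooth_on_surface A W f"
  using assms(2) unfolding smooth_on_surface_def smooth_on_def holomorphic_on_surface_def
  by (intro ballI allI Ck_on_holomorphic open_chart_image_Int assms(1)) blast+

lemma smooth_on_surface_cmod_power2:
  assumes "open W" "smooth_on_surface A W f"
  shows "smooth_on_surface A W (\<lambda>x. (cmod (f x))\<^sup>2)"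
  unfolding cmod_power2 unfolding power2_eq_square
  by (intro smooth_on_surface_add smooth_on_surface_bilinear[OF bounded_bilinear_mult]
      smooth_on_surface_bounded_linear[OF bounded_linear_Re]
      smooth_on_surface_bounded_linear[OF bounded_linear_Im] assms)

lemma smooth_on_surface_flat_exp:
  assumes "open W" "smooth_on_surface A W f"
  shows "smooth_on_surface A W (\<lambda>x. flat_exp m (f x))"
  using assms(2) unfolding smooth_on_surface_def smooth_on_def o_def
  by (intro ballI allI Ck_on_flat_exp open_chart_image_Int assms(1)) blast+

lemma smooth_on_surface_imp_continuous_on:
  assumes "open W" "smooth_on_surface A W f"
  shows "continuous_on W f"
proof (rule continuous_on_local)
  fix x assume x: "x \<in> W"
  obtain c where c: "c \<in> A" "x \<in> fst c" by (rule chart_at)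
  have "Ck_on 0 (f \<circ> chart_inv c) (snd c ` (fst c \<inter> W))"
    using assms(2) c(1) unfolding smooth_on_surface_def smooth_on_def by blast
  then have "continuous_on (fst c \<inter> W) f"
    using continuous_on_chartI[OF c(1)] by simp
  then show "\<exists>V. open V \<and> x \<in> V \<and> continuous_on V f"
    using open_Int[OF open_chart_dom[OF c(1)] assms(1)] x c(2) by blast
qed

text \<open>Read in another chart, \<open>snd c\<close> is a transition function, hence
  holomorphic.\<close>

lemma smooth_on_surface_chart:
  assumes "c \<in> A"
  shows "smooth_on_surface A (fst c) (snd c)"
  using transition[OF assms]
  by (intro smooth_on_surface_holomorphic open_chart_dom assms) (simp add: holomorphic_on_surface_def)

section \<open>Bump functions, partitions of unity and density of smooth functions\<close>

lemma bump_function: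
  assumes "open W" "x \<in> W"
  obtains b :: "'a \<Rightarrow> real" and c K where "smooth_on_surface A UNIV b" "\<And>y. b y \<ge> 0" "b x > 0"
    "c \<in> A" "compact K" "K \<subseteq> fst c \<inter> W" "\<And>y. y \<notin> K \<Longrightarrow> b y = 0"
proof -
  obtain c where c: "c \<in> A" "x \<in> fst c" by (rule chart_at)
  let ?a = "snd c x"
  have "?a \<in> snd c ` (fst c \<inter> W)" using assms(2) c(2) by auto
  then obtain r where r: "r > 0" "cball ?a r \<subseteq> snd c ` (fst c \<inter> W)"
    using open_contains_cball[THEN iffD1, OF open_chart_image_Int[OF c(1) assms(1)]] by meson
  have rdom: "cball ?a r \<subseteq> snd c ` fst c" using r(2) by auto
  define K where "K = chart_inv c ` cball ?a r"
  \<comment> \<open>The argument r^2 - |z - a|^2 is positive exactly inside the disc, so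
    \<open>flat_exp\<close> passes smoothly to zero at its boundary. Differences are written as sums
    with a negated term to match \<open>smooth_on_surface_add\<close>.\<close>
  define b where "b = (\<lambda>y. if y \<in> fst c then flat_exp 0 (r\<^sup>2 + - (cmod (snd c y + - ?a))\<^sup>2) else 0)"
  have K: "compact K" unfolding K_def
    by (intro compact_continuous_image continuous_on_subset[OF continuous_on_chart_inv[OF c(1)] rdom]) simp
  have KW: "K \<subseteq> fst c \<inter> W" unfolding K_def
    using r(2) in_chart_image_iff[OF c(1), of _ W] chart_inv_in_dom[OF c(1)] by fast
  have b0: "b y = 0" if "y \<notin> K" for y
  proof (cases "y \<in> fst c")
    case True
    then have "snd c y \<notin> cball ?a r" using that chart_inv_chart[OF c(1) True] unfolding K_def by force
    then have "r < cmod (snd c y - ?a)" by (simp add: dist_norm norm_minus_commute)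
    then have "r\<^sup>2 < (cmod (snd c y - ?a))\<^sup>2" using r(1) by (simp add: power_strict_mono)
    then show ?thesis by (simp add: b_def flat_exp_def)
  qed (simp add: b_def)
  have "smooth_on_surface A UNIV b"
  proof (rule smooth_on_surface_local)
    fix y
    \<comment> \<open>\<open>K\<close> is compact and hence closed, so the chart domain and the
      complement of \<open>K\<close> form an open cover; \<open>b\<close> is smooth on each of the
      two.\<close>
    have 1: "smooth_on_surface A (fst c) b"
      by (rule smooth_on_surface_cong[where g = "\<lambda>y. flat_exp 0 (r\<^sup>2 + - (cmod (snd c y + - ?a))\<^sup>2)"])
         (simp_all add: b_def open_chart_dom c smooth_on_surface_flat_exp smooth_on_surface_add smooth_on_surface_const
           smooth_on_surface_bounded_linear[OF bounded_linear_minus[OF bounded_linear_ident]]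
           smooth_on_surface_cmod_power2 smooth_on_surface_chart del: add_uminus_conv_diff)
    have 2: "smooth_on_surface A (- K) b"
      by (rule smooth_on_surface_cong[where g = "\<lambda>y. 0"])
         (simp_all add: K compact_imp_closed open_Compl smooth_on_surface_const b0)
    show "\<exists>V. open V \<and> y \<in> V \<and> smooth_on_surface A V b"
    proof (cases "y \<in> fst c")
      case True
      with 1 open_chart_dom[OF c(1)] show ?thesis by blast
    next
      case False
      with KW have "y \<in> - K" by auto
      with 2 open_Compl[OF compact_imp_closed[OF K]] show ?thesis by blast
    qed
  qed
  moreover have "b x > 0" using r(1) c(2) by (simp add: b_def flat_exp_def)
  moreover have "b y \<ge> 0" for y by (simp add: b_def flat_exp_nonneg)
  ultimately show thesis using that c(1) K KW b0 by blast
qed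

text \<open>By compactness finitely many bump functions have an everywhere positive sum
  \<open>B\<close>, and dividing by \<open>B\<close> does not enlarge supports. That each support
  lies in one chart is what localises Green's formula.\<close>

lemma partition_of_unity:
  obtains I :: "'a set" and p :: "'a \<Rightarrow> 'a \<Rightarrow> real" where "finite I"
    "\<And>i. i \<in> I \<Longrightarrow> smooth_on_surface A UNIV (p i)"
    "\<And>i. i \<in> I \<Longrightarrow> \<exists>c\<in>A. \<exists>K. compact K \<and> K \<subseteq> fst c \<and> (\<forall>y. y \<notin> K \<longrightarrow> p i y = 0)"
    "\<And>y. (\<Sum>i\<in>I. p i y) = 1"
proof -
  have ex: "\<forall>x. \<exists>b::'a \<Rightarrow> real. smooth_on_surface A UNIV b \<and> (\<forall>y. b y \<ge> 0) \<and> b x > 0 \<and>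
    (\<exists>c\<in>A. \<exists>K. compact K \<and> K \<subseteq> fst c \<and> (\<forall>y. y \<notin> K \<longrightarrow> b y = 0))"
  proof
    fix x :: 'a
    obtain b :: "'a \<Rightarrow> real" and c K where b: "smooth_on_surface A UNIV b" "\<And>y. b y \<ge> 0" "b x > 0"
      "c \<in> A" "compact K" "K \<subseteq> fst c \<inter> UNIV" "\<And>y. y \<notin> K \<Longrightarrow> b y = 0"
      by (rule bump_function[OF open_UNIV UNIV_I]) blast
    show "\<exists>b::'a \<Rightarrow> real. smooth_on_surface A UNIV b \<and> (\<forall>y. b y \<ge> 0) \<and> b x > 0 \<and>
      (\<exists>c\<in>A. \<exists>K. compact K \<and> K \<subseteq> fst c \<and> (\<forall>y. y \<notin> K \<longrightarrow> b y = 0))"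
      by (rule exI[of _ b]) (use b in auto)
  qed
  obtain b :: "'a \<Rightarrow> 'a \<Rightarrow> real" where b: "\<And>x. smooth_on_surface A UNIV (b x)"
    "\<And>x y. b x y \<ge> 0" "\<And>x. b x x > 0"
    "\<And>x. \<exists>c\<in>A. \<exists>K. compact K \<and> K \<subseteq> fst c \<and> (\<forall>y. y \<notin> K \<longrightarrow> b x y = 0)"
  proof -
    from choice[OF ex] obtain b :: "'a \<Rightarrow> 'a \<Rightarrow> real" where
      "\<forall>x. smooth_on_surface A UNIV (b x) \<and> (\<forall>y. b x y \<ge> 0) \<and> b x x > 0 \<and>
        (\<exists>c\<in>A. \<exists>K. compact K \<and> K \<subseteq> fst c \<and> (\<forall>y. y \<notin> K \<longrightarrow> b x y = 0))" ..
    then show thesis by (intro that[of b]) simp_all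
  qed
  have op: "open {y. b x y > 0}" for x
    using open_Collect_less[OF continuous_on_const smooth_on_surface_imp_continuous_on[OF open_UNIV b(1)]] by simp
  have cov: "UNIV \<subseteq> (\<Union>x\<in>UNIV. {y. b x y > 0})" using b(3) by auto
  obtain I where I: "finite I" "UNIV \<subseteq> (\<Union>x\<in>I. {y. b x y > 0})"
    using compactE_image[OF compact_UNIV, of UNIV "\<lambda>x. {y. b x y > 0}"] op cov by (metis (no_types, lifting))
  define B where "B = (\<lambda>y. \<Sum>x\<in>I. b x y)"
  have B: "B y > 0" for y
  proof -
    obtain x where x: "x \<in> I" "b x y > 0" using I(2) by blast
    show ?thesis unfolding B_def by (rule sum_pos2[where f = "\<lambda>x. b x y", OF I(1) x]) (simp add: b(2))
  qed
  show thesis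
  proof (rule that[of I "\<lambda>i y. b i y * inverse (B y)"])
    have "smooth_on_surface A UNIV (\<lambda>y. inverse (B y))"
      unfolding B_def
      by (intro smooth_on_surface_inverse smooth_on_surface_sum b) (use B in \<open>simp_all add: B_def less_imp_neq[symmetric]\<close>)
    then show "smooth_on_surface A UNIV (\<lambda>y. b i y * inverse (B y))" for i
      by (intro smooth_on_surface_bilinear[OF bounded_bilinear_mult] b) auto
    show "\<exists>c\<in>A. \<exists>K. compact K \<and> K \<subseteq> fst c \<and> (\<forall>y. y \<notin> K \<longrightarrow> b i y * inverse (B y) = 0)" for i
      using b(4)[of i] by (metis mult_zero_left)
    show "(\<Sum>i\<in>I. b i y * inverse (B y)) = 1" for y
      using B[of y] by (simp add: sum_distrib_right[symmetric] B_def)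
  qed (rule I(1))
qed

text \<open>A bump function at \<open>x\<close> supported away from \<open>y\<close> separates the
  two points. The real approximation theorem is applied to the real and the imaginary part, each
  with error e/2.\<close>

lemma A00_dense:
  fixes f :: "'a \<Rightarrow> complex"
  assumes "continuous_on UNIV f" "e > 0"
  obtains g where "g \<in> A00 A" "\<And>x. cmod (f x - g x) < e"
proof -
  interpret function_ring_on "{g :: 'a \<Rightarrow> real. smooth_on_surface A UNIV g}" UNIV
  proof
    show "compact (UNIV :: 'a set)" by (rule compact_UNIV)
  next
    fix x y :: 'a assume "x \<noteq> y"
    then have "x \<in> - {y}" by simp
    obtain b :: "'a \<Rightarrow> real" and c K where b: "smooth_on_surface A UNIV b" "\<And>y. b y \<ge> 0" "b x > 0"
      "c \<in> A" "compact K" "K \<subseteq> fst c \<inter> - {y}" "\<And>y. y \<notin> K \<Longrightarrow> b y = 0"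
      by (rule bump_function[OF open_Compl[OF closed_singleton] \<open>x \<in> - {y}\<close>]) blast
    have "b y = 0" using b(6) by (intro b(7)) auto
    with b(1,3) show "\<exists>f\<in>{g :: 'a \<Rightarrow> real. smooth_on_surface A UNIV g}. f x \<noteq> f y" by auto
  qed (auto intro: smooth_on_surface_imp_continuous_on smooth_on_surface_add smooth_on_surface_const
        smooth_on_surface_bilinear[OF bounded_bilinear_mult])
  have "continuous_on UNIV (\<lambda>x. Re (f x))" "continuous_on UNIV (\<lambda>x. Im (f x))"
    using assms(1) by (auto intro: continuous_intros)
  then obtain g1 g2 where g: "smooth_on_surface A UNIV g1" "\<And>x. \<bar>Re (f x) - g1 x\<bar> < e / 2"
    "smooth_on_surface A UNIV g2" "\<And>x. \<bar>Im (f x) - g2 x\<bar> < e / 2"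
    using Stone_Weierstrass_basic[of "\<lambda>x. Re (f x)" "e / 2"]
      Stone_Weierstrass_basic[of "\<lambda>x. Im (f x)" "e / 2"] assms(2) by auto
  let ?g = "\<lambda>x. complex_of_real (g1 x) + \<i> * complex_of_real (g2 x)"
  have "smooth_on_surface A UNIV ?g"
    by (intro smooth_on_surface_add smooth_on_surface_bounded_linear[OF bounded_linear_of_real]
        smooth_on_surface_bilinear[OF bounded_bilinear_mult] smooth_on_surface_const g open_UNIV)
  moreover have "cmod (f x - ?g x) < e" for x
    using cmod_le[of "f x - ?g x"] g(2,4)[of x] by simp
  ultimately show thesis using that by (simp add: A00_def)
qed

end

section \<open>The volume form\<close>

text \<open>Each new set is diminished by the union of those already treated.\<close>

lemma finite_disjoint_refinement:
  assumes "finite F" "\<And>c. c \<in> F \<Longrightarrow> U c \<in> sets M"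
  shows "\<exists>D. (\<forall>c\<in>F. D c \<in> sets M \<and> D c \<subseteq> U c) \<and> disjoint_family_on D F
    \<and> (\<Union>c\<in>F. D c) = (\<Union>c\<in>F. U c)"
  using assms
proof (induction F rule: finite_induct)
  case empty
  then show ?case by (simp add: disjoint_family_on_def)
next
  case (insert c F)
  then obtain D where D: "\<forall>c\<in>F. D c \<in> sets M \<and> D c \<subseteq> U c" "disjoint_family_on D F"
    "(\<Union>c\<in>F. D c) = (\<Union>c\<in>F. U c)" by auto
  define D' where "D' = D(c := U c - (\<Union>c\<in>F. U c))"
  have eq: "D' b = D b" if "b \<in> F" for b using that insert.hyps(2) by (auto simp: D'_def)
  have c: "D' c = U c - (\<Union>c\<in>F. U c)" by (simp add: D'_def)
  have "(\<Union>c\<in>F. U c) \<in> sets M" using insert.prems insert.hyps(1) by (intro sets.finite_UN) auto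
  then have "D' c \<in> sets M" unfolding c using insert.prems by (intro sets.Diff) auto
  moreover have "disjoint_family_on D' (insert c F)"
  proof -
    have "D' c \<inter> D b = {}" if "b \<in> F" for b using D(1) that unfolding c by blast
    then have "D' c \<inter> (\<Union>b\<in>F. D' b) = {}" using eq by auto
    moreover have "disjoint_family_on D' F"
      using D(2) eq by (simp add: disjoint_family_on_def)
    ultimately show ?thesis using insert.hyps(2) by (simp add: disjoint_family_on_insert)
  qed
  moreover have "(\<Union>c\<in>insert c F. D' c) = (\<Union>c\<in>insert c F. U c)"
  proof -
    have "(\<Union>b\<in>F. D' b) = (\<Union>c\<in>F. U c)" using D(3) eq by simp
    then show ?thesis using c by auto
  qed
  moreover have "\<forall>b\<in>insert c F. D' b \<subseteq> U b" using D(1) eq c by auto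
  moreover have "\<forall>b\<in>F. D' b \<in> sets M" using D(1) eq by simp
  ultimately show ?case by (intro exI[of _ D']) simp
qed

context riemann_surface
begin

lemma finite_measurable_partition:
  obtains F D where "finite F" "F \<subseteq> A" "\<And>c. c \<in> F \<Longrightarrow> D c \<in> sets borel" "\<And>c. c \<in> F \<Longrightarrow> D c \<subseteq> fst c"
    "disjoint_family_on D F" "(\<Union>c\<in>F. D c) = (UNIV :: 'a set)"
proof -
  have cov: "UNIV \<subseteq> (\<Union>c\<in>A. fst c)" using chart_at by blast
  obtain F where F: "F \<subseteq> A" "finite F" "UNIV \<subseteq> (\<Union>c\<in>F. fst c)"
    by (rule compactE_image[OF compact_UNIV _ cov]) (auto intro: open_chart_dom)
  have "fst c \<in> sets borel" if "c \<in> F" for c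
    using subsetD[OF F(1) that] by (intro borel_open open_chart_dom)
  then have "\<exists>D. (\<forall>c\<in>F. D c \<in> sets borel \<and> D c \<subseteq> fst c) \<and> disjoint_family_on D F
    \<and> (\<Union>c\<in>F. D c) = (\<Union>c\<in>F. fst c)"
    by (rule finite_disjoint_refinement[OF F(2)])
  then obtain D where D: "\<forall>c\<in>F. D c \<in> sets borel \<and> D c \<subseteq> fst c" "disjoint_family_on D F"
    "(\<Union>c\<in>F. D c) = (\<Union>c\<in>F. fst c)" by (elim exE conjE)
  show thesis
    by (rule that[OF F(2,1) _ _ D(2)]) (use D(1,3) F(3) in auto)
qed

text \<open>The property whose unique solution \<open>volume_form\<close> selects.\<close>

definition is_volume :: "('a chart, 'a) metric \<Rightarrow> 'a measure \<Rightarrow> bool" where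
  "is_volume h \<mu> \<longleftrightarrow> sets \<mu> = sets borel \<and>
     (\<forall>c\<in>A. \<forall>B\<in>sets borel. B \<subseteq> fst c \<longrightarrow>
        emeasure \<mu> B
          = (\<integral>\<^sup>+ z. ennreal (h c (chart_inv c z) / pi) * indicator (snd c ` B) z \<partial>lborel))"

text \<open>The values are prescribed only on Borel sets inside one chart; a finite Borel partition
  into such pieces determines all others by additivity.\<close>

lemma is_volume_unique:
  assumes "is_volume h \<mu>" "is_volume h \<nu>"
  shows "\<mu> = \<nu>"
proof (rule measure_eqI)
  show "sets \<mu> = sets \<nu>" using assms by (simp add: is_volume_def)
  fix B assume "B \<in> sets \<mu>"
  then have B: "B \<in> sets borel" using assms(1) by (simp add: is_volume_def)
  obtain F D where F: "finite F" "F \<subseteq> A" "\<And>c. c \<in> F \<Longrightarrow> D c \<in> sets borel" "\<And>c. c \<in> F \<Longrightarrow> D c \<subseteq> fst c"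
    "disjoint_family_on D F" "(\<Union>c\<in>F. D c) = (UNIV :: 'a set)" by (rule finite_measurable_partition) blast
  have dis: "disjoint_family_on (\<lambda>c. B \<inter> D c) F"
    using F(5) unfolding disjoint_family_on_def by blast
  have un: "(\<Union>c\<in>F. B \<inter> D c) = B" using F(6) by blast
  have BD: "(\<lambda>c. B \<inter> D c) ` F \<subseteq> sets borel"
    using sets.Int[OF B F(3)] by (rule image_subsetI)
  have sum: "emeasure \<rho> B = (\<Sum>c\<in>F. emeasure \<rho> (B \<inter> D c))" if "sets \<rho> = sets borel" for \<rho>
    using sum_emeasure[OF _ dis F(1), of \<rho>] BD by (simp only: that un)
  have "emeasure \<mu> (B \<inter> D c) = emeasure \<nu> (B \<inter> D c)" if c: "c \<in> F" for c
  proof -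
    have "c \<in> A" "B \<inter> D c \<in> sets borel" "B \<inter> D c \<subseteq> fst c" using subsetD[OF F(2) c] F(3)[OF c] F(4)[OF c] B by auto
    with assms show ?thesis unfolding is_volume_def by simp
  qed
  then show "emeasure \<mu> B = emeasure \<nu> B"
    using assms by (simp add: is_volume_def sum)
qed

text \<open>The inverse of a chart as a total Borel function.\<close>

definition param :: "'a chart \<Rightarrow> complex \<Rightarrow> 'a" where
  "param c z = (if z \<in> snd c ` fst c then chart_inv c z else undefined)"

lemma param_measurable: "c \<in> A \<Longrightarrow> param c \<in> borel \<rightarrow>\<^sub>M borel"
  unfolding param_def[abs_def]
  by (intro borel_measurable_continuous_on_if borel_open open_chart_image continuous_on_chart_inv
      continuous_on_const)

lemma chart_image_measurable:
  assumes "c \<in> A" "B \<in> sets borel" "B \<subseteq> fst c"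
  shows "snd c ` B \<in> sets borel"
proof -
  have "snd c ` B = snd c ` (fst c \<inter> B)" using assms(3) by (simp add: Int_absorb1)
  also have "\<dots> = param c -` B \<inter> snd c ` fst c"
    unfolding chart_image_eq[OF assms(1)] by (auto simp: param_def)
  also have "\<dots> \<in> sets borel"
    using measurable_sets[OF param_measurable[OF assms(1)] assms(2)] open_chart_image[OF assms(1)]
    by auto
  finally show ?thesis .
qed

end

locale metrized_surface = riemann_surface A for A :: "'a::t2_space chart set" +
  fixes h :: "('a chart, 'a) metric"
  assumes continuous_metric: "continuous_metric (tangent_bundle A) h"
begin

lemma h_pos: "c \<in> A \<Longrightarrow> x \<in> fst c \<Longrightarrow> h c x > 0"
  using continuous_metric unfolding continuous_metric_def hermitian_metric_def tangent_bundle_simps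
  by blast

lemma h_transition:
  "c \<in> A \<Longrightarrow> d \<in> A \<Longrightarrow> x \<in> fst c \<inter> fst d \<Longrightarrow>
    h d x = (cmod (deriv (snd c \<circ> chart_inv d) (snd d x)))\<^sup>2 * h c x"
  using continuous_metric unfolding continuous_metric_def hermitian_metric_def tangent_bundle_simps
  by blast

lemma h_continuous: "c \<in> A \<Longrightarrow> continuous_on (fst c) (h c)"
  using continuous_metric unfolding continuous_metric_def tangent_bundle_simps by blast

text \<open>The cut-off makes the density a Borel function on the plane, since
  \<open>chart_inv c\<close> is uncontrolled off the chart image.\<close>

definition chart_density :: "'a chart \<Rightarrow> complex \<Rightarrow> real" where
  "chart_density c z = indicator (snd c ` fst c) z *\<^sub>R (h c (chart_inv c z) / pi)"

lemma chart_density_nonneg: "c \<in> A \<Longrightarrow> chart_density c z \<ge> 0"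
  by (simp add: chart_density_def indicator_def h_pos chart_inv_in_dom less_imp_le)

lemma chart_density_eq: "z \<in> snd c ` fst c \<Longrightarrow> chart_density c z = h c (chart_inv c z) / pi"
  by (simp add: chart_density_def)

lemma chart_density_continuous: "c \<in> A \<Longrightarrow> continuous_on (snd c ` fst c) (\<lambda>z. h c (chart_inv c z) / pi)"
  using continuous_on_chartD[where W = UNIV, of c "h c"] h_continuous[of c]
  by (auto intro!: continuous_intros simp: o_def)

lemma chart_density_measurable: "c \<in> A \<Longrightarrow> chart_density c \<in> borel_measurable borel"
  unfolding chart_density_def[abs_def]
  by (intro borel_measurable_continuous_on_indicator chart_density_continuous borel_open open_chart_image)

lemma chart_density_integral:
  assumes "B \<subseteq> fst c"
  shows "(\<integral>\<^sup>+ z. ennreal (h c (chart_inv c z) / pi) * indicator (snd c ` B) z \<partial>lborel)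
    = (\<integral>\<^sup>+ z. ennreal (chart_density c z) * indicator (snd c ` B) z \<partial>lborel)"
  using assms by (intro nn_integral_cong) (auto simp: indicator_def chart_density_def)

text \<open>The Jacobian |g'|^2 of the transition map is exactly the factor between
  \<open>h d\<close> and \<open>h c\<close>.\<close>

lemma chart_density_transition:
  assumes c: "c \<in> A" and d: "d \<in> A" and B: "B \<in> sets borel" "B \<subseteq> fst c" "B \<subseteq> fst d"
  shows "(\<integral>\<^sup>+ z. ennreal (chart_density c z) * indicator (snd c ` B) z \<partial>lborel)
    = (\<integral>\<^sup>+ z. ennreal (chart_density d z) * indicator (snd d ` B) z \<partial>lborel)"
proof -
  define g where "g = snd c \<circ> chart_inv d"
  have im: "g ` (snd d ` B) = snd c ` B"
    using B(3) by (auto simp: g_def image_image chart_inv_chart[OF d] intro!: image_cong)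
  have inj: "inj_on g (snd d ` (fst d \<inter> fst c))"
    by (rule inj_onI) (auto simp: g_def chart_inv_chart[OF d] dest: inj_onD[OF inj_on_chart[OF c]])
  have "(\<integral>\<^sup>+ z. ennreal (chart_density c z) * indicator (snd c ` B) z \<partial>lborel)
    = (\<integral>\<^sup>+ z. ennreal (chart_density c (g z)) * ennreal ((cmod (deriv g z))\<^sup>2) * indicator (snd d ` B) z \<partial>lborel)"
    unfolding im[symmetric]
  proof (rule nn_integral_holomorphic_image[OF _ _ inj])
    show "open (snd d ` (fst d \<inter> fst c))" by (intro open_chart_image_Int d open_chart_dom c)
    show "g holomorphic_on (snd d ` (fst d \<inter> fst c))" unfolding g_def by (rule transition[OF c d])
    show "snd d ` B \<in> sets borel" by (rule chart_image_measurable[OF d B(1,3)])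
    show "snd d ` B \<subseteq> snd d ` (fst d \<inter> fst c)" using B by auto
    show "(\<lambda>z. ennreal (chart_density c z)) \<in> borel_measurable borel"
      using chart_density_measurable[OF c] by simp
  qed
  also have "\<dots> = (\<integral>\<^sup>+ z. ennreal (chart_density d z) * indicator (snd d ` B) z \<partial>lborel)"
  proof (rule nn_integral_cong)
    fix z
    show "ennreal (chart_density c (g z)) * ennreal ((cmod (deriv g z))\<^sup>2) * indicator (snd d ` B) z
      = ennreal (chart_density d z) * indicator (snd d ` B) z"
    proof (cases "z \<in> snd d ` B")
      case True
      then obtain x where x: "x \<in> B" "z = snd d x" by auto
      have xc: "x \<in> fst c" and xd: "x \<in> fst d" using x B by auto
      have "g z = snd c x" using x xd by (simp add: g_def chart_inv_chart[OF d])
      then have "chart_density c (g z) = h c x / pi" using xc by (simp add: chart_density_eq chart_inv_chart[OF c])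
      moreover have "chart_density d z = h d x / pi" using x(2) xd by (simp add: chart_density_eq chart_inv_chart[OF d])
      moreover have "h d x = (cmod (deriv g z))\<^sup>2 * h c x"
        using h_transition[OF c d] xc xd x(2) by (simp add: g_def)
      moreover have "h c x \<ge> 0" using h_pos[OF c xc] by simp
      ultimately have "ennreal (chart_density c (g z)) * ennreal ((cmod (deriv g z))\<^sup>2) = ennreal (chart_density d z)"
        by (simp add: ennreal_mult[symmetric] mult.commute)
      then show ?thesis by simp
    qed simp
  qed
  finally show ?thesis .
qed

definition chart_measure :: "'a chart \<Rightarrow> 'a measure" where
  "chart_measure c = distr (density lborel (\<lambda>z. ennreal (chart_density c z))) borel (param c)"

lemma sets_chart_measure [simp]: "sets (chart_measure c) = sets borel"
  by (simp add: chart_measure_def)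

lemma emeasure_chart_measure:
  assumes c: "c \<in> A" and B: "B \<in> sets borel"
  shows "emeasure (chart_measure c) B
    = (\<integral>\<^sup>+ z. ennreal (chart_density c z) * indicator (snd c ` (fst c \<inter> B)) z \<partial>lborel)"
proof -
  note [measurable] = param_measurable[OF c] chart_density_measurable[OF c] B
  have "emeasure (chart_measure c) B
      = emeasure (density lborel (\<lambda>z. ennreal (chart_density c z))) (param c -` B)"
    unfolding chart_measure_def by (subst emeasure_distr) auto
  also have "\<dots> = (\<integral>\<^sup>+ z. ennreal (chart_density c z) * indicator (param c -` B) z \<partial>lborel)"
    using measurable_sets[OF param_measurable[OF c] B] by (subst emeasure_density) auto
  also have "\<dots> = (\<integral>\<^sup>+ z. ennreal (chart_density c z) * indicator (snd c ` (fst c \<inter> B)) z \<partial>lborel)"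
    unfolding chart_image_eq[OF c]
    by (intro nn_integral_cong) (auto simp: chart_density_def param_def indicator_def)
  finally show ?thesis .
qed

text \<open>Each piece of a finite Borel partition subordinate to the atlas is measured in one chart; the
  change of variables formula shows that the choice of this chart does not matter.\<close>

lemma volume_exists: "\<exists>\<mu>. is_volume h \<mu>"
proof -
  obtain F D where F: "finite F" "F \<subseteq> A" "\<And>c. c \<in> F \<Longrightarrow> D c \<in> sets borel" "\<And>c. c \<in> F \<Longrightarrow> D c \<subseteq> fst c"
    "disjoint_family_on D F" "(\<Union>c\<in>F. D c) = (UNIV :: 'a set)" by (rule finite_measurable_partition) blast
  define m where "m = (\<lambda>B. \<Sum>c\<in>F. emeasure (chart_measure c) (B \<inter> D c))"
  \<comment> \<open>\<open>m\<close> is so far only a set function; \<open>measure_of\<close> yields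
    a measure with these values once countable additivity is shown.\<close>
  define \<mu> where "\<mu> = measure_of UNIV (sets borel) m"
  have sets: "sets \<mu> = sets borel"
    unfolding \<mu>_def using sets.sigma_sets_eq[of "borel :: 'a measure"] by (simp add: sets_measure_of_conv)
  have emeasure: "emeasure \<mu> B = m B" if B: "B \<in> sets borel" for B
  proof (rule emeasure_measure_of_sigma[of UNIV "sets borel" m B, folded \<mu>_def])
    show "sigma_algebra UNIV (sets (borel :: 'a measure))"
      using sets.sigma_algebra_axioms[of "borel :: 'a measure"] by simp
    show "positive (sets borel) m" by (simp add: positive_def m_def)
    show "B \<in> sets borel" by (rule B)
    show "countably_additive (sets borel) m"
    proof (rule countably_additiveI)
      fix E :: "nat \<Rightarrow> 'a set"
      assume E: "range E \<subseteq> sets borel" "disjoint_family E"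
      have "(\<Sum>i. emeasure (chart_measure c) (E i \<inter> D c)) = emeasure (chart_measure c) (\<Union>(range E) \<inter> D c)"
        if "c \<in> F" for c
      proof -
        have "(\<Sum>i. emeasure (chart_measure c) (E i \<inter> D c)) = emeasure (chart_measure c) (\<Union>i. E i \<inter> D c)"
          using E F(3)[OF that] by (intro suminf_emeasure) (auto simp: disjoint_family_on_def)
        then show ?thesis by simp
      qed
      then show "(\<Sum>i. m (E i)) = m (\<Union> (range E))"
        unfolding m_def by (subst suminf_sum) simp_all
    qed
  qed
  have "emeasure \<mu> B = (\<integral>\<^sup>+ z. ennreal (h d (chart_inv d z) / pi) * indicator (snd d ` B) z \<partial>lborel)"
    if d: "d \<in> A" and B: "B \<in> sets borel" "B \<subseteq> fst d" for d B
  proof -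
    have dis: "disjoint_family_on (\<lambda>c. B \<inter> D c) F"
      using F(5) unfolding disjoint_family_on_def by blast
    have un: "(\<Union>c\<in>F. B \<inter> D c) = B" using F(6) by blast
    have BD: "(\<lambda>c. B \<inter> D c) ` F \<subseteq> sets borel"
      using sets.Int[OF B(1) F(3)] by (rule image_subsetI)
    have "emeasure (chart_measure c) (B \<inter> D c) = emeasure (chart_measure d) (B \<inter> D c)" if "c \<in> F" for c
    proof -
      have cA: "c \<in> A" and BD: "B \<inter> D c \<in> sets borel" "B \<inter> D c \<subseteq> fst c" "B \<inter> D c \<subseteq> fst d"
        using subsetD[OF F(2) that] F(3)[OF that] F(4)[OF that] B by auto
      then show ?thesis
        using chart_density_transition[OF cA d BD]
        by (simp add: emeasure_chart_measure d Int_absorb1)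
    qed
    then have "m B = (\<Sum>c\<in>F. emeasure (chart_measure d) (B \<inter> D c))" by (simp add: m_def)
    also have "\<dots> = emeasure (chart_measure d) B"
      using sum_emeasure[OF _ dis F(1), of "chart_measure d"] BD by (simp only: un sets_chart_measure)
    also have "\<dots> = (\<integral>\<^sup>+ z. ennreal (h d (chart_inv d z) / pi) * indicator (snd d ` B) z \<partial>lborel)"
      using B(2) by (simp add: emeasure_chart_measure[OF d B(1)] chart_density_integral Int_absorb1)
    finally show ?thesis using emeasure[OF B(1)] by simp
  qed
  then have "is_volume h \<mu>" using sets by (simp add: is_volume_def)
  then show ?thesis ..
qed

abbreviation vol :: "'a measure" where "vol \<equiv> volume_form A h"

section \<open>Integration against the volume form\<close>

lemma is_volume_vol: "is_volume h vol"
proof -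
  obtain \<mu> where \<mu>: "is_volume h \<mu>" using volume_exists ..
  have "volume_form A h = (THE \<mu>. is_volume h \<mu>)"
    unfolding volume_form_def is_volume_def ..
  also have "\<dots> = \<mu>" by (rule the_equality) (auto intro: \<mu> is_volume_unique[OF _ \<mu>])
  finally show ?thesis using \<mu> by simp
qed

lemma sets_vol [simp, measurable_cong]: "sets vol = sets borel"
  using is_volume_vol by (simp add: is_volume_def)

lemma space_vol [simp]: "space vol = UNIV"
  using sets_eq_imp_space_eq[OF sets_vol] by simp

lemma emeasure_vol:
  assumes "c \<in> A" "B \<in> sets borel" "B \<subseteq> fst c"
  shows "emeasure vol B = (\<integral>\<^sup>+ z. ennreal (chart_density c z) * indicator (snd c ` B) z \<partial>lborel)"
  using is_volume_vol assms chart_density_integral[OF assms(3)] by (simp add: is_volume_def)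

text \<open>As an identity of measures it transfers both nonnegative and complex integrals to the
  plane.\<close>

lemma restrict_vol_chart:
  assumes c: "c \<in> A"
  shows "density vol (indicator (fst c)) = chart_measure c"
proof (rule measure_eqI)
  fix B assume "B \<in> sets (density vol (indicator (fst c)))"
  then have B: "B \<in> sets borel" by simp
  have U: "fst c \<in> sets borel" using open_chart_dom[OF c] by simp
  have "emeasure (density vol (indicator (fst c))) B = (\<integral>\<^sup>+ x. indicator (fst c \<inter> B) x \<partial>vol)"
  proof -
    have "emeasure (density vol (indicator (fst c))) B
        = (\<integral>\<^sup>+ x. indicator (fst c) x * indicator B x \<partial>vol)"
      using B U by (intro emeasure_density) auto
    then show ?thesis by (simp only: indicator_inter_arith)
  qed
  also have "\<dots> = emeasure vol (fst c \<inter> B)" using B U by (subst nn_integral_indicator) auto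
  also have "\<dots> = emeasure (chart_measure c) B"
    using B U by (simp add: emeasure_chart_measure[OF c] emeasure_vol[OF c])
  finally show "emeasure (density vol (indicator (fst c))) B = emeasure (chart_measure c) B" .
qed simp

lemma nn_integral_vol_chart:
  assumes c: "c \<in> A" and f: "f \<in> borel_measurable borel" and f0: "\<And>x. x \<notin> fst c \<Longrightarrow> f x = 0"
  shows "(\<integral>\<^sup>+ x. f x \<partial>vol) = (\<integral>\<^sup>+ z. ennreal (chart_density c z) * f (param c z) \<partial>lborel)"
proof -
  note [measurable] = param_measurable[OF c] chart_density_measurable[OF c] f
  have U: "fst c \<in> sets borel" using open_chart_dom[OF c] by simp
  have "(\<integral>\<^sup>+ x. f x \<partial>vol) = (\<integral>\<^sup>+ x. indicator (fst c) x * f x \<partial>vol)"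
    using f0 by (intro nn_integral_cong) (auto simp: indicator_def)
  also have "\<dots> = (\<integral>\<^sup>+ x. f x \<partial>chart_measure c)"
    unfolding restrict_vol_chart[OF c, symmetric] using U by (subst nn_integral_density) auto
  also have "\<dots> = (\<integral>\<^sup>+ z. f (param c z) \<partial>density lborel (\<lambda>z. ennreal (chart_density c z)))"
    unfolding chart_measure_def by (subst nn_integral_distr) auto
  also have "\<dots> = (\<integral>\<^sup>+ z. ennreal (chart_density c z) * f (param c z) \<partial>lborel)"
    by (subst nn_integral_density) auto
  finally show ?thesis .
qed

lemma integral_vol_chart:
  fixes f :: "'a \<Rightarrow> complex"
  assumes c: "c \<in> A" and f: "f \<in> borel_measurable borel" and f0: "\<And>x. x \<notin> fst c \<Longrightarrow> f x = 0"
  shows "(\<integral>x. f x \<partial>vol) = (\<integral>z. chart_density c z *\<^sub>R f (param c z) \<partial>lborel)"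
proof -
  note [measurable] = param_measurable[OF c] chart_density_measurable[OF c] f
  have U: "fst c \<in> sets borel" using open_chart_dom[OF c] by simp
  have "(\<integral>x. f x \<partial>vol) = (\<integral>x. indicator (fst c) x *\<^sub>R f x \<partial>vol)"
    using f0 by (intro Bochner_Integration.integral_cong) (auto simp: indicator_def)
  also have "\<dots> = (\<integral>x. f x \<partial>density vol (\<lambda>x. ennreal (indicator (fst c) x)))"
    using U by (subst integral_density) auto
  also have "density vol (\<lambda>x. ennreal (indicator (fst c) x)) = chart_measure c"
    unfolding restrict_vol_chart[OF c, symmetric] by (simp add: ennreal_indicator)
  also have "(\<integral>x. f x \<partial>chart_measure c)
      = (\<integral>z. f (param c z) \<partial>density lborel (\<lambda>z. ennreal (chart_density c z)))"
    unfolding chart_measure_def by (subst integral_distr) auto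
  also have "\<dots> = (\<integral>z. chart_density c z *\<^sub>R f (param c z) \<partial>lborel)"
    using chart_density_nonneg[OF c] by (subst integral_density) auto
  finally show ?thesis .
qed

text \<open>A closed disc inside a chart image has finite area and bounded density, so its interior
  gives a neighbourhood of finite volume; by compactness finitely many of these cover X.\<close>

lemma emeasure_vol_finite: "emeasure vol UNIV < \<infinity>"
proof -
  have ex: "\<exists>V. open V \<and> x \<in> V \<and> emeasure vol V < \<infinity>" for x :: 'a
  proof -
    obtain c where c: "c \<in> A" "x \<in> fst c" by (rule chart_at)
    obtain r where r: "r > 0" "cball (snd c x) r \<subseteq> snd c ` fst c"
      using open_contains_cball[THEN iffD1, OF open_chart_image[OF c(1)]] c(2) by blast
    define V where "V = snd c -` ball (snd c x) r \<inter> fst c"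
    have V: "open V" "x \<in> V" "V \<subseteq> fst c"
      unfolding V_def using continuous_open_preimage[OF continuous_on_chart[OF c(1)] open_chart_dom[OF c(1)] open_ball[of "snd c x" r]] c r
      by (auto simp: Int_commute)
    have "bounded ((\<lambda>z. h c (chart_inv c z) / pi) ` cball (snd c x) r)"
      by (intro compact_imp_bounded compact_continuous_image
          continuous_on_subset[OF chart_density_continuous[OF c(1)] r(2)]) simp
    then obtain M where M: "\<And>z. z \<in> cball (snd c x) r \<Longrightarrow> \<bar>h c (chart_inv c z) / pi\<bar> \<le> M"
      unfolding bounded_iff by (metis imageI real_norm_def)
    have "emeasure vol V = (\<integral>\<^sup>+ z. ennreal (chart_density c z) * indicator (snd c ` V) z \<partial>lborel)"
      using V by (intro emeasure_vol c) auto
    also have "\<dots> \<le> (\<integral>\<^sup>+ z. ennreal M * indicator (cball (snd c x) r) z \<partial>lborel)"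
    proof (rule nn_integral_mono)
      fix z
      have "chart_density c z \<le> M" "z \<in> cball (snd c x) r" if "z \<in> snd c ` V"
      proof -
        have "z \<in> snd c ` fst c" "z \<in> cball (snd c x) r" using that by (auto simp: V_def)
        then show "chart_density c z \<le> M" "z \<in> cball (snd c x) r" using abs_le_D1[OF M[of z]] by (simp_all add: chart_density_eq)
      qed
      then show "ennreal (chart_density c z) * indicator (snd c ` V) z
          \<le> ennreal M * indicator (cball (snd c x) r) z"
        by (auto simp: indicator_def intro: ennreal_leI)
    qed
    also have "\<dots> = ennreal M * emeasure lborel (cball (snd c x) r)"
      by (subst nn_integral_cmult_indicator) auto
    also have "\<dots> < \<infinity>"
      using emeasure_compact_finite[of "cball (snd c x) r"] by (simp add: ennreal_mult_less_top)
    finally show ?thesis using V by blast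
  qed
  then have "\<forall>x. \<exists>V. open V \<and> x \<in> V \<and> emeasure vol V < \<infinity>" by blast
  from choice[OF this] obtain V where V: "\<And>x. open (V x)" "\<And>x. x \<in> V x" "\<And>x. emeasure vol (V x) < \<infinity>"
    by blast
  have cov: "(UNIV :: 'a set) \<subseteq> (\<Union>x\<in>UNIV. V x)" using V(2) by blast
  obtain I where I: "finite I" "(UNIV :: 'a set) \<subseteq> (\<Union>x\<in>I. V x)"
    by (rule compactE_image[OF compact_UNIV _ cov]) (auto intro: V(1))
  have "emeasure vol UNIV \<le> emeasure vol (\<Union>x\<in>I. V x)" using I by (intro emeasure_mono) (auto intro!: borel_open V(1) open_UN)
  also have "\<dots> \<le> (\<Sum>x\<in>I. emeasure vol (V x))"
    using I V(1) by (intro emeasure_subadditive_finite) auto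
  also have "\<dots> < \<infinity>" using I(1) V(3) by (simp add: less_top[symmetric])
  finally show ?thesis .
qed

sublocale vol: finite_measure vol
  using emeasure_vol_finite by (intro finite_measureI) simp

lemma continuous_measurable_vol:
  fixes f :: "'a \<Rightarrow> 'b::topological_space"
  assumes "continuous_on UNIV f"
  shows "f \<in> borel_measurable vol"
  using borel_measurable_continuous_onI[OF assms] measurable_cong_sets[OF sets_vol refl] by blast

lemma continuous_bounded:
  fixes f :: "'a \<Rightarrow> 'b::real_normed_vector"
  assumes "continuous_on UNIV f"
  obtains M where "M > 0" "\<And>x. norm (f x) \<le> M"
proof -
  have "bounded (range f)"
    by (intro compact_imp_bounded compact_continuous_image assms compact_UNIV)
  then show thesis using that by (auto simp: bounded_pos)
qed

lemma continuous_integrable_vol: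
  fixes f :: "'a \<Rightarrow> 'b::{banach, second_countable_topology}"
  assumes "continuous_on UNIV f"
  shows "integrable vol f"
proof -
  obtain M where "M > 0" "\<And>x. norm (f x) \<le> M" using continuous_bounded[OF assms] by blast
  then show ?thesis using continuous_measurable_vol[OF assms]
    by (intro vol.integrable_const_bound[of _ M]) auto
qed

end

section \<open>The Laplacian and Green's formula\<close>

context riemann_surface
begin

lemma A00_Ck_on: "\<xi> \<in> A00 A \<Longrightarrow> c \<in> A \<Longrightarrow> Ck_on k (\<xi> \<circ> chart_inv c) (snd c ` fst c)"
  unfolding A00_def smooth_on_surface_def smooth_on_def mem_Collect_eq Int_UNIV_right by blast

lemma A00_smooth: "\<xi> \<in> A00 A \<Longrightarrow> smooth_on_surface A UNIV \<xi>"
  by (simp add: A00_def)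

lemma A00_continuous: "\<xi> \<in> A00 A \<Longrightarrow> continuous_on UNIV \<xi>"
  by (rule smooth_on_surface_imp_continuous_on[OF open_UNIV A00_smooth])

lemma A00_add: "\<xi> \<in> A00 A \<Longrightarrow> \<eta> \<in> A00 A \<Longrightarrow> (\<lambda>x. \<xi> x + \<eta> x) \<in> A00 A"
  by (simp add: A00_def smooth_on_surface_add)

lemma A00_scale: "\<xi> \<in> A00 A \<Longrightarrow> (\<lambda>x. a * \<xi> x) \<in> A00 A"
  by (simp add: A00_def smooth_on_surface_bilinear[OF bounded_bilinear_mult] smooth_on_surface_const)

definition dbar :: "'a chart \<Rightarrow> ('a \<Rightarrow> complex) \<Rightarrow> complex \<Rightarrow> complex" where
  "dbar c \<xi> = d_dzbar (\<xi> \<circ> chart_inv c)"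

lemma laplacian_dbar:
  "laplacian A h \<xi> x = (let c = index_at (tangent_bundle A) x in
     - inverse (complex_of_real (h c x)) * d_dz (dbar c \<xi>) (snd c x))"
  by (simp add: laplacian_def dbar_def)

lemma A00_differentiable:
  assumes "\<xi> \<in> A00 A" "c \<in> A" "z \<in> snd c ` fst c"
  shows "(\<xi> \<circ> chart_inv c) differentiable at z" "dbar c \<xi> differentiable at z"
proof -
  show "(\<xi> \<circ> chart_inv c) differentiable at z"
    by (rule Ck_on_SucD(1)[OF A00_Ck_on[OF assms(1,2), of "Suc 0"] assms(3)])
  have "Ck_on (Suc 0) (dbar c \<xi>) (snd c ` fst c)"
    unfolding dbar_def by (rule Ck_on_d_dz(2)[OF open_chart_image[OF assms(2)] A00_Ck_on[OF assms(1,2)]])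
  from Ck_on_SucD(1)[OF this assms(3)] show "dbar c \<xi> differentiable at z" .
qed

lemma dbar_Ck_on:
  assumes "\<xi> \<in> A00 A" "c \<in> A"
  shows "Ck_on k (dbar c \<xi>) (snd c ` fst c)"
  unfolding dbar_def by (rule Ck_on_d_dz(2)[OF open_chart_image[OF assms(2)] A00_Ck_on[OF assms]])

text \<open>\<open>dbar c \<xi>\<close> is the coefficient of a (0,1)-form, which explains the
  conjugate derivative; the mixed second derivative is the coefficient of a (1,1)-form.\<close>

lemma dbar_transition:
  assumes c: "c \<in> A" and d: "d \<in> A" and x: "x \<in> fst c \<inter> fst d" and \<xi>: "\<xi> \<in> A00 A"
  defines "g' \<equiv> deriv (snd c \<circ> chart_inv d) (snd d x)"
  shows "dbar d \<xi> (snd d x) = cnj g' * dbar c \<xi> (snd c x)"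
    "d_dz (dbar d \<xi>) (snd d x) = of_real ((cmod g')\<^sup>2) * d_dz (dbar c \<xi>) (snd c x)"
proof -
  define g where "g = snd c \<circ> chart_inv d"
  define U where "U = snd d ` (fst d \<inter> fst c)"
  have U: "open U" unfolding U_def by (intro open_chart_image_Int open_chart_dom c d)
  have hol: "g holomorphic_on U" unfolding g_def U_def by (rule transition[OF c d])
  have xU: "snd d x \<in> U" using x by (auto simp: U_def)
  have gx: "g (snd d x) = snd c x" using x by (simp add: g_def chart_inv_chart[OF d])
  have gU: "g ` U \<subseteq> snd c ` fst c"
    unfolding g_def U_def using chart_inv_chart[OF d] by auto
  have eq: "(\<xi> \<circ> chart_inv d) w = (\<xi> \<circ> chart_inv c) (g w)" if "w \<in> U" for w
    using chart_inv_transition[OF c d that[unfolded U_def]] by (simp add: g_def)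
  have dg: "(g has_field_derivative g') (at (snd d x))"
    unfolding g'_def g_def[symmetric] by (rule holomorphic_derivI[OF hol U xU])
  have "d_dzbar (\<xi> \<circ> chart_inv d) (snd d x) = d_dzbar (\<lambda>w. (\<xi> \<circ> chart_inv c) (g w)) (snd d x)"
    by (rule d_dz_cong(2)[OF U xU eq])
  also have "\<dots> = cnj g' * d_dzbar (\<xi> \<circ> chart_inv c) (g (snd d x))"
    by (rule d_dz_compose_holomorphic(2)[OF A00_differentiable(1)[OF \<xi> c] dg])
       (use x gx in auto)
  finally show "dbar d \<xi> (snd d x) = cnj g' * dbar c \<xi> (snd c x)"
    by (simp add: dbar_def gx)
  have "d_dz (dbar d \<xi>) (snd d x) = d_dz (d_dzbar (\<lambda>w. (\<xi> \<circ> chart_inv c) (g w))) (snd d x)"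
    unfolding dbar_def by (rule d_dz_cong(1)[OF U xU d_dz_cong(2)[OF U _ eq]])
  also have "\<dots> = of_real ((cmod (deriv g (snd d x)))\<^sup>2) * d_dz (d_dzbar (\<xi> \<circ> chart_inv c)) (g (snd d x))"
    by (rule d_dz_d_dzbar_compose_holomorphic[OF U hol xU open_chart_image[OF c] gU A00_Ck_on[OF \<xi> c]])
  finally show "d_dz (dbar d \<xi>) (snd d x) = of_real ((cmod g')\<^sup>2) * d_dz (dbar c \<xi>) (snd c x)"
    unfolding g'_def g_def[symmetric] dbar_def by (simp only: gx)
qed

lemma dbar_add:
  assumes "\<xi> \<in> A00 A" "\<eta> \<in> A00 A" "c \<in> A" "z \<in> snd c ` fst c"
  shows "dbar c (\<lambda>x. \<xi> x + \<eta> x) z = dbar c \<xi> z + dbar c \<eta> z"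
    and "d_dz (dbar c (\<lambda>x. \<xi> x + \<eta> x)) z = d_dz (dbar c \<xi>) z + d_dz (dbar c \<eta>) z"
proof -
  have *: "dbar c (\<lambda>x. \<xi> x + \<eta> x) w = dbar c \<xi> w + dbar c \<eta> w" if "w \<in> snd c ` fst c" for w
    using d_dz_add(2)[OF A00_differentiable(1)[OF assms(1,3) that] A00_differentiable(1)[OF assms(2,3) that]]
    by (simp add: dbar_def o_def)
  from *[OF assms(4)] show "dbar c (\<lambda>x. \<xi> x + \<eta> x) z = dbar c \<xi> z + dbar c \<eta> z" .
  have "d_dz (dbar c (\<lambda>x. \<xi> x + \<eta> x)) z = d_dz (\<lambda>w. dbar c \<xi> w + dbar c \<eta> w) z"
    by (rule d_dz_cong(1)[OF open_chart_image[OF assms(3)] assms(4) *])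
  then show "d_dz (dbar c (\<lambda>x. \<xi> x + \<eta> x)) z = d_dz (dbar c \<xi>) z + d_dz (dbar c \<eta>) z"
    using d_dz_add(1)[OF A00_differentiable(2)[OF assms(1,3,4)] A00_differentiable(2)[OF assms(2,3,4)]]
    by simp
qed

lemma dbar_scale:
  assumes "\<xi> \<in> A00 A" "c \<in> A" "z \<in> snd c ` fst c"
  shows "dbar c (\<lambda>x. a * \<xi> x) z = a * dbar c \<xi> z"
    and "d_dz (dbar c (\<lambda>x. a * \<xi> x)) z = a * d_dz (dbar c \<xi>) z"
proof -
  have *: "dbar c (\<lambda>x. a * \<xi> x) w = a * dbar c \<xi> w" if "w \<in> snd c ` fst c" for w
    using d_dz_cmult(2)[OF A00_differentiable(1)[OF assms(1,2) that]] by (simp add: dbar_def o_def)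
  from *[OF assms(3)] show "dbar c (\<lambda>x. a * \<xi> x) z = a * dbar c \<xi> z" .
  have "d_dz (dbar c (\<lambda>x. a * \<xi> x)) z = d_dz (\<lambda>w. a * dbar c \<xi> w) z"
    by (rule d_dz_cong(1)[OF open_chart_image[OF assms(2)] assms(3) *])
  then show "d_dz (dbar c (\<lambda>x. a * \<xi> x)) z = a * d_dz (dbar c \<xi>) z"
    using d_dz_cmult(1)[OF A00_differentiable(2)[OF assms]] by simp
qed

lemma laplacian_add:
  assumes "\<xi> \<in> A00 A" "\<eta> \<in> A00 A"
  shows "laplacian A h (\<lambda>x. \<xi> x + \<eta> x) x = laplacian A h \<xi> x + laplacian A h \<eta> x"
  using dbar_add(2)[OF assms index_at_tangent(1) imageI[OF index_at_tangent(2)], of x]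
  by (simp add: laplacian_dbar Let_def algebra_simps)

lemma laplacian_scale:
  assumes "\<xi> \<in> A00 A"
  shows "laplacian A h (\<lambda>x. a * \<xi> x) x = a * laplacian A h \<xi> x"
  using dbar_scale(2)[OF assms index_at_tangent(1) imageI[OF index_at_tangent(2)], where a = a]
  by (simp add: laplacian_dbar Let_def)

end

context metrized_surface
begin

text \<open>Between the chart selected by \<open>index_at\<close> and any other, numerator and
  denominator both change by |g'|^2, which is nonzero because \<open>h\<close> is positive in both
  charts.\<close>

lemma laplacian_chart:
  assumes "c \<in> A" "x \<in> fst c" "\<xi> \<in> A00 A"
  shows "laplacian A h \<xi> x = - (d_dz (dbar c \<xi>) (snd c x) / of_real (h c x))"
proof -
  let ?d = "index_at (tangent_bundle A) x"
  have d: "?d \<in> A" "x \<in> fst ?d" by (rule index_at_tangent)+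
  then have x: "x \<in> fst c \<inter> fst ?d" using assms(2) by simp
  let ?g' = "deriv (snd c \<circ> chart_inv ?d) (snd ?d x)"
  have h: "h ?d x = (cmod ?g')\<^sup>2 * h c x" by (rule h_transition[OF assms(1) d(1) x])
  with h_pos[OF d] have "cmod ?g' \<noteq> 0" by auto
  then show ?thesis
    unfolding laplacian_dbar Let_def dbar_transition(2)[OF assms(1) d(1) x assms(3)] h
    using h_pos[OF assms(1,2)] by (simp add: field_simps)
qed

text \<open>The pointwise hermitian product of \<partial>-bar \<xi> and \<partial>-bar \<eta> in the
  metric induced by \<open>h\<close>. Against the volume form \<open>h\<close> cancels, which leaves
  the usual Dirichlet integrand.\<close>

definition dirichlet :: "('a \<Rightarrow> complex) \<Rightarrow> ('a \<Rightarrow> complex) \<Rightarrow> 'a \<Rightarrow> complex" where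
  "dirichlet \<xi> \<eta> x = (let c = index_at (tangent_bundle A) x in
     dbar c \<xi> (snd c x) * cnj (dbar c \<eta> (snd c x)) / of_real (h c x))"

lemma dirichlet_chart:
  assumes "c \<in> A" "x \<in> fst c" "\<xi> \<in> A00 A" "\<eta> \<in> A00 A"
  shows "dirichlet \<xi> \<eta> x = dbar c \<xi> (snd c x) * cnj (dbar c \<eta> (snd c x)) / of_real (h c x)"
proof -
  let ?d = "index_at (tangent_bundle A) x"
  have d: "?d \<in> A" "x \<in> fst ?d" by (rule index_at_tangent)+
  then have x: "x \<in> fst c \<inter> fst ?d" using assms(2) by simp
  let ?g' = "deriv (snd c \<circ> chart_inv ?d) (snd ?d x)"
  have h: "h ?d x = (cmod ?g')\<^sup>2 * h c x" by (rule h_transition[OF assms(1) d(1) x])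
  with h_pos[OF d] have "?g' \<noteq> 0" by auto
  moreover have "complex_of_real ((cmod ?g')\<^sup>2) = ?g' * cnj ?g'" by (rule complex_norm_square)
  ultimately show ?thesis
    unfolding dirichlet_def Let_def dbar_transition(1)[OF assms(1) d(1) x assms(3)]
      dbar_transition(1)[OF assms(1) d(1) x assms(4)] h of_real_mult
    using h_pos[OF assms(1,2)] by (simp add: field_simps)
qed

lemma continuous_on_surfaceI:
  fixes f :: "'a \<Rightarrow> 'b::topological_space"
  assumes "\<And>c. c \<in> A \<Longrightarrow> continuous_on (snd c ` fst c) (F c)"
    and "\<And>c x. c \<in> A \<Longrightarrow> x \<in> fst c \<Longrightarrow> f x = F c (snd c x)"
  shows "continuous_on UNIV f"
proof (rule continuous_on_local)
  fix x :: 'a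
  obtain c where c: "c \<in> A" "x \<in> fst c" by (rule chart_at)
  have "continuous_on (fst c) (\<lambda>x. F c (snd c x))"
    by (rule continuous_on_compose2[OF assms(1)[OF c(1)] continuous_on_chart[OF c(1)]]) simp
  then have "continuous_on (fst c) f"
    by (rule continuous_on_eq) (simp add: assms(2)[OF c(1)])
  with c open_chart_dom[OF c(1)] show "\<exists>V. open V \<and> x \<in> V \<and> continuous_on V f" by blast
qed

lemma h_chart_continuous: "c \<in> A \<Longrightarrow> continuous_on (snd c ` fst c) (\<lambda>z. h c (chart_inv c z))"
  using continuous_on_chartD[where W = UNIV, of c "h c"] h_continuous[of c] by (simp add: o_def)

lemma laplacian_continuous:
  assumes "\<xi> \<in> A00 A"
  shows "continuous_on UNIV (laplacian A h \<xi>)"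
proof (rule continuous_on_surfaceI)
  fix c assume c: "c \<in> A"
  have "Ck_on 0 (d_dz (dbar c \<xi>)) (snd c ` fst c)"
    by (rule Ck_on_d_dz(1)[OF open_chart_image[OF c] dbar_Ck_on[OF assms c]])
  moreover have "h c (chart_inv c z) \<noteq> 0" if "z \<in> snd c ` fst c" for z
    using h_pos[OF c chart_inv_in_dom[OF c that]] by simp
  ultimately show "continuous_on (snd c ` fst c) (\<lambda>z. - (d_dz (dbar c \<xi>) z / of_real (h c (chart_inv c z))))"
    using h_chart_continuous[OF c] by (intro continuous_intros) auto
qed (simp add: laplacian_chart assms chart_inv_chart)

lemma dirichlet_continuous:
  assumes "\<xi> \<in> A00 A" "\<eta> \<in> A00 A"
  shows "continuous_on UNIV (dirichlet \<xi> \<eta>)"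
proof (rule continuous_on_surfaceI)
  fix c assume c: "c \<in> A"
  have "Ck_on 0 (dbar c \<xi>) (snd c ` fst c)" "Ck_on 0 (dbar c \<eta>) (snd c ` fst c)"
    by (intro dbar_Ck_on assms c)+
  moreover have "h c (chart_inv c z) \<noteq> 0" if "z \<in> snd c ` fst c" for z
    using h_pos[OF c chart_inv_in_dom[OF c that]] by simp
  ultimately show "continuous_on (snd c ` fst c)
      (\<lambda>z. dbar c \<xi> z * cnj (dbar c \<eta> z) / of_real (h c (chart_inv c z)))"
    using h_chart_continuous[OF c] by (intro continuous_intros) auto
qed (simp add: dirichlet_chart assms chart_inv_chart)

text \<open>Additivity in the second argument is what Green's formula uses, as it is localised in
  \<eta>.\<close>

lemma dirichlet_add_right:
  assumes "\<eta> \<in> A00 A" "\<eta>' \<in> A00 A"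
  shows "dirichlet \<xi> (\<lambda>x. \<eta> x + \<eta>' x) x = dirichlet \<xi> \<eta> x + dirichlet \<xi> \<eta>' x"
  using dbar_add(1)[OF assms index_at_tangent(1) imageI[OF index_at_tangent(2)], of x]
  by (simp add: dirichlet_def Let_def algebra_simps add_divide_distrib)

lemma dirichlet_0_right: "dirichlet \<xi> (\<lambda>x. 0) x = 0"
  by (simp add: dirichlet_def dbar_def o_def)

lemma A00_sum: "(\<And>i. i \<in> I \<Longrightarrow> f i \<in> A00 A) \<Longrightarrow> (\<lambda>x. \<Sum>i\<in>I. f i x) \<in> A00 A"
  unfolding A00_def by (simp add: smooth_on_surface_sum)

lemma dirichlet_sum_right:
  assumes "finite I" "\<And>i. i \<in> I \<Longrightarrow> f i \<in> A00 A"
  shows "dirichlet \<xi> (\<lambda>x. \<Sum>i\<in>I. f i x) x = (\<Sum>i\<in>I. dirichlet \<xi> (f i) x)"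
  using assms
proof (induction I rule: finite_induct)
  case empty
  then show ?case by (simp add: dirichlet_0_right)
next
  case (insert i I)
  then have "f i \<in> A00 A" "(\<lambda>x. \<Sum>i\<in>I. f i x) \<in> A00 A" by (auto intro: A00_sum)
  from dirichlet_add_right[OF this] insert show ?case by simp
qed

text \<open>In the chart, the difference of the two integrands times the density of the volume form is
  \<open>1/\<pi>\<close> times the derivative \<open>\<partial>/\<partial>z\<close> of \<open>(\<partial>\<xi>/\<partial>z\<close>-bar\<open>) \<eta>\<close>-bar, which has compact support.\<close>

lemma green_formula_local:
  assumes \<xi>: "\<xi> \<in> A00 A" and \<eta>: "\<eta> \<in> A00 A" and c: "c \<in> A"
    and K: "compact K" "K \<subseteq> fst c" "\<And>x. x \<notin> K \<Longrightarrow> \<eta> x = 0"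
  shows "(\<integral>x. laplacian A h \<xi> x * cnj (\<eta> x) \<partial>vol) = (\<integral>x. dirichlet \<xi> \<eta> x \<partial>vol)"
proof -
  let ?S = "snd c ` fst c" and ?\<eta> = "\<eta> \<circ> chart_inv c"
  \<comment> \<open>Extension by zero gives a C^1 function on the whole plane, to which
    \<open>integral_d_dz_eq_0\<close> applies.\<close>
  define F where "F = (\<lambda>z. if z \<in> ?S then dbar c \<xi> z * cnj (?\<eta> z) else 0)"
  define f where "f = (\<lambda>x. dirichlet \<xi> \<eta> x - laplacian A h \<xi> x * cnj (\<eta> x))"
  have compact: "compact (snd c ` K)"
    by (intro compact_continuous_image continuous_on_subset[OF continuous_on_chart[OF c] K(2)] K(1))
  have KS: "snd c ` K \<subseteq> ?S" using K(2) by auto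
  have opS: "open ?S" by (rule open_chart_image[OF c])
  have opK: "open (- (snd c ` K))" by (intro open_Compl compact_imp_closed compact)
  have F0: "F z = 0" if "z \<notin> snd c ` K" for z
  proof (cases "z \<in> ?S")
    case True
    have "chart_inv c z \<notin> K"
    proof
      assume "chart_inv c z \<in> K"
      from imageI[OF this, of "snd c"] chart_chart_inv[OF c True] that show False by simp
    qed
    then show ?thesis by (simp add: F_def K(3))
  qed (simp add: F_def)
  have F_Ck: "Ck_on 1 F UNIV"
  proof (rule Ck_on_local)
    fix z
    have "Ck_on 1 (\<lambda>z. dbar c \<xi> z * cnj (?\<eta> z)) ?S"
      by (intro Ck_on_bilinear[OF bounded_bilinear_mult] Ck_on_bounded_linear[OF bounded_linear_cnj]
          opS dbar_Ck_on A00_Ck_on \<xi> \<eta> c)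
    then have 1: "Ck_on 1 F ?S"
      by (subst Ck_on_cong[OF opS, where g = "\<lambda>z. dbar c \<xi> z * cnj (?\<eta> z)"]) (simp_all add: F_def)
    have 2: "Ck_on 1 F (- (snd c ` K))"
      by (subst Ck_on_cong[OF opK, where g = "\<lambda>z. 0"]) (simp_all add: F0)
    show "\<exists>T. open T \<and> z \<in> T \<and> Ck_on 1 F T"
    proof (cases "z \<in> ?S")
      case True
      with 1 opS show ?thesis by blast
    next
      case False
      with KS have "z \<in> - (snd c ` K)" by auto
      with 2 opK show ?thesis by blast
    qed
  qed
  have dF: "d_dz F z = d_dz (dbar c \<xi>) z * cnj (?\<eta> z) + dbar c \<xi> z * cnj (dbar c \<eta> z)" if z: "z \<in> ?S" for z
  proof -
    have "d_dz F z = d_dz (\<lambda>z. dbar c \<xi> z * cnj (?\<eta> z)) z"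
      by (rule d_dz_cong(1)[OF opS z]) (simp add: F_def)
    also have "\<dots> = d_dz (dbar c \<xi>) z * cnj (?\<eta> z) + dbar c \<xi> z * d_dz (\<lambda>z. cnj (?\<eta> z)) z"
      by (rule d_dz_mult(1)[OF A00_differentiable(2)[OF \<xi> c z] d_dz_cnj(3)[OF A00_differentiable(1)[OF \<eta> c z]]])
    also have "d_dz (\<lambda>z. cnj (?\<eta> z)) z = cnj (dbar c \<eta> z)"
      using d_dz_cnj(1)[OF A00_differentiable(1)[OF \<eta> c z]] by (simp add: dbar_def)
    finally show ?thesis .
  qed
  have dF0: "d_dz F z = 0" if "z \<notin> ?S" for z
    using d_dz_cong(1)[OF opK, of z F "\<lambda>z. 0"] KS that F0 by auto
  have f_cont: "continuous_on UNIV f"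
    unfolding f_def by (intro continuous_intros dirichlet_continuous laplacian_continuous A00_continuous \<xi> \<eta>)
  \<comment> \<open>Off the chart \<open>c\<close> the Dirichlet term is evaluated in the chart
    selected at \<open>x\<close>. There \<eta> vanishes on the open complement of \<open>K\<close>,
    and with it its derivative; the Laplacian term vanishes because \<eta> does at
    \<open>x\<close>.\<close>
  have f0: "f x = 0" if x: "x \<notin> fst c" for x
  proof -
    let ?d = "index_at (tangent_bundle A) x"
    have d: "?d \<in> A" "x \<in> fst ?d" by (rule index_at_tangent)+
    have opd: "open (snd ?d ` (fst ?d \<inter> - K))"
      by (intro open_chart_image_Int d open_Compl compact_imp_closed K)
    have xK: "x \<notin> K" using x K(2) by auto
    have "dbar ?d \<eta> (snd ?d x) = d_dzbar (\<lambda>z. 0) (snd ?d x)"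
      unfolding dbar_def
    proof (rule d_dz_cong(2)[OF opd])
      show "snd ?d x \<in> snd ?d ` (fst ?d \<inter> - K)" using d(2) xK by auto
      show "(\<eta> \<circ> chart_inv ?d) w = 0" if "w \<in> snd ?d ` (fst ?d \<inter> - K)" for w
        using that in_chart_image_iff[OF d(1)] K(3) by simp
    qed
    then show ?thesis using K(3)[OF xK] by (simp add: f_def dirichlet_def Let_def)
  qed
  have "(\<integral>x. f x \<partial>vol) = (\<integral>z. chart_density c z *\<^sub>R f (param c z) \<partial>lborel)"
    by (rule integral_vol_chart[OF c borel_measurable_continuous_onI[OF f_cont] f0])
  also have "\<dots> = (\<integral>z. (1 / of_real pi) * d_dz F z \<partial>lborel)"
  proof (rule Bochner_Integration.integral_cong[OF refl])
    fix z
    show "chart_density c z *\<^sub>R f (param c z) = (1 / of_real pi) * d_dz F z"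
    proof (cases "z \<in> ?S")
      case True
      let ?x = "chart_inv c z"
      have x: "?x \<in> fst c" "snd c ?x = z" using chart_inv_in_dom[OF c True] chart_chart_inv[OF c True] by auto
      have h: "h c ?x > 0" by (rule h_pos[OF c x(1)])
      \<comment> \<open>The minus sign of the Laplacian turns the difference into the sum produced
        by the product rule for \<open>F\<close>.\<close>
      have "f ?x = (dbar c \<xi> z * cnj (dbar c \<eta> z) + d_dz (dbar c \<xi>) z * cnj (?\<eta> z)) / of_real (h c ?x)"
        unfolding f_def dirichlet_chart[OF c x(1) \<xi> \<eta>] laplacian_chart[OF c x(1) \<xi>] x(2)
        by (simp add: add_divide_distrib)
      with h True show ?thesis
        by (simp add: chart_density_eq param_def dF scaleR_conv_of_real add.commute)
    qed (simp add: chart_density_def dF0)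
  qed
  also have "\<dots> = 0"
    using integral_d_dz_eq_0[OF F_Ck compact F0] by simp
  finally have "(\<integral>x. f x \<partial>vol) = 0" .
  moreover have "(\<integral>x. f x \<partial>vol) = (\<integral>x. dirichlet \<xi> \<eta> x \<partial>vol) - (\<integral>x. laplacian A h \<xi> x * cnj (\<eta> x) \<partial>vol)"
    unfolding f_def
    by (intro Bochner_Integration.integral_diff continuous_integrable_vol continuous_intros
        dirichlet_continuous laplacian_continuous A00_continuous \<xi> \<eta>)
  ultimately show ?thesis by simp
qed

text \<open>Both sides are additive in \<eta>, so \<eta> is cut into pieces supported in single
  charts while \<xi> is left whole.\<close>

lemma green_formula:
  assumes \<xi>: "\<xi> \<in> A00 A" and \<eta>: "\<eta> \<in> A00 A"
  shows "(\<integral>x. laplacian A h \<xi> x * cnj (\<eta> x) \<partial>vol) = (\<integral>x. dirichlet \<xi> \<eta> x \<partial>vol)"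
proof -
  obtain I :: "'a set" and p :: "'a \<Rightarrow> 'a \<Rightarrow> real" where I: "finite I"
    "\<And>i. i \<in> I \<Longrightarrow> smooth_on_surface A UNIV (p i)"
    "\<And>i. i \<in> I \<Longrightarrow> \<exists>c\<in>A. \<exists>K. compact K \<and> K \<subseteq> fst c \<and> (\<forall>y. y \<notin> K \<longrightarrow> p i y = 0)"
    "\<And>y. (\<Sum>i\<in>I. p i y) = 1"
    by (rule partition_of_unity) blast
  define q where "q = (\<lambda>i x. of_real (p i x) * \<eta> x)"
  have q: "q i \<in> A00 A" if "i \<in> I" for i
    unfolding q_def A00_def mem_Collect_eq
    by (intro smooth_on_surface_bilinear[OF bounded_bilinear_mult] open_UNIV A00_smooth[OF \<eta>]
        smooth_on_surface_bounded_linear[OF bounded_linear_of_real] I(2)[OF that])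
  have sum: "(\<Sum>i\<in>I. q i x) = \<eta> x" for x
    unfolding q_def by (simp add: sum_distrib_right[symmetric] of_real_sum[symmetric] I(4) del: of_real_sum)
  have loc: "(\<integral>x. laplacian A h \<xi> x * cnj (q i x) \<partial>vol) = (\<integral>x. dirichlet \<xi> (q i) x \<partial>vol)"
    if i: "i \<in> I" for i
  proof -
    from I(3)[OF i] obtain c K where cK: "c \<in> A" "compact K" "K \<subseteq> fst c" "\<forall>y. y \<notin> K \<longrightarrow> p i y = 0"
      by (elim bexE exE conjE)
    show ?thesis
      by (rule green_formula_local[OF \<xi> q[OF i] cK(1-3)]) (simp add: q_def cK(4))
  qed
  have "(\<integral>x. laplacian A h \<xi> x * cnj (\<eta> x) \<partial>vol)
      = (\<integral>x. (\<Sum>i\<in>I. laplacian A h \<xi> x * cnj (q i x)) \<partial>vol)"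
    by (simp add: sum[symmetric] sum_distrib_left)
  also have "\<dots> = (\<Sum>i\<in>I. \<integral>x. laplacian A h \<xi> x * cnj (q i x) \<partial>vol)"
    by (intro Bochner_Integration.integral_sum continuous_integrable_vol continuous_intros
        laplacian_continuous A00_continuous \<xi> q)
  also have "\<dots> = (\<Sum>i\<in>I. \<integral>x. dirichlet \<xi> (q i) x \<partial>vol)"
    by (intro sum.cong refl loc)
  also have "\<dots> = (\<integral>x. (\<Sum>i\<in>I. dirichlet \<xi> (q i) x) \<partial>vol)"
    by (intro Bochner_Integration.integral_sum[symmetric] continuous_integrable_vol dirichlet_continuous \<xi> q)
  also have "\<dots> = (\<integral>x. dirichlet \<xi> \<eta> x \<partial>vol)"
  proof -
    have "(\<Sum>i\<in>I. dirichlet \<xi> (q i) x) = dirichlet \<xi> (\<lambda>x. \<Sum>i\<in>I. q i x) x" for x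
      by (rule dirichlet_sum_right[OF I(1), symmetric]) (rule q)
    then show ?thesis by (simp only: sum)
  qed
  finally show ?thesis .
qed

lemma dirichlet_commute: "dirichlet \<eta> \<xi> x = cnj (dirichlet \<xi> \<eta> x)"
  by (simp add: dirichlet_def Let_def)

text \<open>Up to conjugation both sides are Dirichlet integrals by Green's formula, and
  \<open>dirichlet\<close> is conjugate symmetric.\<close>

lemma laplacian_symmetric:
  assumes \<xi>: "\<xi> \<in> A00 A" and \<eta>: "\<eta> \<in> A00 A"
  shows "(\<integral>x. laplacian A h \<xi> x * cnj (\<eta> x) \<partial>vol) = (\<integral>x. \<xi> x * cnj (laplacian A h \<eta> x) \<partial>vol)"
proof -
  have "(\<integral>x. \<xi> x * cnj (laplacian A h \<eta> x) \<partial>vol) = (\<integral>x. cnj (laplacian A h \<eta> x * cnj (\<xi> x)) \<partial>vol)"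
    by (simp only: complex_cnj_mult complex_cnj_cnj mult.commute)
  also have "\<dots> = cnj (\<integral>x. laplacian A h \<eta> x * cnj (\<xi> x) \<partial>vol)"
    by (rule Bochner_Integration.integral_cnj)
  also have "\<dots> = cnj (\<integral>x. dirichlet \<eta> \<xi> x \<partial>vol)"
    by (simp only: green_formula[OF \<eta> \<xi>])
  also have "\<dots> = (\<integral>x. cnj (dirichlet \<eta> \<xi> x) \<partial>vol)"
    by simp
  also have "\<dots> = (\<integral>x. dirichlet \<xi> \<eta> x \<partial>vol)"
    by (simp only: dirichlet_commute[symmetric])
  also have "\<dots> = (\<integral>x. laplacian A h \<xi> x * cnj (\<eta> x) \<partial>vol)"
    by (rule green_formula[OF \<xi> \<eta>, symmetric])
  finally show ?thesis ..
qed

text \<open>Green's formula turns the integral into that of |\<partial>-bar \<xi>|^2 / h.\<close>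

lemma laplacian_nonneg:
  assumes \<xi>: "\<xi> \<in> A00 A"
  shows "(\<integral>x. laplacian A h \<xi> x * cnj (\<xi> x) \<partial>vol) \<in> \<real>\<^sub>\<ge>\<^sub>0"
proof -
  define e where "e = (\<lambda>x. let c = index_at (tangent_bundle A) x in (cmod (dbar c \<xi> (snd c x)))\<^sup>2 / h c x)"
  have e: "dirichlet \<xi> \<xi> = (\<lambda>x. complex_of_real (e x))"
    by (simp add: fun_eq_iff dirichlet_def e_def Let_def complex_norm_square[symmetric])
  have "e x \<ge> 0" for x
    using h_pos[OF index_at_tangent, of x] by (simp add: e_def Let_def)
  then have "(\<integral>x. e x \<partial>vol) \<ge> 0" by (intro integral_nonneg_AE) simp
  then show ?thesis
    unfolding green_formula[OF \<xi> \<xi>] e by (simp add: integral_complex_of_real)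
qed

end

section \<open>The completion\<close>

text \<open>Squared norms satisfy no triangle inequality; (a + b)^2 \<le> 2 a^2 + 2 b^2 takes its
  place in all limits of this section.\<close>

lemma ennreal_tendsto_0_sandwich:
  fixes a b c :: "nat \<Rightarrow> ennreal"
  assumes "a \<longlonglongrightarrow> 0" "b \<longlonglongrightarrow> 0" "\<And>n. c n \<le> 2 * a n + 2 * b n"
  shows "c \<longlonglongrightarrow> 0"
proof (rule tendsto_sandwich[OF _ _ tendsto_const])
  have "(\<lambda>n. 2 * a n + 2 * b n) \<longlonglongrightarrow> 2 * 0 + 2 * 0"
    by (intro tendsto_add ennreal_tendsto_cmult assms(1,2)) simp_all
  then show "(\<lambda>n. 2 * a n + 2 * b n) \<longlonglongrightarrow> 0" by simp
qed (simp_all add: assms(3))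

locale l2_surface = metrized_surface A h for A :: "'a::t2_space chart set" and h +
  fixes hO :: "(unit, 'a) metric" and r :: real
  assumes r_pos: "r > 0" and hO_eq: "hO () x = r"
begin

abbreviation N :: "('a \<Rightarrow> complex) \<Rightarrow> ennreal" where "N \<equiv> l2_norm_sq A hO h"

lemma N_eq: "N f = (\<integral>\<^sup>+ x. ennreal ((cmod (f x))\<^sup>2 * r) \<partial>vol)"
  by (simp add: l2_norm_sq_def hO_eq)

lemma N_add_le:
  assumes "f \<in> borel_measurable borel" "g \<in> borel_measurable borel"
  shows "N (\<lambda>x. f x + g x) \<le> 2 * N f + 2 * N g"
proof -
  have [measurable]: "f \<in> borel_measurable vol" "g \<in> borel_measurable vol"
    using assms measurable_cong_sets[OF sets_vol refl] by blast+
  have "(cmod (f x + g x))\<^sup>2 * r \<le> 2 * ((cmod (f x))\<^sup>2 * r) + 2 * ((cmod (g x))\<^sup>2 * r)" for x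
  proof -
    have "(cmod (f x + g x))\<^sup>2 \<le> (cmod (f x) + cmod (g x))\<^sup>2"
      by (intro power_mono norm_triangle_ineq) simp
    also have "\<dots> \<le> 2 * (cmod (f x))\<^sup>2 + 2 * (cmod (g x))\<^sup>2"
      using sum_squares_bound[of "cmod (f x)" "cmod (g x)"] by (simp add: power2_sum)
    finally show ?thesis using r_pos by (simp add: distrib_right[symmetric] mult.assoc[symmetric])
  qed
  then have "N (\<lambda>x. f x + g x)
      \<le> (\<integral>\<^sup>+ x. 2 * ennreal ((cmod (f x))\<^sup>2 * r) + 2 * ennreal ((cmod (g x))\<^sup>2 * r) \<partial>vol)"
    unfolding N_eq using r_pos
    by (intro nn_integral_mono)
       (simp add: ennreal_mult[symmetric] ennreal_plus[symmetric] ennreal_leI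
         flip: ennreal_numeral del: ennreal_plus)
  also have "\<dots> = 2 * N f + 2 * N g"
    unfolding N_eq by (subst nn_integral_add) (simp_all add: nn_integral_cmult)
  finally show ?thesis .
qed

lemma N_minus_commute: "N (\<lambda>x. f x - g x) = N (\<lambda>x. g x - f x)"
  by (simp add: N_eq norm_minus_commute)

lemma N_diff_le:
  assumes "s \<in> borel_measurable borel" "t \<in> borel_measurable borel" "f \<in> borel_measurable borel"
  shows "N (\<lambda>x. s x - t x) \<le> 2 * N (\<lambda>x. s x - f x) + 2 * N (\<lambda>x. t x - f x)"
  using N_add_le[of "\<lambda>x. s x - f x" "\<lambda>x. f x - t x"] assms
  by (simp add: N_minus_commute[of t f] borel_measurable_diff)

lemma N_scale: "N (\<lambda>x. a * f x) = ennreal ((cmod a)\<^sup>2) * N f" if "f \<in> borel_measurable borel"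
proof -
  have [measurable]: "f \<in> borel_measurable vol"
    using that measurable_cong_sets[OF sets_vol refl] by blast
  show ?thesis
    unfolding N_eq using r_pos
    by (subst nn_integral_cmult[symmetric])
       (simp_all add: norm_mult power_mult_distrib ennreal_mult[symmetric] mult.assoc)
qed

text \<open>This is how uniform approximation controls the L^2 norm: the total volume is
  finite.\<close>

lemma N_le_bound:
  assumes "\<And>x. cmod (f x) \<le> M"
  shows "N f \<le> ennreal (M\<^sup>2 * r * measure vol UNIV)"
proof -
  have "N f \<le> (\<integral>\<^sup>+ x. ennreal (M\<^sup>2 * r) \<partial>vol)"
    unfolding N_eq using assms r_pos
    by (intro nn_integral_mono ennreal_leI mult_right_mono power_mono) auto
  also have "\<dots> = ennreal (M\<^sup>2 * r) * emeasure vol UNIV" by (simp add: space_vol)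
  also have "\<dots> = ennreal (M\<^sup>2 * r * measure vol UNIV)"
    using r_pos by (simp add: vol.emeasure_eq_measure ennreal_mult)
  finally show ?thesis .
qed

lemma A00_measurable: "\<xi> \<in> A00 A \<Longrightarrow> \<xi> \<in> borel_measurable borel"
  by (rule borel_measurable_continuous_onI[OF A00_continuous])

text \<open>The convergence part of \<open>H0_class\<close>; for Borel \<open>f\<close> the Cauchy
  condition follows from it by \<open>l2_limit_cauchy\<close>.\<close>

definition l2_limit :: "(nat \<Rightarrow> 'a \<Rightarrow> complex) \<Rightarrow> ('a \<Rightarrow> complex) \<Rightarrow> bool" where
  "l2_limit s f \<longleftrightarrow> (\<forall>n. s n \<in> A00 A) \<and> (\<lambda>n. N (\<lambda>x. s n x - f x)) \<longlonglongrightarrow> 0"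

lemma l2_limit_exists:
  assumes "continuous_on UNIV f"
  shows "\<exists>s. l2_limit s f"
proof -
  have "\<forall>n. \<exists>g\<in>A00 A. \<forall>x. cmod (f x - g x) < inverse (real (Suc n))"
  proof
    fix n
    obtain g where "g \<in> A00 A" "\<And>x. cmod (f x - g x) < inverse (real (Suc n))"
      using A00_dense[OF assms, of "inverse (real (Suc n))"] by auto
    then show "\<exists>g\<in>A00 A. \<forall>x. cmod (f x - g x) < inverse (real (Suc n))" by blast
  qed
  then obtain s where s: "\<And>n. s n \<in> A00 A" "\<And>n x. cmod (f x - s n x) < inverse (real (Suc n))"
    by metis
  have "(\<lambda>n. N (\<lambda>x. s n x - f x)) \<longlonglongrightarrow> 0"
  proof (rule tendsto_sandwich[OF _ _ tendsto_const])
    have "N (\<lambda>x. s n x - f x) \<le> ennreal ((inverse (real (Suc n)))\<^sup>2 * r * measure vol UNIV)" for n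
      using s(2)[of _ n] by (intro N_le_bound) (simp add: norm_minus_commute less_imp_le del: of_nat_Suc)
    then show "\<forall>\<^sub>F n in sequentially. N (\<lambda>x. s n x - f x)
        \<le> ennreal ((inverse (real (Suc n)))\<^sup>2 * r * measure vol UNIV)" by simp
    have "(\<lambda>n. (inverse (real (Suc n)))\<^sup>2 * r * measure vol UNIV) \<longlonglongrightarrow> 0\<^sup>2 * r * measure vol UNIV"
      by (intro tendsto_intros LIMSEQ_inverse_real_of_nat)
    then show "(\<lambda>n. ennreal ((inverse (real (Suc n)))\<^sup>2 * r * measure vol UNIV)) \<longlonglongrightarrow> 0"
      by (auto dest: tendsto_ennrealI simp del: of_nat_Suc)
  qed simp
  with s(1) show ?thesis by (auto simp: l2_limit_def)
qed

lemma l2_limit_add: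
  assumes "l2_limit s f" "l2_limit t g" "f \<in> borel_measurable borel" "g \<in> borel_measurable borel"
  shows "l2_limit (\<lambda>n x. s n x + t n x) (\<lambda>x. f x + g x)"
proof -
  have "(\<lambda>n. N (\<lambda>x. s n x + t n x - (f x + g x))) \<longlonglongrightarrow> 0"
  proof (rule ennreal_tendsto_0_sandwich)
    show "(\<lambda>n. N (\<lambda>x. s n x - f x)) \<longlonglongrightarrow> 0" "(\<lambda>n. N (\<lambda>x. t n x - g x)) \<longlonglongrightarrow> 0"
      using assms(1,2) by (simp_all add: l2_limit_def)
    fix n
    have "s n \<in> borel_measurable borel" "t n \<in> borel_measurable borel"
      using assms(1,2) by (simp_all add: l2_limit_def A00_measurable)
    then show "N (\<lambda>x. s n x + t n x - (f x + g x)) \<le> 2 * N (\<lambda>x. s n x - f x) + 2 * N (\<lambda>x. t n x - g x)"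
      using N_add_le[of "\<lambda>x. s n x - f x" "\<lambda>x. t n x - g x"] assms(3,4)
      by (simp add: borel_measurable_diff algebra_simps)
  qed
  with assms(1,2) show ?thesis by (simp add: l2_limit_def A00_add)
qed

lemma l2_limit_scale:
  assumes "l2_limit s f" "f \<in> borel_measurable borel"
  shows "l2_limit (\<lambda>n x. a * s n x) (\<lambda>x. a * f x)"
proof -
  have "(\<lambda>n. ennreal ((cmod a)\<^sup>2) * N (\<lambda>x. s n x - f x)) \<longlonglongrightarrow> ennreal ((cmod a)\<^sup>2) * 0"
    using assms(1) by (intro ennreal_tendsto_cmult) (simp_all add: l2_limit_def)
  moreover have "N (\<lambda>x. a * s n x - a * f x) = ennreal ((cmod a)\<^sup>2) * N (\<lambda>x. s n x - f x)" for n
  proof -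
    have "s n \<in> borel_measurable borel"
      using assms(1) by (simp add: l2_limit_def A00_measurable)
    then show ?thesis
      using N_scale[of "\<lambda>x. s n x - f x" a] assms(2)
      by (simp add: borel_measurable_diff right_diff_distrib)
  qed
  ultimately show ?thesis using assms(1) by (simp add: l2_limit_def A00_scale)
qed

lemma l2_limit_cauchy:
  assumes "l2_limit s f" "f \<in> borel_measurable borel"
  shows "l2_cauchy A hO h s"
  unfolding l2_cauchy_def
proof (intro conjI allI impI)
  show s: "s n \<in> A00 A" for n using assms(1) by (simp add: l2_limit_def)
  fix e :: real assume "e > 0"
  have "(\<lambda>n. N (\<lambda>x. s n x - f x)) \<longlonglongrightarrow> 0" using assms(1) by (simp add: l2_limit_def)
  \<comment> \<open>A quarter of e is needed because \<open>N_diff_le\<close> bounds the difference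
    by two such terms, each with a factor 2.\<close>
  from order_tendstoD(2)[OF this, of "ennreal (e / 4)"] \<open>e > 0\<close>
  have "\<forall>\<^sub>F n in sequentially. N (\<lambda>x. s n x - f x) < ennreal (e / 4)" by simp
  then obtain M where M: "\<And>n. n \<ge> M \<Longrightarrow> N (\<lambda>x. s n x - f x) < ennreal (e / 4)"
    by (auto simp: eventually_sequentially)
  have "N (\<lambda>x. s m x - s n x) < ennreal e" if "m \<ge> M" "n \<ge> M" for m n
  proof -
    have "N (\<lambda>x. s m x - s n x) \<le> 2 * N (\<lambda>x. s m x - f x) + 2 * N (\<lambda>x. s n x - f x)"
      by (intro N_diff_le A00_measurable s assms(2))
    also have "\<dots> < 2 * ennreal (e / 4) + 2 * ennreal (e / 4)"
      using M[OF that(1)] M[OF that(2)]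
      by (intro add_strict_mono ennreal_mult_strict_left_mono) auto
    also have "\<dots> = ennreal e"
      using \<open>e > 0\<close> by (simp add: ennreal_mult[symmetric] ennreal_plus[symmetric]
          flip: ennreal_numeral del: ennreal_plus)
    finally show ?thesis .
  qed
  then show "\<exists>N'. \<forall>m\<ge>N'. \<forall>n\<ge>N'. N (\<lambda>x. s m x - s n x) < ennreal e" by blast
qed

text \<open>Together with \<open>l2_equiv_limit\<close> this makes the sequences with a given limit
  one full equivalence class.\<close>

lemma l2_limit_equiv:
  assumes "l2_limit s f" "l2_limit t f" "f \<in> borel_measurable borel"
  shows "(s, t) \<in> l2_equiv A hO h"
proof -
  have "(\<lambda>n. N (\<lambda>x. s n x - t n x)) \<longlonglongrightarrow> 0"
  proof (rule ennreal_tendsto_0_sandwich)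
    show "(\<lambda>n. N (\<lambda>x. s n x - f x)) \<longlonglongrightarrow> 0" "(\<lambda>n. N (\<lambda>x. t n x - f x)) \<longlonglongrightarrow> 0"
      using assms(1,2) by (simp_all add: l2_limit_def)
    show "N (\<lambda>x. s n x - t n x) \<le> 2 * N (\<lambda>x. s n x - f x) + 2 * N (\<lambda>x. t n x - f x)" for n
      using assms(1,2) by (intro N_diff_le[OF A00_measurable A00_measurable assms(3)]) (simp_all add: l2_limit_def)
  qed
  then show ?thesis using l2_limit_cauchy assms by (simp add: l2_equiv_def)
qed

lemma l2_equiv_limit:
  assumes "l2_limit s f" "(s, t) \<in> l2_equiv A hO h" "f \<in> borel_measurable borel"
  shows "l2_limit t f"
proof -
  have t: "t n \<in> A00 A" for n using assms(2) by (simp add: l2_equiv_def l2_cauchy_def)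
  have s: "s n \<in> A00 A" for n using assms(1) by (simp add: l2_limit_def)
  have "(\<lambda>n. N (\<lambda>x. t n x - f x)) \<longlonglongrightarrow> 0"
  proof (rule ennreal_tendsto_0_sandwich)
    show "(\<lambda>n. N (\<lambda>x. s n x - t n x)) \<longlonglongrightarrow> 0" using assms(2) by (simp add: l2_equiv_def)
    show "(\<lambda>n. N (\<lambda>x. s n x - f x)) \<longlonglongrightarrow> 0" using assms(1) by (simp add: l2_limit_def)
    show "N (\<lambda>x. t n x - f x) \<le> 2 * N (\<lambda>x. s n x - t n x) + 2 * N (\<lambda>x. s n x - f x)" for n
      using N_add_le[of "\<lambda>x. t n x - s n x" "\<lambda>x. s n x - f x"] A00_measurable[OF t, of n]
        A00_measurable[OF s, of n] assms(3)
      by (simp add: N_minus_commute[of "t n" "s n"] borel_measurable_diff)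
  qed
  with t show ?thesis by (simp add: l2_limit_def)
qed

lemma H0_class_eq:
  assumes "f \<in> borel_measurable borel"
  shows "H0_class A hO h f = {s. l2_limit s f}"
  using assms l2_limit_cauchy[OF _ assms] by (auto simp: H0_class_def l2_limit_def l2_cauchy_def)

lemma H0_class_eq_Image:
  assumes "f \<in> borel_measurable borel" "l2_limit s f"
  shows "H0_class A hO h f = l2_equiv A hO h `` {s}"
  unfolding H0_class_eq[OF assms(1)]
  using l2_limit_equiv[OF assms(2) _ assms(1)] l2_equiv_limit[OF assms(2) _ assms(1)] by blast

lemma H0_class_in_H0:
  assumes "continuous_on UNIV f"
  shows "H0_class A hO h f \<in> H0 A hO h"
proof -
  have f: "f \<in> borel_measurable borel" by (rule borel_measurable_continuous_onI[OF assms])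
  obtain s where s: "l2_limit s f" using l2_limit_exists[OF assms] by blast
  show ?thesis
    unfolding H0_class_eq_Image[OF f s] H0_def
    by (rule quotientI) (simp add: l2_limit_cauchy[OF s f])
qed

text \<open>From left to right, one approximating pair is enough, since the image under
  \<open>l2_equiv\<close> reaches every sequence with the same limit. From right to left, sums of
  arbitrary members still converge to f + g.\<close>

lemma H0_class_add:
  assumes "continuous_on UNIV f" "continuous_on UNIV g"
  shows "H0_class A hO h (\<lambda>x. f x + g x) = H0_add A hO h (H0_class A hO h f) (H0_class A hO h g)"
proof -
  have m: "f \<in> borel_measurable borel" "g \<in> borel_measurable borel"
    using assms by (auto intro: borel_measurable_continuous_onI)
  then have fg: "(\<lambda>x. f x + g x) \<in> borel_measurable borel" by (rule borel_measurable_add)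
  obtain s t where st: "l2_limit s f" "l2_limit t g" using l2_limit_exists assms by blast
  show ?thesis
  proof (intro equalityI subsetI)
    fix u assume "u \<in> H0_class A hO h (\<lambda>x. f x + g x)"
    then have "((\<lambda>n x. s n x + t n x), u) \<in> l2_equiv A hO h"
      using l2_limit_equiv[OF l2_limit_add[OF st m] _ fg] by (simp add: H0_class_eq[OF fg])
    with st show "u \<in> H0_add A hO h (H0_class A hO h f) (H0_class A hO h g)"
      unfolding H0_add_def H0_class_eq[OF m(1)] H0_class_eq[OF m(2)] by blast
  next
    fix u assume "u \<in> H0_add A hO h (H0_class A hO h f) (H0_class A hO h g)"
    then obtain s t where "l2_limit s f" "l2_limit t g" "((\<lambda>n x. s n x + t n x), u) \<in> l2_equiv A hO h"
      unfolding H0_add_def H0_class_eq[OF m(1)] H0_class_eq[OF m(2)] by blast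
    then show "u \<in> H0_class A hO h (\<lambda>x. f x + g x)"
      using l2_equiv_limit[OF l2_limit_add[OF _ _ m] _ fg] by (simp add: H0_class_eq[OF fg])
  qed
qed

lemma H0_class_scale:
  assumes "continuous_on UNIV f"
  shows "H0_class A hO h (\<lambda>x. a * f x) = H0_scale A hO h a (H0_class A hO h f)"
proof -
  have m: "f \<in> borel_measurable borel" using assms by (rule borel_measurable_continuous_onI)
  then have af: "(\<lambda>x. a * f x) \<in> borel_measurable borel" by simp
  obtain s where s: "l2_limit s f" using l2_limit_exists assms by blast
  show ?thesis
  proof (intro equalityI subsetI)
    fix u assume "u \<in> H0_class A hO h (\<lambda>x. a * f x)"
    then have "((\<lambda>n x. a * s n x), u) \<in> l2_equiv A hO h"
      using l2_limit_equiv[OF l2_limit_scale[OF s m] _ af] by (simp add: H0_class_eq[OF af])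
    with s show "u \<in> H0_scale A hO h a (H0_class A hO h f)"
      unfolding H0_scale_def H0_class_eq[OF m] by blast
  next
    fix u assume "u \<in> H0_scale A hO h a (H0_class A hO h f)"
    then obtain s where "l2_limit s f" "((\<lambda>n x. a * s n x), u) \<in> l2_equiv A hO h"
      unfolding H0_scale_def H0_class_eq[OF m] by blast
    then show "u \<in> H0_class A hO h (\<lambda>x. a * f x)"
      using l2_equiv_limit[OF l2_limit_scale[OF _ m] _ af] by (simp add: H0_class_eq[OF af])
  qed
qed

lemma laplacian_linear_operator:
  "linear_operator_into_H0 A hO h (\<lambda>\<xi>. H0_class A hO h (laplacian A h \<xi>))"
  unfolding linear_operator_into_H0_def
proof (intro conjI ballI allI)
  fix \<xi> assume \<xi>: "\<xi> \<in> A00 A"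
  show "H0_class A hO h (laplacian A h \<xi>) \<in> H0 A hO h"
    by (rule H0_class_in_H0[OF laplacian_continuous[OF \<xi>]])
  show "H0_class A hO h (laplacian A h (\<lambda>x. \<xi> x + \<eta> x))
      = H0_add A hO h (H0_class A hO h (laplacian A h \<xi>)) (H0_class A hO h (laplacian A h \<eta>))"
    if \<eta>: "\<eta> \<in> A00 A" for \<eta>
    using H0_class_add[OF laplacian_continuous[OF \<xi>] laplacian_continuous[OF \<eta>]]
    by (simp only: laplacian_add[OF \<xi> \<eta>, abs_def])
  show "H0_class A hO h (laplacian A h (\<lambda>x. a * \<xi> x))
      = H0_scale A hO h a (H0_class A hO h (laplacian A h \<xi>))" for a
    using H0_class_scale[OF laplacian_continuous[OF \<xi>]]
    by (simp only: laplacian_scale[OF \<xi>, abs_def])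
qed

lemma l2_norm_laplacian_finite:
  assumes "\<xi> \<in> A00 A"
  shows "N (laplacian A h \<xi>) < \<infinity>"
proof -
  obtain M where "\<And>x. cmod (laplacian A h \<xi> x) \<le> M"
    using continuous_bounded[OF laplacian_continuous[OF assms]] by blast
  then have "N (laplacian A h \<xi>) \<le> ennreal (M\<^sup>2 * r * measure vol UNIV)" by (rule N_le_bound)
  also have "\<dots> < \<infinity>" by simp
  finally show ?thesis .
qed

lemma l2_prod_eq: "l2_prod A hO h f g = of_real r * (\<integral>x. f x * cnj (g x) \<partial>vol)"
  by (simp add: l2_prod_def hO_eq mult.commute)

lemma l2_prod_laplacian_symmetric:
  assumes "\<xi> \<in> A00 A" "\<eta> \<in> A00 A"
  shows "l2_prod A hO h (laplacian A h \<xi>) \<eta> = l2_prod A hO h \<xi> (laplacian A h \<eta>)"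
  unfolding l2_prod_eq by (simp only: laplacian_symmetric[OF assms])

lemma l2_prod_laplacian_nonneg:
  assumes "\<xi> \<in> A00 A"
  shows "l2_prod A hO h (laplacian A h \<xi>) \<xi> \<in> \<real>\<^sub>\<ge>\<^sub>0"
  unfolding l2_prod_eq using r_pos
  by (intro nonneg_Reals_mult_I laplacian_nonneg assms) simp

end

section \<open>Change of the metric\<close>

context metrized_surface
begin

text \<open>The function \<rho> of the overview; by \<open>metric_ratio_chart\<close> its value does
  not depend on the selected chart.\<close>

definition metric_ratio :: "('a chart, 'a) metric \<Rightarrow> 'a \<Rightarrow> real" where
  "metric_ratio h' x = (let c = index_at (tangent_bundle A) x in h' c x / h c x)"

context
  fixes h' :: "('a chart, 'a) metric"
  assumes h': "continuous_metric (tangent_bundle A) h'"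
begin

interpretation h': metrized_surface A h' by unfold_locales (rule h')

lemma metric_ratio_chart:
  assumes c: "c \<in> A" "x \<in> fst c"
  shows "metric_ratio h' x = h' c x / h c x"
proof -
  let ?d = "index_at (tangent_bundle A) x"
  have d: "?d \<in> A" "x \<in> fst ?d" by (rule index_at_tangent)+
  then have x: "x \<in> fst c \<inter> fst ?d" using assms(2) by simp
  have "h ?d x = (cmod (deriv (snd c \<circ> chart_inv ?d) (snd ?d x)))\<^sup>2 * h c x"
    by (rule h_transition[OF assms(1) d(1) x])
  moreover have "h' ?d x = (cmod (deriv (snd c \<circ> chart_inv ?d) (snd ?d x)))\<^sup>2 * h' c x"
    by (rule h'.h_transition[OF assms(1) d(1) x])
  moreover have "h ?d x > 0" by (rule h_pos[OF d])
  ultimately show ?thesis by (auto simp: metric_ratio_def Let_def)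
qed

lemma metric_ratio_pos: "metric_ratio h' x > 0"
  using h_pos[OF index_at_tangent, of x] h'.h_pos[OF index_at_tangent, of x]
  by (simp add: metric_ratio_def Let_def)

lemma metric_ratio_continuous: "continuous_on UNIV (metric_ratio h')"
proof (rule continuous_on_surfaceI)
  fix c assume c: "c \<in> A"
  have "h c (chart_inv c z) \<noteq> 0" if "z \<in> snd c ` fst c" for z
    using h_pos[OF c chart_inv_in_dom[OF c that]] by simp
  then show "continuous_on (snd c ` fst c) (\<lambda>z. h' c (chart_inv c z) / h c (chart_inv c z))"
    using h_chart_continuous[OF c] h'.h_chart_continuous[OF c] by (intro continuous_intros) auto
qed (simp add: metric_ratio_chart chart_inv_chart)

text \<open>By uniqueness it is enough that the measure on the right has the values prescribed by
  \<open>h'\<close> in every chart.\<close>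

lemma volume_form_density:
  "volume_form A h' = density vol (\<lambda>x. ennreal (metric_ratio h' x))"
proof (rule is_volume_unique[OF h'.is_volume_vol])
  note ratio_meas [measurable] = borel_measurable_continuous_onI[OF metric_ratio_continuous]
  show "is_volume h' (density vol (\<lambda>x. ennreal (metric_ratio h' x)))"
    unfolding is_volume_def
  proof (intro conjI ballI impI)
    fix c B assume c: "c \<in> A" and B [measurable]: "B \<in> sets borel" and Bc: "B \<subseteq> fst c"
    have "emeasure (density vol (\<lambda>x. ennreal (metric_ratio h' x))) B
        = (\<integral>\<^sup>+ x. ennreal (metric_ratio h' x) * indicator B x \<partial>vol)"
      by (intro emeasure_density) auto
    also have "\<dots> = (\<integral>\<^sup>+ z. ennreal (chart_density c z)
        * (ennreal (metric_ratio h' (param c z)) * indicator B (param c z)) \<partial>lborel)"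
      by (rule nn_integral_vol_chart[OF c]) (use Bc in \<open>auto simp: indicator_def\<close>)
    also have "\<dots> = (\<integral>\<^sup>+ z. ennreal (h' c (chart_inv c z) / pi) * indicator (snd c ` B) z \<partial>lborel)"
    proof (rule nn_integral_cong)
      fix z
      show "ennreal (chart_density c z) * (ennreal (metric_ratio h' (param c z)) * indicator B (param c z))
        = ennreal (h' c (chart_inv c z) / pi) * indicator (snd c ` B) z"
      proof (cases "z \<in> snd c ` fst c")
        case True
        let ?x = "chart_inv c z"
        have x: "?x \<in> fst c" by (rule chart_inv_in_dom[OF c True])
        have "z \<in> snd c ` B \<longleftrightarrow> ?x \<in> B"
          using in_chart_image_iff[OF c, of z B] True Bc by (simp add: Int_absorb1)
        moreover have "chart_density c z * metric_ratio h' ?x = h' c ?x / pi"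
          using True h_pos[OF c x] by (simp add: chart_density_eq metric_ratio_chart[OF c x])
        then have "ennreal (chart_density c z) * ennreal (metric_ratio h' ?x) = ennreal (h' c ?x / pi)"
          using chart_density_nonneg[OF c] metric_ratio_pos by (simp add: ennreal_mult[symmetric] less_imp_le)
        ultimately show ?thesis
          using True by (simp add: param_def mult.assoc[symmetric] indicator_def)
      next
        case False
        with Bc have "z \<notin> snd c ` B" by auto
        with False show ?thesis by (simp add: chart_density_def)
      qed
    qed
    finally show "emeasure (density vol (\<lambda>x. ennreal (metric_ratio h' x))) B
        = (\<integral>\<^sup>+ z. ennreal (h' c (chart_inv c z) / pi) * indicator (snd c ` B) z \<partial>lborel)" .
  qed simp
qed

lemma laplacian_metric_ratio:
  assumes "\<xi> \<in> A00 A"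
  shows "laplacian A h' \<xi> x = laplacian A h \<xi> x / of_real (metric_ratio h' x)"
proof -
  let ?c = "index_at (tangent_bundle A) x"
  have c: "?c \<in> A" "x \<in> fst ?c" by (rule index_at_tangent)+
  show ?thesis
    using h_pos[OF c] h'.h_pos[OF c]
    unfolding laplacian_chart[OF c assms] h'.laplacian_chart[OF c assms] metric_ratio_chart[OF c]
    by (simp add: field_simps)
qed

end

end

context l2_surface
begin

text \<open>The volume form contributes one factor \<rho> and the squared Laplacian the factor
  \<rho>^(-2), which leaves 1/\<rho>.\<close>

lemma N_laplacian_metric_ratio:
  assumes h': "continuous_metric (tangent_bundle A) h'" and \<xi>: "\<xi> \<in> A00 A"
  shows "l2_norm_sq A hO h' (laplacian A h' \<xi>)
    = (\<integral>\<^sup>+ x. ennreal ((cmod (laplacian A h \<xi> x))\<^sup>2 * r / metric_ratio h' x) \<partial>vol)"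
proof -
  interpret h': metrized_surface A h' by unfold_locales (rule h')
  note ratio_meas [measurable] = borel_measurable_continuous_onI[OF metric_ratio_continuous[OF h']]
  have [measurable]: "laplacian A h' \<xi> \<in> borel_measurable borel"
    by (rule borel_measurable_continuous_onI[OF h'.laplacian_continuous[OF \<xi>]])
  have "l2_norm_sq A hO h' (laplacian A h' \<xi>)
    = (\<integral>\<^sup>+ x. ennreal (metric_ratio h' x) * ennreal ((cmod (laplacian A h' \<xi> x))\<^sup>2 * r) \<partial>vol)"
    unfolding l2_norm_sq_def volume_form_density[OF h'] hO_eq by (rule nn_integral_density) auto
  also have "\<dots> = (\<integral>\<^sup>+ x. ennreal ((cmod (laplacian A h \<xi> x))\<^sup>2 * r / metric_ratio h' x) \<partial>vol)"
  proof (rule nn_integral_cong)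
    fix x
    have "metric_ratio h' x > 0" by (rule metric_ratio_pos[OF h'])
    then show "ennreal (metric_ratio h' x) * ennreal ((cmod (laplacian A h' \<xi> x))\<^sup>2 * r)
        = ennreal ((cmod (laplacian A h \<xi> x))\<^sup>2 * r / metric_ratio h' x)"
      using r_pos unfolding laplacian_metric_ratio[OF h' \<xi>]
      by (simp add: ennreal_mult[symmetric] norm_divide power_divide power2_eq_square)
  qed
  finally show ?thesis .
qed

text \<open>From |\<rho> - 1| < e \<le> 1/2 follows |1/\<rho> - 1| \<le> 2e, and integrating this
  pointwise bound gives a relative error of at most 2e. The values are compared as real numbers,
  where their difference makes sense.\<close>

lemma N_laplacian_bounds:
  assumes h': "continuous_metric (tangent_bundle A) h'" and \<xi>: "\<xi> \<in> A00 A"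
    and e: "0 < e" "e \<le> 1 / 2"
    and close: "\<And>c x. c \<in> A \<Longrightarrow> x \<in> fst c \<Longrightarrow> \<bar>h' c x / h c x - 1\<bar> < e"
  shows "\<bar>enn2real (l2_norm_sq A hO h' (laplacian A h' \<xi>)) - enn2real (N (laplacian A h \<xi>))\<bar>
    \<le> 2 * e * enn2real (N (laplacian A h \<xi>))"
proof -
  interpret h': l2_surface A h' hO r by unfold_locales (fact h' r_pos hO_eq)+
  let ?N = "N (laplacian A h \<xi>)" and ?N' = "l2_norm_sq A hO h' (laplacian A h' \<xi>)"
  let ?g = "\<lambda>x. (cmod (laplacian A h \<xi> x))\<^sup>2 * r"
  have [measurable]: "laplacian A h \<xi> \<in> borel_measurable vol"
    by (rule continuous_measurable_vol[OF laplacian_continuous[OF \<xi>]])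
  have g: "?g x \<ge> 0" for x using r_pos by simp
  have inv: "1 - 2 * e \<le> inverse (metric_ratio h' x)" "inverse (metric_ratio h' x) \<le> 1 + 2 * e" for x
  proof -
    let ?\<rho> = "metric_ratio h' x"
    have "\<bar>?\<rho> - 1\<bar> < e"
      using close[OF index_at_tangent, of x] by (simp add: metric_ratio_def Let_def)
    then have \<rho>: "1 - e < ?\<rho>" "?\<rho> < 1 + e" by linarith+
    have pos: "?\<rho> > 0" using \<rho>(1) e by linarith
    have "(1 - 2 * e) * ?\<rho> \<le> (1 - 2 * e) * (1 + e)" using \<rho>(2) e by (intro mult_left_mono) auto
    also have "\<dots> \<le> 1" using e by (simp add: algebra_simps)
    finally show "1 - 2 * e \<le> inverse ?\<rho>" using pos by (simp add: field_simps)
    \<comment> \<open>The product equals 1 + e (1 - 2e), which is at least 1 because e \<le>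
      1/2.\<close>
    have "1 \<le> (1 + 2 * e) * (1 - e)"
      using e mult_left_mono[of e "1/2" e] by (simp add: algebra_simps)
    also have "\<dots> \<le> (1 + 2 * e) * ?\<rho>" using \<rho>(1) e by (intro mult_left_mono) auto
    finally show "inverse ?\<rho> \<le> 1 + 2 * e" using pos by (simp add: field_simps)
  qed
  \<comment> \<open>Finiteness allows inequalities to pass through \<open>enn2real\<close>, which
    sends infinity to 0.\<close>
  have fin: "?N < \<infinity>" "?N' < \<infinity>"
    by (rule l2_norm_laplacian_finite[OF \<xi>] h'.l2_norm_laplacian_finite[OF \<xi>])+
  have cmult: "(\<integral>\<^sup>+ x. ennreal (a * ?g x) \<partial>vol) = ennreal a * ?N" if "a \<ge> 0" for a
    unfolding N_eq using that g
    by (subst nn_integral_cmult[symmetric]) (simp_all add: ennreal_mult)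
  have N': "?N' = (\<integral>\<^sup>+ x. ennreal (inverse (metric_ratio h' x) * ?g x) \<partial>vol)"
    unfolding N_laplacian_metric_ratio[OF h' \<xi>] by (simp add: divide_inverse mult.commute)
  have "?N' \<le> (\<integral>\<^sup>+ x. ennreal ((1 + 2 * e) * ?g x) \<partial>vol)"
    unfolding N' by (intro nn_integral_mono ennreal_leI mult_right_mono inv g)
  also have "\<dots> = ennreal (1 + 2 * e) * ?N" using e by (intro cmult) simp
  finally have "enn2real ?N' \<le> enn2real (ennreal (1 + 2 * e) * ?N)"
    using fin by (intro enn2real_mono) (simp_all add: ennreal_mult_less_top)
  moreover have "enn2real (ennreal (1 + 2 * e)) = 1 + 2 * e" using e by (intro enn2real_ennreal) simp
  ultimately have up: "enn2real ?N' \<le> (1 + 2 * e) * enn2real ?N" by (simp only: enn2real_mult)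
  have "ennreal (1 - 2 * e) * ?N = (\<integral>\<^sup>+ x. ennreal ((1 - 2 * e) * ?g x) \<partial>vol)"
    using e by (intro cmult[symmetric]) simp
  also have "\<dots> \<le> ?N'"
    unfolding N' by (intro nn_integral_mono ennreal_leI mult_right_mono inv g)
  finally have "enn2real (ennreal (1 - 2 * e) * ?N) \<le> enn2real ?N'"
    using fin by (intro enn2real_mono) simp_all
  moreover have "enn2real (ennreal (1 - 2 * e)) = 1 - 2 * e" using e by (intro enn2real_ennreal) simp
  ultimately have "(1 - 2 * e) * enn2real ?N \<le> enn2real ?N'" by (simp only: enn2real_mult)
  with up show ?thesis by (simp add: abs_le_iff algebra_simps)
qed

lemma N_laplacian_tendsto:
  assumes H: "\<forall>\<^sub>F u in F. continuous_metric (tangent_bundle A) (H u)" and \<xi>: "\<xi> \<in> A00 A"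
    and conv: "metrics_converge_uniformly (tangent_bundle A) H h F"
  shows "((\<lambda>u. l2_norm_sq A hO (H u) (laplacian A (H u) \<xi>)) \<longlongrightarrow> N (laplacian A h \<xi>)) F"
proof -
  let ?n = "enn2real (N (laplacian A h \<xi>))"
  let ?n' = "\<lambda>u. enn2real (l2_norm_sq A hO (H u) (laplacian A (H u) \<xi>))"
  have "(?n' \<longlongrightarrow> ?n) F"
  proof (rule tendstoI)
    fix \<epsilon> :: real assume \<epsilon>: "\<epsilon> > 0"
    \<comment> \<open>The summand 1 keeps the denominator positive when the limit is 0; with this
      choice 2 e n is at most \<epsilon>/2.\<close>
    define e where "e = min (1 / 2) (\<epsilon> / (4 * (?n + 1)))"
    have "0 < \<epsilon> / (4 * (?n + 1))" using \<epsilon> by (intro divide_pos_pos mult_pos_pos add_nonneg_pos) simp_all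
    then have e: "0 < e" by (simp only: e_def)
    have e': "e \<le> 1 / 2" "e \<le> \<epsilon> / (4 * (?n + 1))"
      unfolding e_def by (rule min.cobounded1 min.cobounded2)+
    have "2 * e * ?n \<le> 2 * e * (?n + 1)" using e by (intro mult_left_mono) auto
    also have "\<dots> \<le> 2 * (\<epsilon> / (4 * (?n + 1))) * (?n + 1)" using e' by (intro mult_right_mono mult_left_mono) auto
    also have "\<dots> = \<epsilon> / 2"
    proof -
      have "?n + 1 > 0" by (simp add: add_nonneg_pos)
      then show ?thesis by (simp add: field_simps)
    qed
    also have "\<dots> < \<epsilon>" using \<epsilon> by simp
    finally have small: "2 * e * ?n < \<epsilon>" .
    have "\<forall>\<^sub>F u in F. \<forall>c\<in>A. \<forall>x\<in>fst c. \<bar>H u c x / h c x - 1\<bar> < e"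
      using conv e unfolding metrics_converge_uniformly_def tangent_bundle_simps by blast
    with H show "\<forall>\<^sub>F u in F. dist (?n' u) ?n < \<epsilon>"
    proof eventually_elim
      case (elim u)
      have "\<bar>?n' u - ?n\<bar> \<le> 2 * e * ?n"
        by (rule N_laplacian_bounds[OF elim(1) \<xi> e e'(1)]) (use elim(2) in blast)
      with small show ?case by (simp add: dist_real_def)
    qed
  qed
  \<comment> \<open>All the norms involved are finite, so the limit of real numbers transfers back
    to the extended values.\<close>
  then have "((\<lambda>u. ennreal (?n' u)) \<longlongrightarrow> ennreal ?n) F" by (rule tendsto_ennrealI)
  moreover have "\<forall>\<^sub>F u in F. ennreal (?n' u) = l2_norm_sq A hO (H u) (laplacian A (H u) \<xi>)"
    using H
  proof eventually_elim
    case (elim u)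
    interpret u: l2_surface A "H u" hO r by unfold_locales (fact elim r_pos hO_eq)+
    show ?case using u.l2_norm_laplacian_finite[OF \<xi>] by simp
  qed
  moreover have "ennreal ?n = N (laplacian A h \<xi>)"
    using l2_norm_laplacian_finite[OF \<xi>] by simp
  ultimately show ?thesis using tendsto_cong by fastforce
qed

end

section \<open>Metrics on the tangent bundle\<close>

lemma tensor_dual_simps [simp]:
  "lb_index (tensor_bundle L M) = lb_index L \<times> lb_index M"
  "lb_dom (tensor_bundle L M) (i, j) = lb_dom L i \<inter> lb_dom M j"
  "lb_trans (tensor_bundle L M) (i, j) (i', j') x = lb_trans L i i' x * lb_trans M j j' x"
  "lb_index (dual_bundle L) = lb_index L" "lb_dom (dual_bundle L) = lb_dom L"
  "lb_trans (dual_bundle L) i i' x = inverse (lb_trans L i i' x)"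
  by (simp_all add: tensor_bundle_def dual_bundle_def)

lemma index_at_line_bundle:
  assumes "holomorphic_line_bundle A L"
  shows "index_at L x \<in> lb_index L" "x \<in> lb_dom L (index_at L x)"
proof -
  have "x \<in> (\<Union>i\<in>lb_index L. lb_dom L i)" using assms unfolding holomorphic_line_bundle_def by blast
  then have "\<exists>i. i \<in> lb_index L \<and> x \<in> lb_dom L i" by blast
  from someI_ex[OF this] show "index_at L x \<in> lb_index L" "x \<in> lb_dom L (index_at L x)"
    by (simp_all add: index_at_def)
qed

text \<open>The cocycle condition makes the value idempotent, and it is nonzero.\<close>

lemma line_bundle_trans_self:
  assumes "holomorphic_line_bundle A L" "i \<in> lb_index L" "x \<in> lb_dom L i"
  shows "lb_trans L i i x = 1"
proof -
  have "lb_trans L i i x * lb_trans L i i x = lb_trans L i i x" "lb_trans L i i x \<noteq> 0"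
    using assms unfolding holomorphic_line_bundle_def by blast+
  then show ?thesis by simp
qed

lemma hermitian_metricD:
  assumes "hermitian_metric L h" "i \<in> lb_index L" "x \<in> lb_dom L i"
  shows "h i x > 0"
    and "j \<in> lb_index L \<Longrightarrow> x \<in> lb_dom L j \<Longrightarrow> h j x = (cmod (lb_trans L i j x))\<^sup>2 * h i x"
  using assms unfolding hermitian_metric_def by blast+

locale integrable_tangent = riemann_surface A for A :: "'a::t2_space chart set" +
  fixes L\<^sub>1 :: "('i, 'a) line_bundle" and L\<^sub>2 :: "('j, 'a) line_bundle"
    and f :: "'i \<times> 'j \<Rightarrow> 'a chart \<Rightarrow> 'a \<Rightarrow> complex"
  assumes L: "holomorphic_line_bundle A L\<^sub>1" "holomorphic_line_bundle A L\<^sub>2"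
    and iso: "line_bundle_iso A (tangent_bundle A) (tensor_bundle L\<^sub>1 (dual_bundle L\<^sub>2)) f"
begin

abbreviation "D i j c \<equiv> fst c \<inter> (lb_dom L\<^sub>1 i \<inter> lb_dom L\<^sub>2 j)"

lemma open_D: "c \<in> A \<Longrightarrow> i \<in> lb_index L\<^sub>1 \<Longrightarrow> j \<in> lb_index L\<^sub>2 \<Longrightarrow> open (D i j c)"
  using L unfolding holomorphic_line_bundle_def by (intro open_Int open_chart_dom) blast+

lemma iso_holomorphic:
  assumes "c \<in> A" "i \<in> lb_index L\<^sub>1" "j \<in> lb_index L\<^sub>2"
  shows "holomorphic_on_surface A (D i j c) (f (i, j) c)"
    and "x \<in> D i j c \<Longrightarrow> f (i, j) c x \<noteq> 0"
proof -
  have "(i, j) \<in> lb_index (tensor_bundle L\<^sub>1 (dual_bundle L\<^sub>2))" using assms by simp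
  with assms(1) iso have "holomorphic_on_surface A (fst c \<inter> lb_dom (tensor_bundle L\<^sub>1 (dual_bundle L\<^sub>2)) (i, j)) (f (i, j) c)
      \<and> (\<forall>x\<in>fst c \<inter> lb_dom (tensor_bundle L\<^sub>1 (dual_bundle L\<^sub>2)) (i, j). f (i, j) c x \<noteq> 0)"
    unfolding line_bundle_iso_def tangent_bundle_simps by blast
  then show "holomorphic_on_surface A (D i j c) (f (i, j) c)"
    and "x \<in> D i j c \<Longrightarrow> f (i, j) c x \<noteq> 0" by simp_all
qed

lemma iso_transition:
  assumes "c \<in> A" "d \<in> A" "i \<in> lb_index L\<^sub>1" "i' \<in> lb_index L\<^sub>1" "j \<in> lb_index L\<^sub>2" "j' \<in> lb_index L\<^sub>2"
    and "x \<in> D i j c" "x \<in> D i' j' d"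
  shows "f (i, j) c x * lb_trans (tangent_bundle A) c d x
    = lb_trans L\<^sub>1 i i' x * inverse (lb_trans L\<^sub>2 j j' x) * f (i', j') d x"
proof -
  let ?M = "tensor_bundle L\<^sub>1 (dual_bundle L\<^sub>2)"
  have "(i, j) \<in> lb_index ?M" "(i', j') \<in> lb_index ?M"
    "x \<in> lb_dom (tangent_bundle A) c \<inter> lb_dom (tangent_bundle A) d \<inter> lb_dom ?M (i, j) \<inter> lb_dom ?M (i', j')"
    using assms by simp_all
  moreover have "c \<in> lb_index (tangent_bundle A)" "d \<in> lb_index (tangent_bundle A)"
    using assms by simp_all
  ultimately have "f (i, j) c x * lb_trans (tangent_bundle A) c d x
      = lb_trans ?M (i, j) (i', j') x * f (i', j') d x"
    using iso unfolding line_bundle_iso_def by blast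
  then show ?thesis by (simp only: tensor_dual_simps)
qed

lemma tangent_trans_self:
  assumes "c \<in> A" "x \<in> fst c"
  shows "lb_trans (tangent_bundle A) c c x = 1"
proof -
  have "((snd c \<circ> chart_inv c) has_field_derivative 1) (at (snd c x))"
  proof (rule has_field_derivative_transform_within_open[OF DERIV_ident open_chart_image[OF assms(1)]])
    show "snd c x \<in> snd c ` fst c" using assms(2) by (rule imageI)
    show "z = (snd c \<circ> chart_inv c) z" if "z \<in> snd c ` fst c" for z
      using chart_chart_inv[OF assms(1) that] by simp
  qed
  then show ?thesis unfolding tangent_bundle_simps by (rule DERIV_imp_deriv)
qed

text \<open>The pullback along \<open>f\<close> of the metric on \<open>L\<^sub>1\<close> tensor the
  dual of \<open>L\<^sub>2\<close>. The frames are selected pointwise and may jump, so continuity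
  and smoothness are obtained through \<open>tangent_metric_eq\<close>, which allows fixed
  frames.\<close>

definition tangent_metric :: "('i, 'a) metric \<Rightarrow> ('j, 'a) metric \<Rightarrow> ('a chart, 'a) metric" where
  "tangent_metric k\<^sub>1 k\<^sub>2 c x = (let i = index_at L\<^sub>1 x; j = index_at L\<^sub>2 x in
     (cmod (f (i, j) c x))\<^sup>2 * (k\<^sub>1 i x * inverse (k\<^sub>2 j x)))"

context
  fixes k\<^sub>1 :: "('i, 'a) metric" and k\<^sub>2 :: "('j, 'a) metric"
  assumes k: "hermitian_metric L\<^sub>1 k\<^sub>1" "hermitian_metric L\<^sub>2 k\<^sub>2"
begin

text \<open>A change of frames multiplies the quotient of the two metrics by |g/g'|^2 and |f|^2 by
  the inverse of this factor.\<close>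

lemma tangent_metric_eq:
  assumes c: "c \<in> A" and ij: "i \<in> lb_index L\<^sub>1" "j \<in> lb_index L\<^sub>2" and x: "x \<in> D i j c"
  shows "tangent_metric k\<^sub>1 k\<^sub>2 c x = (cmod (f (i, j) c x))\<^sup>2 * (k\<^sub>1 i x * inverse (k\<^sub>2 j x))"
proof -
  let ?i = "index_at L\<^sub>1 x" and ?j = "index_at L\<^sub>2 x"
  have i: "?i \<in> lb_index L\<^sub>1" "x \<in> lb_dom L\<^sub>1 ?i" by (rule index_at_line_bundle[OF L(1)])+
  have j: "?j \<in> lb_index L\<^sub>2" "x \<in> lb_dom L\<^sub>2 ?j" by (rule index_at_line_bundle[OF L(2)])+
  have xc: "x \<in> fst c" using x by simp
  have x': "x \<in> D ?i ?j c" using x i j by simp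
  let ?g = "lb_trans L\<^sub>1 i ?i x" and ?g' = "lb_trans L\<^sub>2 j ?j x"
  have f: "f (i, j) c x = ?g * inverse ?g' * f (?i, ?j) c x"
    using iso_transition[OF c c ij(1) i(1) ij(2) j(1) x x'] tangent_trans_self[OF c xc] by simp
  have k1: "k\<^sub>1 ?i x = (cmod ?g)\<^sup>2 * k\<^sub>1 i x"
    by (rule hermitian_metricD(2)[OF k(1) ij(1) _ i]) (use x in simp)
  have k2: "k\<^sub>2 ?j x = (cmod ?g')\<^sup>2 * k\<^sub>2 j x"
    by (rule hermitian_metricD(2)[OF k(2) ij(2) _ j]) (use x in simp)
  show ?thesis
    unfolding tangent_metric_def Let_def k1 k2 f
    by (simp add: norm_mult norm_inverse power_mult_distrib power_inverse)
qed

lemma tangent_metric_hermitian: "hermitian_metric (tangent_bundle A) (tangent_metric k\<^sub>1 k\<^sub>2)"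
  unfolding hermitian_metric_def
proof (intro conjI ballI)
  fix c x assume c: "c \<in> lb_index (tangent_bundle A)" "x \<in> lb_dom (tangent_bundle A) c"
  let ?i = "index_at L\<^sub>1 x" and ?j = "index_at L\<^sub>2 x"
  have i: "?i \<in> lb_index L\<^sub>1" "x \<in> lb_dom L\<^sub>1 ?i" by (rule index_at_line_bundle[OF L(1)])+
  have j: "?j \<in> lb_index L\<^sub>2" "x \<in> lb_dom L\<^sub>2 ?j" by (rule index_at_line_bundle[OF L(2)])+
  have cA: "c \<in> A" and xc: "x \<in> D ?i ?j c" using c i j by simp_all
  have "f (?i, ?j) c x \<noteq> 0" by (rule iso_holomorphic(2)[OF cA i(1) j(1) xc])
  then show "tangent_metric k\<^sub>1 k\<^sub>2 c x > 0"
    using hermitian_metricD(1)[OF k(1) i] hermitian_metricD(1)[OF k(2) j]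
    unfolding tangent_metric_eq[OF cA i(1) j(1) xc] by simp
next
  fix c d x assume c: "c \<in> lb_index (tangent_bundle A)" and d: "d \<in> lb_index (tangent_bundle A)"
    and x: "x \<in> lb_dom (tangent_bundle A) c \<inter> lb_dom (tangent_bundle A) d"
  let ?i = "index_at L\<^sub>1 x" and ?j = "index_at L\<^sub>2 x"
  have i: "?i \<in> lb_index L\<^sub>1" "x \<in> lb_dom L\<^sub>1 ?i" by (rule index_at_line_bundle[OF L(1)])+
  have j: "?j \<in> lb_index L\<^sub>2" "x \<in> lb_dom L\<^sub>2 ?j" by (rule index_at_line_bundle[OF L(2)])+
  have cA: "c \<in> A" and dA: "d \<in> A" and xc: "x \<in> D ?i ?j c" and xd: "x \<in> D ?i ?j d"
    using c d x i j by simp_all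
  \<comment> \<open>Using the same frames of \<open>L\<^sub>1\<close> and \<open>L\<^sub>2\<close>
    for both charts reduces the compatibility of \<open>f\<close> to the tangent transition
    function.\<close>
  have "f (?i, ?j) d x = f (?i, ?j) c x * lb_trans (tangent_bundle A) c d x"
    unfolding iso_transition[OF cA dA i(1) i(1) j(1) j(1) xc xd] line_bundle_trans_self[OF L(1) i]
      line_bundle_trans_self[OF L(2) j] by simp
  then show "tangent_metric k\<^sub>1 k\<^sub>2 d x
      = (cmod (lb_trans (tangent_bundle A) c d x))\<^sup>2 * tangent_metric k\<^sub>1 k\<^sub>2 c x"
    unfolding tangent_metric_eq[OF cA i(1) j(1) xc] tangent_metric_eq[OF dA i(1) j(1) xd]
    by (simp only: norm_mult power_mult_distrib mult_ac)
qed

end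

lemma tangent_metric_smooth:
  assumes "smooth_metric A L\<^sub>1 k\<^sub>1" "smooth_metric A L\<^sub>2 k\<^sub>2"
  shows "smooth_metric A (tangent_bundle A) (tangent_metric k\<^sub>1 k\<^sub>2)"
proof -
  have k: "hermitian_metric L\<^sub>1 k\<^sub>1" "hermitian_metric L\<^sub>2 k\<^sub>2"
    and sm: "\<And>i. i \<in> lb_index L\<^sub>1 \<Longrightarrow> smooth_on_surface A (lb_dom L\<^sub>1 i) (k\<^sub>1 i)"
      "\<And>j. j \<in> lb_index L\<^sub>2 \<Longrightarrow> smooth_on_surface A (lb_dom L\<^sub>2 j) (k\<^sub>2 j)"
    using assms unfolding smooth_metric_def by blast+
  have "smooth_on_surface A (fst c) (tangent_metric k\<^sub>1 k\<^sub>2 c)" if c: "c \<in> A" for c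
  proof (rule smooth_on_surface_local)
    fix x assume x: "x \<in> fst c"
    let ?i = "index_at L\<^sub>1 x" and ?j = "index_at L\<^sub>2 x"
    have i: "?i \<in> lb_index L\<^sub>1" "x \<in> lb_dom L\<^sub>1 ?i" by (rule index_at_line_bundle[OF L(1)])+
    have j: "?j \<in> lb_index L\<^sub>2" "x \<in> lb_dom L\<^sub>2 ?j" by (rule index_at_line_bundle[OF L(2)])+
    \<comment> \<open>The frames selected at \<open>x\<close> are kept fixed on this neighbourhood,
      where one smooth formula then describes the metric.\<close>
    let ?V = "D ?i ?j c"
    have op: "open ?V" by (rule open_D[OF c i(1) j(1)])
    have k2: "k\<^sub>2 ?j y \<noteq> 0" if "y \<in> ?V" for y
      using hermitian_metricD(1)[OF k(2) j(1), of y] that by simp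
    have "smooth_on_surface A ?V (\<lambda>y. (cmod (f (?i, ?j) c y))\<^sup>2 * (k\<^sub>1 ?i y * inverse (k\<^sub>2 ?j y)))"
      by (intro smooth_on_surface_bilinear[OF bounded_bilinear_mult] smooth_on_surface_cmod_power2
          smooth_on_surface_holomorphic smooth_on_surface_inverse op iso_holomorphic(1)[OF c i(1) j(1)] k2
          smooth_on_surface_subset[OF sm(1)[OF i(1)]] smooth_on_surface_subset[OF sm(2)[OF j(1)]]) auto
    then have "smooth_on_surface A ?V (tangent_metric k\<^sub>1 k\<^sub>2 c)"
      by (rule smooth_on_surface_cong[OF op tangent_metric_eq[OF k c i(1) j(1)], rotated])
    moreover have "x \<in> ?V" using x i j by simp
    ultimately show "\<exists>V. open V \<and> x \<in> V \<and> smooth_on_surface A V (tangent_metric k\<^sub>1 k\<^sub>2 c)"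
      using op by blast
  qed
  then show ?thesis
    unfolding smooth_metric_def tangent_bundle_simps using tangent_metric_hermitian[OF k] by blast
qed

lemma tangent_metric_continuous:
  assumes "continuous_metric L\<^sub>1 k\<^sub>1" "continuous_metric L\<^sub>2 k\<^sub>2"
  shows "continuous_metric (tangent_bundle A) (tangent_metric k\<^sub>1 k\<^sub>2)"
proof -
  have k: "hermitian_metric L\<^sub>1 k\<^sub>1" "hermitian_metric L\<^sub>2 k\<^sub>2"
    and ct: "\<And>i. i \<in> lb_index L\<^sub>1 \<Longrightarrow> continuous_on (lb_dom L\<^sub>1 i) (k\<^sub>1 i)"
      "\<And>j. j \<in> lb_index L\<^sub>2 \<Longrightarrow> continuous_on (lb_dom L\<^sub>2 j) (k\<^sub>2 j)"
    using assms unfolding continuous_metric_def by blast+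
  have "continuous_on (fst c) (tangent_metric k\<^sub>1 k\<^sub>2 c)" if c: "c \<in> A" for c
  proof (rule continuous_on_local)
    fix x assume x: "x \<in> fst c"
    let ?i = "index_at L\<^sub>1 x" and ?j = "index_at L\<^sub>2 x"
    have i: "?i \<in> lb_index L\<^sub>1" "x \<in> lb_dom L\<^sub>1 ?i" by (rule index_at_line_bundle[OF L(1)])+
    have j: "?j \<in> lb_index L\<^sub>2" "x \<in> lb_dom L\<^sub>2 ?j" by (rule index_at_line_bundle[OF L(2)])+
    let ?V = "D ?i ?j c"
    have op: "open ?V" by (rule open_D[OF c i(1) j(1)])
    have k2: "\<forall>y\<in>?V. k\<^sub>2 ?j y \<noteq> 0"
      using hermitian_metricD(1)[OF k(2) j(1)] by fastforce
    have "continuous_on ?V (f (?i, ?j) c)"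
      by (intro smooth_on_surface_imp_continuous_on smooth_on_surface_holomorphic op
          iso_holomorphic(1)[OF c i(1) j(1)])
    moreover have "continuous_on ?V (k\<^sub>1 ?i)" "continuous_on ?V (k\<^sub>2 ?j)"
      by (auto intro: continuous_on_subset[OF ct(1)[OF i(1)]] continuous_on_subset[OF ct(2)[OF j(1)]])
    ultimately have "continuous_on ?V (\<lambda>y. (cmod (f (?i, ?j) c y))\<^sup>2 * (k\<^sub>1 ?i y * inverse (k\<^sub>2 ?j y)))"
      using k2 by (intro continuous_intros) auto
    then have "continuous_on ?V (tangent_metric k\<^sub>1 k\<^sub>2 c)"
      by (rule continuous_on_eq) (rule tangent_metric_eq[OF k c i(1) j(1), symmetric])
    moreover have "x \<in> ?V" using x i j by simp
    ultimately show "\<exists>V. open V \<and> x \<in> V \<and> continuous_on V (tangent_metric k\<^sub>1 k\<^sub>2 c)"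
      using op by blast
  qed
  then show ?thesis
    unfolding continuous_metric_def tangent_bundle_simps using tangent_metric_hermitian[OF k] by blast
qed

lemma tangent_metric_isometry:
  assumes k: "hermitian_metric L\<^sub>1 k\<^sub>1" "hermitian_metric L\<^sub>2 k\<^sub>2"
    and isom: "isometry_of_metrics (tangent_bundle A) (tensor_bundle L\<^sub>1 (dual_bundle L\<^sub>2)) f
      h (tensor_metric k\<^sub>1 (dual_metric k\<^sub>2))"
    and c: "c \<in> A" "x \<in> fst c"
  shows "h c x = tangent_metric k\<^sub>1 k\<^sub>2 c x"
proof -
  let ?i = "index_at L\<^sub>1 x" and ?j = "index_at L\<^sub>2 x"
  have i: "?i \<in> lb_index L\<^sub>1" "x \<in> lb_dom L\<^sub>1 ?i" by (rule index_at_line_bundle[OF L(1)])+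
  have j: "?j \<in> lb_index L\<^sub>2" "x \<in> lb_dom L\<^sub>2 ?j" by (rule index_at_line_bundle[OF L(2)])+
  have "c \<in> lb_index (tangent_bundle A)"
    "(?i, ?j) \<in> lb_index (tensor_bundle L\<^sub>1 (dual_bundle L\<^sub>2))"
    "x \<in> lb_dom (tangent_bundle A) c \<inter> lb_dom (tensor_bundle L\<^sub>1 (dual_bundle L\<^sub>2)) (?i, ?j)"
    using c i j by simp_all
  then have "h c x = (cmod (f (?i, ?j) c x))\<^sup>2 * tensor_metric k\<^sub>1 (dual_metric k\<^sub>2) (?i, ?j) x"
    using isom unfolding isometry_of_metrics_def by blast
  then show ?thesis by (simp add: tangent_metric_def Let_def tensor_metric_def dual_metric_def)
qed

text \<open>The factor |f|^2 cancels in the quotient of the two tangent metrics, which becomes the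
  quotient a / b of the ratios on \<open>L\<^sub>1\<close> and \<open>L\<^sub>2\<close>.\<close>

lemma tangent_metric_converge:
  assumes k: "hermitian_metric L\<^sub>1 k\<^sub>1" "hermitian_metric L\<^sub>2 k\<^sub>2"
    and conv: "metrics_converge_uniformly L\<^sub>1 ks\<^sub>1 k\<^sub>1 F" "metrics_converge_uniformly L\<^sub>2 ks\<^sub>2 k\<^sub>2 F"
  shows "metrics_converge_uniformly (tangent_bundle A) (\<lambda>n. tangent_metric (ks\<^sub>1 n) (ks\<^sub>2 n))
    (tangent_metric k\<^sub>1 k\<^sub>2) F"
  unfolding metrics_converge_uniformly_def
proof (intro allI impI)
  fix \<epsilon> :: real assume \<epsilon>: "\<epsilon> > 0"
  \<comment> \<open>The bound 1/2 keeps the ratio b above 1/2; with |a - b| < 2e this gives |a/b -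
    1| < 4e, whence the quarter of \<epsilon>.\<close>
  define e where "e = min (1 / 2) (\<epsilon> / 4)"
  have e: "e > 0" "e \<le> 1 / 2" "4 * e \<le> \<epsilon>" using \<epsilon> by (auto simp: e_def)
  have "\<forall>\<^sub>F n in F. \<forall>i\<in>lb_index L\<^sub>1. \<forall>x\<in>lb_dom L\<^sub>1 i. \<bar>ks\<^sub>1 n i x / k\<^sub>1 i x - 1\<bar> < e"
    "\<forall>\<^sub>F n in F. \<forall>j\<in>lb_index L\<^sub>2. \<forall>x\<in>lb_dom L\<^sub>2 j. \<bar>ks\<^sub>2 n j x / k\<^sub>2 j x - 1\<bar> < e"
    using conv e(1) unfolding metrics_converge_uniformly_def by blast+
  then show "\<forall>\<^sub>F n in F. \<forall>c\<in>lb_index (tangent_bundle A). \<forall>x\<in>lb_dom (tangent_bundle A) c.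
      \<bar>tangent_metric (ks\<^sub>1 n) (ks\<^sub>2 n) c x / tangent_metric k\<^sub>1 k\<^sub>2 c x - 1\<bar> < \<epsilon>"
  proof eventually_elim
    case (elim n)
    show ?case
    proof (intro ballI)
      fix c x assume c: "c \<in> lb_index (tangent_bundle A)" "x \<in> lb_dom (tangent_bundle A) c"
      let ?i = "index_at L\<^sub>1 x" and ?j = "index_at L\<^sub>2 x"
      have i: "?i \<in> lb_index L\<^sub>1" "x \<in> lb_dom L\<^sub>1 ?i" by (rule index_at_line_bundle[OF L(1)])+
      have j: "?j \<in> lb_index L\<^sub>2" "x \<in> lb_dom L\<^sub>2 ?j" by (rule index_at_line_bundle[OF L(2)])+
      have cA: "c \<in> A" and xc: "x \<in> D ?i ?j c" using c i j by simp_all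
      have f0: "f (?i, ?j) c x \<noteq> 0" by (rule iso_holomorphic(2)[OF cA i(1) j(1) xc])
      have k0: "k\<^sub>1 ?i x > 0" "k\<^sub>2 ?j x > 0"
        by (rule hermitian_metricD(1)[OF k(1) i] hermitian_metricD(1)[OF k(2) j])+
      define a where "a = ks\<^sub>1 n ?i x / k\<^sub>1 ?i x"
      define b where "b = ks\<^sub>2 n ?j x / k\<^sub>2 ?j x"
      have a: "\<bar>a - 1\<bar> < e" using elim(1) i unfolding a_def by blast
      have b: "\<bar>b - 1\<bar> < e" using elim(2) j unfolding b_def by blast
      have b2: "b > 1 / 2" using b e(2) by linarith
      have "tangent_metric (ks\<^sub>1 n) (ks\<^sub>2 n) c x / tangent_metric k\<^sub>1 k\<^sub>2 c x = a / b"
        unfolding tangent_metric_def Let_def a_def b_def using f0 k0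
        by (simp add: divide_inverse mult_ac)
      moreover have "a / b - 1 = (a - b) / b" using b2 by (simp add: field_simps)
      moreover have "\<bar>(a - b) / b\<bar> < 4 * e"
      proof -
        have "\<bar>a - b\<bar> < 2 * e" using a b by linarith
        also have "\<dots> \<le> 4 * e * b" using b2 e(1) mult_left_mono[of "1/2" b "4 * e"] by simp
        finally show ?thesis using b2 by (simp add: abs_divide pos_divide_less_eq)
      qed
      ultimately show "\<bar>tangent_metric (ks\<^sub>1 n) (ks\<^sub>2 n) c x / tangent_metric k\<^sub>1 k\<^sub>2 c x - 1\<bar> < \<epsilon>"
        using e(3) by simp
    qed
  qed
qed

end

lemma (in riemann_surface) smooth_imp_continuous_metric:
  assumes "smooth_metric A (tangent_bundle A) h"
  shows "continuous_metric (tangent_bundle A) h"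
  using assms smooth_on_surface_imp_continuous_on[OF open_chart_dom]
  unfolding smooth_metric_def continuous_metric_def tangent_bundle_simps by blast

theorem theorem1p1:
  fixes A :: "'a::t2_space chart set"
    and hO :: "(unit, 'a) metric"
    and L\<^sub>1 :: "('i, 'a) line_bundle"
    and L\<^sub>2 :: "('j, 'a) line_bundle"
    and h_inf :: "('a chart, 'a) metric"
  assumes "compact_riemann_surface A"
    and "constant_metric hO"
    and "integrable_metric A L\<^sub>1 L\<^sub>2 h_inf"
  shows "\<exists>h :: real \<Rightarrow> ('a chart, 'a) metric.
     (\<forall>u\<ge>1. smooth_metric A (tangent_bundle A) (h u))
     \<and> metrics_converge_uniformly (tangent_bundle A) h h_inf at_top
     \<and> (\<forall>\<xi>\<in>A00 A.
          ((\<lambda>u. l2_norm_sq A hO (h u) (laplacian A (h u) \<xi>))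
             \<longlongrightarrow> l2_norm_sq A hO h_inf (laplacian A h_inf \<xi>)) at_top
          \<and> l2_norm_sq A hO h_inf (laplacian A h_inf \<xi>) < \<infinity>)
     \<and> linear_operator_into_H0 A hO h_inf (\<lambda>\<xi>. H0_class A hO h_inf (laplacian A h_inf \<xi>))
     \<and> (\<forall>\<xi>\<in>A00 A. \<forall>\<xi>'\<in>A00 A.
          l2_prod A hO h_inf (laplacian A h_inf \<xi>) \<xi>' = l2_prod A hO h_inf \<xi> (laplacian A h_inf \<xi>'))
     \<and> (\<forall>\<xi>\<in>A00 A. l2_prod A hO h_inf (laplacian A h_inf \<xi>) \<xi> \<in> \<real>\<^sub>\<ge>\<^sub>0)"
proof -
  obtain h\<^sub>1 h\<^sub>2 f where L: "holomorphic_line_bundle A L\<^sub>1" "holomorphic_line_bundle A L\<^sub>2"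
    and herm: "hermitian_metric (tangent_bundle A) h_inf"
    and adm: "admissible_metric A L\<^sub>1 h\<^sub>1" "admissible_metric A L\<^sub>2 h\<^sub>2"
    and iso: "line_bundle_iso A (tangent_bundle A) (tensor_bundle L\<^sub>1 (dual_bundle L\<^sub>2)) f"
    and isom: "isometry_of_metrics (tangent_bundle A) (tensor_bundle L\<^sub>1 (dual_bundle L\<^sub>2)) f
      h_inf (tensor_metric h\<^sub>1 (dual_metric h\<^sub>2))"
    using assms(3) unfolding integrable_metric_def by blast
  obtain hs\<^sub>1 where hs1: "\<And>n::nat. smooth_metric A L\<^sub>1 (hs\<^sub>1 n)"
    "metrics_converge_uniformly L\<^sub>1 hs\<^sub>1 h\<^sub>1 sequentially" and h1: "continuous_metric L\<^sub>1 h\<^sub>1"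
    using adm(1) unfolding admissible_metric_def by blast
  obtain hs\<^sub>2 where hs2: "\<And>n::nat. smooth_metric A L\<^sub>2 (hs\<^sub>2 n)"
    "metrics_converge_uniformly L\<^sub>2 hs\<^sub>2 h\<^sub>2 sequentially" and h2: "continuous_metric L\<^sub>2 h\<^sub>2"
    using adm(2) unfolding admissible_metric_def by blast
  interpret integrable_tangent A L\<^sub>1 L\<^sub>2 f by unfold_locales (fact assms(1) L iso)+
  have k: "hermitian_metric L\<^sub>1 h\<^sub>1" "hermitian_metric L\<^sub>2 h\<^sub>2"
    using h1 h2 by (simp_all add: continuous_metric_def)
  have eq: "h_inf c x = tangent_metric h\<^sub>1 h\<^sub>2 c x" if "c \<in> A" "x \<in> fst c" for c x
    by (rule tangent_metric_isometry[OF k isom that])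
  \<comment> \<open>\<open>integrable_metric\<close> makes \<open>h_inf\<close> a hermitian metric;
    its continuity comes from the isometry with a quotient of continuous metrics.\<close>
  have cont: "continuous_metric (tangent_bundle A) h_inf"
    unfolding continuous_metric_def
  proof (intro conjI ballI herm)
    fix c assume "c \<in> lb_index (tangent_bundle A)"
    then have c: "c \<in> A" by simp
    have "continuous_on (fst c) (tangent_metric h\<^sub>1 h\<^sub>2 c)"
      using tangent_metric_continuous[OF h1 h2] c
      unfolding continuous_metric_def tangent_bundle_simps by blast
    then have "continuous_on (fst c) (h_inf c)"
      by (rule continuous_on_eq) (simp add: eq[OF c])
    then show "continuous_on (lb_dom (tangent_bundle A) c) (h_inf c)" by simp
  qed
  obtain r where r: "\<And>x. hO () x = r" using assms(2) by (auto simp: constant_metric_def)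
  \<comment> \<open>\<open>undefined\<close> merely names a point of X at which the sign of the
    constant is read off.\<close>
  have "hO () undefined > 0"
    using assms(2) by (auto simp: constant_metric_def hermitian_metric_def trivial_bundle_def)
  then have r_pos: "r > 0" by (simp add: r)
  interpret l2_surface A h_inf hO r by unfold_locales (fact cont r_pos r)+
  \<comment> \<open>The parameter is real while the approximating sequences are indexed by natural
    numbers, so the family is made constant on each interval [n, n + 1).\<close>
  define H where "H = (\<lambda>u::real. tangent_metric (hs\<^sub>1 (nat \<lfloor>u\<rfloor>)) (hs\<^sub>2 (nat \<lfloor>u\<rfloor>)))"
  have smooth: "smooth_metric A (tangent_bundle A) (H u)" for u
    unfolding H_def by (rule tangent_metric_smooth[OF hs1(1) hs2(1)])
  have conv: "metrics_converge_uniformly (tangent_bundle A) H h_inf at_top"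
    unfolding metrics_converge_uniformly_def
  proof (intro allI impI)
    fix \<epsilon> :: real assume "\<epsilon> > 0"
    then have "\<forall>\<^sub>F n in sequentially. \<forall>c\<in>A. \<forall>x\<in>fst c.
        \<bar>tangent_metric (hs\<^sub>1 n) (hs\<^sub>2 n) c x / tangent_metric h\<^sub>1 h\<^sub>2 c x - 1\<bar> < \<epsilon>"
      using tangent_metric_converge[OF k hs1(2) hs2(2)]
      unfolding metrics_converge_uniformly_def tangent_bundle_simps by blast
    then have "\<forall>\<^sub>F n in sequentially. \<forall>c\<in>A. \<forall>x\<in>fst c.
        \<bar>tangent_metric (hs\<^sub>1 n) (hs\<^sub>2 n) c x / h_inf c x - 1\<bar> < \<epsilon>"
      by (rule eventually_mono) (simp add: eq)
    moreover have "filterlim (\<lambda>u::real. nat \<lfloor>u\<rfloor>) sequentially at_top"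
      by (rule filterlim_compose[OF filterlim_nat_sequentially filterlim_floor_sequentially])
    ultimately show "\<forall>\<^sub>F u in at_top. \<forall>c\<in>lb_index (tangent_bundle A). \<forall>x\<in>lb_dom (tangent_bundle A) c.
        \<bar>H u c x / h_inf c x - 1\<bar> < \<epsilon>"
      unfolding H_def tangent_bundle_simps by (rule eventually_compose_filterlim)
  qed
  show ?thesis
  proof (rule exI[of _ H], intro conjI allI impI ballI)
    show "((\<lambda>u. l2_norm_sq A hO (H u) (laplacian A (H u) \<xi>))
        \<longlongrightarrow> l2_norm_sq A hO h_inf (laplacian A h_inf \<xi>)) at_top" if "\<xi> \<in> A00 A" for \<xi>
      using smooth_imp_continuous_metric[OF smooth]
      by (intro N_laplacian_tendsto always_eventually allI that conv)
    show "smooth_metric A (tangent_bundle A) (H u)" for u by (rule smooth)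
    show "metrics_converge_uniformly (tangent_bundle A) H h_inf at_top" by (rule conv)
    show "linear_operator_into_H0 A hO h_inf (\<lambda>\<xi>. H0_class A hO h_inf (laplacian A h_inf \<xi>))"
      by (rule laplacian_linear_operator)
    show "l2_norm_sq A hO h_inf (laplacian A h_inf \<xi>) < \<infinity>" if "\<xi> \<in> A00 A" for \<xi>
      using that by (rule l2_norm_laplacian_finite)
    show "l2_prod A hO h_inf (laplacian A h_inf \<xi>) \<xi>' = l2_prod A hO h_inf \<xi> (laplacian A h_inf \<xi>')"
      if "\<xi> \<in> A00 A" "\<xi>' \<in> A00 A" for \<xi> \<xi>'
      using that by (rule l2_prod_laplacian_symmetric)
    show "l2_prod A hO h_inf (laplacian A h_inf \<xi>) \<xi> \<in> \<real>\<^sub>\<ge>\<^sub>0" if "\<xi> \<in> A00 A" for \<xi>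
      using that by (rule l2_prod_laplacian_nonneg)
  qed
qed

end
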